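(* Let $\mathcal{C}$ be an extriangulated category. Then there exist mutually inverse bijections $$\Phi:\{\text{bounded hereditary cotorsion pairs in }\mathcal{C}\}\to\mathsf{silt}\,\mathcal{C},\qquad \Psi:\mathsf{silt}\,\mathcal{C}\to\{\text{bounded hereditary cotorsion pairs in }\mathcal{C}\},$$ where $\Phi(\mathcal{X},\mathcal{Y}):=\mathcal{X}\cap\mathcal{Y}$ and $\Psi(\mathcal{M}):=(\mathcal{M}^{\vee},\mathcal{M}^{\wedge})$.
   Context: Conventions: $R$ is a commutative unital ring; $\mathcal{C}$ is a small additive $R$-linear category; all subcategories are full, additive and closed under isomorphisms. Extriangulated category (Nakaoka--Palu): a triple $(\mathcal{C},\mathbb{E},\mathfrak{s})$ with $\mathbb{E}:\mathcal{C}^{\mathrm{op}}\times\mathcal{C}\to \mathrm{Mod}\,R$ an $R$-bilinear functor and $\mathfrak{s}$ assigning to each $\delta\in\mathbb{E}(C,A)$ an equivalence class $\mathfrak{s}(\delta)=[A\to B\to C]$ of complexes (equivalence: an isomorphism of middle terms compatible with identities of $A$ and $C$). Write $a_*\delta=\mathbb{E}(C,a)(\delta)$, $c^*\delta=\mathbb{E}(c,A)(\delta)$. Axioms: (i) $\mathfrak{s}(0)$ is the split class $[A\to A\oplus C\to C]$ and $\mathfrak{s}(\delta\oplus\delta')=\mathfrak{s}(\delta)\oplus\mathfrak{s}(\delta')$; (ii) for $\mathfrak{s}(\delta)=[A\xrightarrow{f}B\xrightarrow{g}C]$, $\mathfrak{s}(\delta')=[A'\xrightarrow{f'}B'\xrightarrow{g'}C']$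 and $a:A\to A'$, $c:C\to C'$ with $a_*\delta=c^*\delta'$, there is $b$ with $bf=f'a$, $g'b=cg$; (iii) (ET3) for $a,b$ with $bf=f'a$ there is $c$ with $cg=g'b$ and $a_*\delta=c^*\delta'$, and dually (ET3)$^{\mathrm{op}}$; (iv) (ET4) if $\mathfrak{s}(\delta)=[A\xrightarrow{f}B\xrightarrow{f'}D]$ and $\mathfrak{s}(\delta')=[B\xrightarrow{g}C\xrightarrow{g'}F]$, there are $E$, $h:C\to E$, $d:D\to E$, $e:E\to F$ and $\delta''\in\mathbb{E}(E,A)$ with $\mathfrak{s}(\delta'')=[A\xrightarrow{gf}C\xrightarrow{h}E]$, $hg=df'$, $eh=g'$, $\mathfrak{s}(f'_*\delta')=[D\xrightarrow{d}E\xrightarrow{e}F]$, $d^*\delta''=\delta$, $f_*\delta''=e^*\delta'$, and dually (ET4)$^{\mathrm{op}}$. A complex $A\to B\to C$ with $[A\to B\to C]=\mathfrak{s}(\delta)$ for some $\delta$ is an $\mathfrak{s}$-conflation, written $A\to B\to C\dashrightarrow$. Higher extensions (Gorsky--Nakaoka--Palu): $\mathbb{E}^1=\mathbb{E}$ and $\mathbb{E}^{n}(C,A)=\int^{X\in\mathcal{C}}\mathbb{E}^{n-1}(X,A)\otimes_R\mathbb{E}(C,X)$ for $n\ge2$. $\mathbb{E}^k(\mathcal{X},\mathcal{Y})=0$ means vanishing on all pairs of objects. For subcategories $\mathcal{X},\mathcal{Y}$: $\mathcal{X}\ast\mathcal{Y}$ consists of $M$ with an $\mathfrak{s}$-conflation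 $X\to M\to Y\dashrightarrow$; $\mathrm{Cone}(\mathcal{X},\mathcal{Y})$ of $M$ with $X\to Y\to M\dashrightarrow$; $\mathrm{Cocone}(\mathcal{X},\mathcal{Y})$ of $M$ with $M\to X\to Y\dashrightarrow$ (always $X\in\mathcal{X}$, $Y\in\mathcal{Y}$). $\mathcal{X}$ is closed under extensions (cones, cocones) if $\mathcal{X}\ast\mathcal{X}\subseteq\mathcal{X}$ (resp. $\mathrm{Cone}(\mathcal{X},\mathcal{X})\subseteq\mathcal{X}$, $\mathrm{Cocone}(\mathcal{X},\mathcal{X})\subseteq\mathcal{X}$). $\mathsf{thick}\,\mathcal{X}$ is the smallest subcategory containing $\mathcal{X}$ and closed under extensions, cones, cocones and direct summands. Put $\mathcal{X}^{\wedge}_{-1}=\mathcal{X}^{\vee}_{-1}=\{0\}$, and for $n\ge0$ $\mathcal{X}^{\wedge}_n=\mathrm{Cone}(\mathcal{X}^{\wedge}_{n-1},\mathcal{X})$, $\mathcal{X}^{\vee}_n=\mathrm{Cocone}(\mathcal{X},\mathcal{X}^{\vee}_{n-1})$; $\mathcal{X}^{\wedge}=\bigcup_{n\ge0}\mathcal{X}^{\wedge}_n$, $\mathcal{X}^{\vee}=\bigcup_{n\ge0}\mathcal{X}^{\vee}_n$. A cotorsion pair in $\mathcal{C}$ is a pair $(\mathcal{X},\mathcal{Y})$ of subcategories closed under direct summands with $\mathbb{E}(\mathcal{X},\mathcal{Y})=0$, $\mathcal{C}=\mathrm{Cone}(\mathcal{Y},\mathcal{X})$ and $\mathcal{C}=\mathrm{Cocone}(\mathcal{Y},\mathcal{X})$.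 It is hereditary if $\mathbb{E}^k(\mathcal{X},\mathcal{Y})=0$ for all $k\ge2$, and bounded if $\mathcal{C}=\mathcal{X}^{\wedge}$ and $\mathcal{C}=\mathcal{Y}^{\vee}$. A subcategory $\mathcal{M}$ is a silting subcategory of $\mathcal{C}$ if it is closed under direct summands, $\mathbb{E}^k(\mathcal{M},\mathcal{M})=0$ for all $k\ge1$, and $\mathcal{C}=\mathsf{thick}\,\mathcal{M}$. $\mathsf{silt}\,\mathcal{C}$ denotes the set of silting subcategories of $\mathcal{C}$. *)

theory Defs
  imports "HOL-Algebra.Module" "HOL-Library.Multiset"
begin

section \<open>Additive linear categories\<close>

text \<open>
  A small category enriched in \<open>R\<close>-modules. The objects form a set of elements of type
  \<open>'o\<close>, and each \<open>Hom A B\<close> is a module whose elements have type \<open>'m\<close>; the ring-multiplication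
  fields of the module records are irrelevant. \<open>g \<bullet> f\<close> is the composite ``first \<open>f\<close>, then \<open>g\<close>''.
\<close>

record ('o, 'm, 'r) lin_cat =
  Obj :: "'o set"
  Hom :: "'o \<Rightarrow> 'o \<Rightarrow> ('r, 'm) module"
  Dom :: "'m \<Rightarrow> 'o"
  Cod :: "'m \<Rightarrow> 'o"
  Ide :: "'o \<Rightarrow> 'm"
  Comp :: "'m \<Rightarrow> 'm \<Rightarrow> 'm" (infixr \<open>\<bullet>\<index>\<close> 75)

abbreviation homs :: "('o, 'm, 'r, 'z) lin_cat_scheme \<Rightarrow> 'o \<Rightarrow> 'o \<Rightarrow> 'm set" where
  "homs \<C> A B \<equiv> carrier (Hom \<C> A B)"

definition zero_object :: "('o, 'm, 'r, 'z) lin_cat_scheme \<Rightarrow> 'o \<Rightarrow> bool" where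
  "zero_object \<C> Z \<longleftrightarrow> Z \<in> Obj \<C> \<and>
     (\<forall>A\<in>Obj \<C>. homs \<C> Z A = {\<zero>\<^bsub>Hom \<C> Z A\<^esub>} \<and> homs \<C> A Z = {\<zero>\<^bsub>Hom \<C> A Z\<^esub>})"

definition is_biproduct ::
  "('o, 'm, 'r, 'z) lin_cat_scheme \<Rightarrow> 'o \<Rightarrow> 'o \<Rightarrow> 'o \<Rightarrow> 'm \<Rightarrow> 'm \<Rightarrow> 'm \<Rightarrow> 'm \<Rightarrow> bool" where
  "is_biproduct \<C> A B S i j p q \<longleftrightarrow>
     A \<in> Obj \<C> \<and> B \<in> Obj \<C> \<and> S \<in> Obj \<C> \<and>
     i \<in> homs \<C> A S \<and> j \<in> homs \<C> B S \<and> p \<in> homs \<C> S A \<and> q \<in> homs \<C> S B \<and>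
     p \<bullet>\<^bsub>\<C>\<^esub> i = Ide \<C> A \<and> q \<bullet>\<^bsub>\<C>\<^esub> j = Ide \<C> B \<and>
     q \<bullet>\<^bsub>\<C>\<^esub> i = \<zero>\<^bsub>Hom \<C> A B\<^esub> \<and> p \<bullet>\<^bsub>\<C>\<^esub> j = \<zero>\<^bsub>Hom \<C> B A\<^esub> \<and>
     (i \<bullet>\<^bsub>\<C>\<^esub> p) \<oplus>\<^bsub>Hom \<C> S S\<^esub> (j \<bullet>\<^bsub>\<C>\<^esub> q) = Ide \<C> S"

definition is_iso :: "('o, 'm, 'r, 'z) lin_cat_scheme \<Rightarrow> 'o \<Rightarrow> 'o \<Rightarrow> 'm \<Rightarrow> bool" where
  "is_iso \<C> A B f \<longleftrightarrow> A \<in> Obj \<C> \<and> B \<in> Obj \<C> \<and> f \<in> homs \<C> A B \<and>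
     (\<exists>g\<in>homs \<C> B A. g \<bullet>\<^bsub>\<C>\<^esub> f = Ide \<C> A \<and> f \<bullet>\<^bsub>\<C>\<^esub> g = Ide \<C> B)"

locale additive_linear_category = cring R
  for R :: "('r, 'y) ring_scheme" (structure)
  and \<C> :: "('o, 'm, 'r, 'z) lin_cat_scheme" +
  assumes hom_module: "\<lbrakk>A \<in> Obj \<C>; B \<in> Obj \<C>\<rbrakk> \<Longrightarrow> module R (Hom \<C> A B)"
    and hom_Dom_Cod: "\<lbrakk>A \<in> Obj \<C>; B \<in> Obj \<C>; f \<in> homs \<C> A B\<rbrakk> \<Longrightarrow> Dom \<C> f = A \<and> Cod \<C> f = B"
    and Ide_closed: "A \<in> Obj \<C> \<Longrightarrow> Ide \<C> A \<in> homs \<C> A A"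
    and Comp_closed: "\<lbrakk>A \<in> Obj \<C>; B \<in> Obj \<C>; C \<in> Obj \<C>; f \<in> homs \<C> A B; g \<in> homs \<C> B C\<rbrakk>
      \<Longrightarrow> g \<bullet>\<^bsub>\<C>\<^esub> f \<in> homs \<C> A C"
    and Comp_Ide: "\<lbrakk>A \<in> Obj \<C>; B \<in> Obj \<C>; f \<in> homs \<C> A B\<rbrakk> \<Longrightarrow> f \<bullet>\<^bsub>\<C>\<^esub> Ide \<C> A = f"
    and Ide_Comp: "\<lbrakk>A \<in> Obj \<C>; B \<in> Obj \<C>; f \<in> homs \<C> A B\<rbrakk> \<Longrightarrow> Ide \<C> B \<bullet>\<^bsub>\<C>\<^esub> f = f"
    and Comp_assoc: "\<lbrakk>A \<in> Obj \<C>; B \<in> Obj \<C>; C \<in> Obj \<C>; D \<in> Obj \<C>;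
        f \<in> homs \<C> A B; g \<in> homs \<C> B C; h \<in> homs \<C> C D\<rbrakk>
      \<Longrightarrow> (h \<bullet>\<^bsub>\<C>\<^esub> g) \<bullet>\<^bsub>\<C>\<^esub> f = h \<bullet>\<^bsub>\<C>\<^esub> (g \<bullet>\<^bsub>\<C>\<^esub> f)"
    and Comp_add_left: "\<lbrakk>A \<in> Obj \<C>; B \<in> Obj \<C>; C \<in> Obj \<C>;
        f \<in> homs \<C> A B; g \<in> homs \<C> B C; g' \<in> homs \<C> B C\<rbrakk>
      \<Longrightarrow> (g \<oplus>\<^bsub>Hom \<C> B C\<^esub> g') \<bullet>\<^bsub>\<C>\<^esub> f = (g \<bullet>\<^bsub>\<C>\<^esub> f) \<oplus>\<^bsub>Hom \<C> A C\<^esub> (g' \<bullet>\<^bsub>\<C>\<^esub> f)"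
    and Comp_add_right: "\<lbrakk>A \<in> Obj \<C>; B \<in> Obj \<C>; C \<in> Obj \<C>;
        f \<in> homs \<C> A B; f' \<in> homs \<C> A B; g \<in> homs \<C> B C\<rbrakk>
      \<Longrightarrow> g \<bullet>\<^bsub>\<C>\<^esub> (f \<oplus>\<^bsub>Hom \<C> A B\<^esub> f') = (g \<bullet>\<^bsub>\<C>\<^esub> f) \<oplus>\<^bsub>Hom \<C> A C\<^esub> (g \<bullet>\<^bsub>\<C>\<^esub> f')"
    and Comp_smult_left: "\<lbrakk>A \<in> Obj \<C>; B \<in> Obj \<C>; C \<in> Obj \<C>;
        r \<in> carrier R; f \<in> homs \<C> A B; g \<in> homs \<C> B C\<rbrakk>
      \<Longrightarrow> (r \<odot>\<^bsub>Hom \<C> B C\<^esub> g) \<bullet>\<^bsub>\<C>\<^esub> f = r \<odot>\<^bsub>Hom \<C> A C\<^esub> (g \<bullet>\<^bsub>\<C>\<^esub> f)"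
    and Comp_smult_right: "\<lbrakk>A \<in> Obj \<C>; B \<in> Obj \<C>; C \<in> Obj \<C>;
        r \<in> carrier R; f \<in> homs \<C> A B; g \<in> homs \<C> B C\<rbrakk>
      \<Longrightarrow> g \<bullet>\<^bsub>\<C>\<^esub> (r \<odot>\<^bsub>Hom \<C> A B\<^esub> f) = r \<odot>\<^bsub>Hom \<C> A C\<^esub> (g \<bullet>\<^bsub>\<C>\<^esub> f)"
    and ex_zero_object: "\<exists>Z. zero_object \<C> Z"
    and ex_biproduct: "\<lbrakk>A \<in> Obj \<C>; B \<in> Obj \<C>\<rbrakk> \<Longrightarrow> \<exists>S i j p q. is_biproduct \<C> A B S i j p q"


section \<open>Extriangulated categories\<close>

text \<open>
  \<open>Ext C A\<close> is the module \<open>\<bbbE>(C,A)\<close> (contravariant in \<open>C\<close>, covariant in \<open>A\<close>);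
  \<open>push C a\<close> is \<open>\<bbbE>(C,a)\<close>, that is \<open>a\<^sub>*\<close>, and \<open>pull c A\<close> is \<open>\<bbbE>(c,A)\<close>, that is \<open>c\<^sup>*\<close>.
  \<open>realize C A \<delta>\<close> is the class \<open>\<ss>(\<delta>)\<close>, a set of triples \<open>(B, f, g)\<close> standing for
  sequences \<open>A \<rightarrow> B \<rightarrow> C\<close> with maps \<open>f\<close> and \<open>g\<close>.
\<close>

record ('o, 'm, 'r, 'e) extri_cat = "('o, 'm, 'r) lin_cat" +
  Ext :: "'o \<Rightarrow> 'o \<Rightarrow> ('r, 'e) module"
  push :: "'o \<Rightarrow> 'm \<Rightarrow> 'e \<Rightarrow> 'e"
  pull :: "'m \<Rightarrow> 'o \<Rightarrow> 'e \<Rightarrow> 'e"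
  realize :: "'o \<Rightarrow> 'o \<Rightarrow> 'e \<Rightarrow> ('o \<times> 'm \<times> 'm) set"

abbreviation exts :: "('o, 'm, 'r, 'e, 'z) extri_cat_scheme \<Rightarrow> 'o \<Rightarrow> 'o \<Rightarrow> 'e set" where
  "exts \<C> C A \<equiv> carrier (Ext \<C> C A)"

definition is_complex ::
  "('o, 'm, 'r, 'z) lin_cat_scheme \<Rightarrow> 'o \<Rightarrow> 'o \<Rightarrow> 'o \<times> 'm \<times> 'm \<Rightarrow> bool" where
  "is_complex \<C> A C = (\<lambda>(B, f, g). A \<in> Obj \<C> \<and> B \<in> Obj \<C> \<and> C \<in> Obj \<C> \<and>
     f \<in> homs \<C> A B \<and> g \<in> homs \<C> B C \<and> g \<bullet>\<^bsub>\<C>\<^esub> f = \<zero>\<^bsub>Hom \<C> A C\<^esub>)"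

definition complex_equiv ::
  "('o, 'm, 'r, 'z) lin_cat_scheme \<Rightarrow> 'o \<times> 'm \<times> 'm \<Rightarrow> 'o \<times> 'm \<times> 'm \<Rightarrow> bool" where
  "complex_equiv \<C> = (\<lambda>(B, f, g) (B', f', g').
     \<exists>b. is_iso \<C> B B' b \<and> b \<bullet>\<^bsub>\<C>\<^esub> f = f' \<and> g' \<bullet>\<^bsub>\<C>\<^esub> b = g)"

definition complex_class ::
  "('o, 'm, 'r, 'z) lin_cat_scheme \<Rightarrow> 'o \<Rightarrow> 'o \<Rightarrow> 'o \<times> 'm \<times> 'm \<Rightarrow> ('o \<times> 'm \<times> 'm) set" where
  "complex_class \<C> A C s = {t. is_complex \<C> A C t \<and> complex_equiv \<C> s t}"

text \<open>
  In \<open>realize_sum\<close>, the element of \<open>\<bbbE>(C \<oplus> C', A \<oplus> A')\<close> is \<open>\<delta> \<oplus> \<delta>'\<close>: its components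
  under the biproduct decomposition are \<open>\<delta>\<close>, \<open>\<delta>'\<close> and two zeros. The two morphisms are
  \<open>f \<oplus> f'\<close> and \<open>g \<oplus> g'\<close>.
\<close>

locale extriangulated_category = additive_linear_category R \<C>
  for R :: "('r, 'y) ring_scheme" (structure)
  and \<C> :: "('o, 'm, 'r, 'e, 'z) extri_cat_scheme" +
  assumes ext_module: "\<lbrakk>C \<in> Obj \<C>; A \<in> Obj \<C>\<rbrakk> \<Longrightarrow> module R (Ext \<C> C A)"
    \<comment> \<open>functoriality of \<open>\<bbbE>\<close>\<close>
    and push_closed: "\<lbrakk>C \<in> Obj \<C>; A \<in> Obj \<C>; A' \<in> Obj \<C>; a \<in> homs \<C> A A'; \<delta> \<in> exts \<C> C A\<rbrakk>
      \<Longrightarrow> push \<C> C a \<delta> \<in> exts \<C> C A'"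
    and pull_closed: "\<lbrakk>C \<in> Obj \<C>; C' \<in> Obj \<C>; A \<in> Obj \<C>; c \<in> homs \<C> C' C; \<delta> \<in> exts \<C> C A\<rbrakk>
      \<Longrightarrow> pull \<C> c A \<delta> \<in> exts \<C> C' A"
    and push_Ide: "\<lbrakk>C \<in> Obj \<C>; A \<in> Obj \<C>; \<delta> \<in> exts \<C> C A\<rbrakk> \<Longrightarrow> push \<C> C (Ide \<C> A) \<delta> = \<delta>"
    and pull_Ide: "\<lbrakk>C \<in> Obj \<C>; A \<in> Obj \<C>; \<delta> \<in> exts \<C> C A\<rbrakk> \<Longrightarrow> pull \<C> (Ide \<C> C) A \<delta> = \<delta>"
    and push_Comp: "\<lbrakk>C \<in> Obj \<C>; A \<in> Obj \<C>; A' \<in> Obj \<C>; A'' \<in> Obj \<C>;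
        a \<in> homs \<C> A A'; a' \<in> homs \<C> A' A''; \<delta> \<in> exts \<C> C A\<rbrakk>
      \<Longrightarrow> push \<C> C (a' \<bullet>\<^bsub>\<C>\<^esub> a) \<delta> = push \<C> C a' (push \<C> C a \<delta>)"
    and pull_Comp: "\<lbrakk>C \<in> Obj \<C>; C' \<in> Obj \<C>; C'' \<in> Obj \<C>; A \<in> Obj \<C>;
        c \<in> homs \<C> C' C; c' \<in> homs \<C> C'' C'; \<delta> \<in> exts \<C> C A\<rbrakk>
      \<Longrightarrow> pull \<C> (c \<bullet>\<^bsub>\<C>\<^esub> c') A \<delta> = pull \<C> c' A (pull \<C> c A \<delta>)"
    and push_pull: "\<lbrakk>C \<in> Obj \<C>; C' \<in> Obj \<C>; A \<in> Obj \<C>; A' \<in> Obj \<C>;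
        a \<in> homs \<C> A A'; c \<in> homs \<C> C' C; \<delta> \<in> exts \<C> C A\<rbrakk>
      \<Longrightarrow> push \<C> C' a (pull \<C> c A \<delta>) = pull \<C> c A' (push \<C> C a \<delta>)"
    \<comment> \<open>\<open>\<bbbE>\<close> takes values in module homomorphisms\<close>
    and push_add: "\<lbrakk>C \<in> Obj \<C>; A \<in> Obj \<C>; A' \<in> Obj \<C>; a \<in> homs \<C> A A';
        \<delta> \<in> exts \<C> C A; \<delta>' \<in> exts \<C> C A\<rbrakk>
      \<Longrightarrow> push \<C> C a (\<delta> \<oplus>\<^bsub>Ext \<C> C A\<^esub> \<delta>') = push \<C> C a \<delta> \<oplus>\<^bsub>Ext \<C> C A'\<^esub> push \<C> C a \<delta>'"
    and pull_add: "\<lbrakk>C \<in> Obj \<C>; C' \<in> Obj \<C>; A \<in> Obj \<C>; c \<in> homs \<C> C' C;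
        \<delta> \<in> exts \<C> C A; \<delta>' \<in> exts \<C> C A\<rbrakk>
      \<Longrightarrow> pull \<C> c A (\<delta> \<oplus>\<^bsub>Ext \<C> C A\<^esub> \<delta>') = pull \<C> c A \<delta> \<oplus>\<^bsub>Ext \<C> C' A\<^esub> pull \<C> c A \<delta>'"
    and push_smult: "\<lbrakk>C \<in> Obj \<C>; A \<in> Obj \<C>; A' \<in> Obj \<C>; a \<in> homs \<C> A A';
        r \<in> carrier R; \<delta> \<in> exts \<C> C A\<rbrakk>
      \<Longrightarrow> push \<C> C a (r \<odot>\<^bsub>Ext \<C> C A\<^esub> \<delta>) = r \<odot>\<^bsub>Ext \<C> C A'\<^esub> push \<C> C a \<delta>"
    and pull_smult: "\<lbrakk>C \<in> Obj \<C>; C' \<in> Obj \<C>; A \<in> Obj \<C>; c \<in> homs \<C> C' C;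
        r \<in> carrier R; \<delta> \<in> exts \<C> C A\<rbrakk>
      \<Longrightarrow> pull \<C> c A (r \<odot>\<^bsub>Ext \<C> C A\<^esub> \<delta>) = r \<odot>\<^bsub>Ext \<C> C' A\<^esub> pull \<C> c A \<delta>"
    \<comment> \<open>\<open>\<bbbE>\<close> is linear in each morphism variable\<close>
    and add_push: "\<lbrakk>C \<in> Obj \<C>; A \<in> Obj \<C>; A' \<in> Obj \<C>; a \<in> homs \<C> A A'; a' \<in> homs \<C> A A';
        \<delta> \<in> exts \<C> C A\<rbrakk>
      \<Longrightarrow> push \<C> C (a \<oplus>\<^bsub>Hom \<C> A A'\<^esub> a') \<delta> = push \<C> C a \<delta> \<oplus>\<^bsub>Ext \<C> C A'\<^esub> push \<C> C a' \<delta>"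
    and add_pull: "\<lbrakk>C \<in> Obj \<C>; C' \<in> Obj \<C>; A \<in> Obj \<C>; c \<in> homs \<C> C' C; c' \<in> homs \<C> C' C;
        \<delta> \<in> exts \<C> C A\<rbrakk>
      \<Longrightarrow> pull \<C> (c \<oplus>\<^bsub>Hom \<C> C' C\<^esub> c') A \<delta> = pull \<C> c A \<delta> \<oplus>\<^bsub>Ext \<C> C' A\<^esub> pull \<C> c' A \<delta>"
    and smult_push: "\<lbrakk>C \<in> Obj \<C>; A \<in> Obj \<C>; A' \<in> Obj \<C>; r \<in> carrier R; a \<in> homs \<C> A A';
        \<delta> \<in> exts \<C> C A\<rbrakk>
      \<Longrightarrow> push \<C> C (r \<odot>\<^bsub>Hom \<C> A A'\<^esub> a) \<delta> = r \<odot>\<^bsub>Ext \<C> C A'\<^esub> push \<C> C a \<delta>"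
    and smult_pull: "\<lbrakk>C \<in> Obj \<C>; C' \<in> Obj \<C>; A \<in> Obj \<C>; r \<in> carrier R; c \<in> homs \<C> C' C;
        \<delta> \<in> exts \<C> C A\<rbrakk>
      \<Longrightarrow> pull \<C> (r \<odot>\<^bsub>Hom \<C> C' C\<^esub> c) A \<delta> = r \<odot>\<^bsub>Ext \<C> C' A\<^esub> pull \<C> c A \<delta>"
    \<comment> \<open>\<open>\<ss>\<close> is an additive realization\<close>
    and realize_class: "\<lbrakk>C \<in> Obj \<C>; A \<in> Obj \<C>; \<delta> \<in> exts \<C> C A\<rbrakk>
      \<Longrightarrow> \<exists>s. is_complex \<C> A C s \<and> realize \<C> C A \<delta> = complex_class \<C> A C s"
    and realize_zero: "is_biproduct \<C> A C S i j p q
      \<Longrightarrow> (S, i, q) \<in> realize \<C> C A \<zero>\<^bsub>Ext \<C> C A\<^esub>"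
    and realize_sum: "\<lbrakk>\<delta> \<in> exts \<C> C A; \<delta>' \<in> exts \<C> C' A';
        (B, f, g) \<in> realize \<C> C A \<delta>; (B', f', g') \<in> realize \<C> C' A' \<delta>';
        is_biproduct \<C> A A' SA iA iA' pA pA';
        is_biproduct \<C> B B' SB iB iB' pB pB';
        is_biproduct \<C> C C' SC iC iC' pC pC'\<rbrakk>
      \<Longrightarrow> (SB,
           (iB \<bullet>\<^bsub>\<C>\<^esub> f \<bullet>\<^bsub>\<C>\<^esub> pA) \<oplus>\<^bsub>Hom \<C> SA SB\<^esub> (iB' \<bullet>\<^bsub>\<C>\<^esub> f' \<bullet>\<^bsub>\<C>\<^esub> pA'),
           (iC \<bullet>\<^bsub>\<C>\<^esub> g \<bullet>\<^bsub>\<C>\<^esub> pB) \<oplus>\<^bsub>Hom \<C> SB SC\<^esub> (iC' \<bullet>\<^bsub>\<C>\<^esub> g' \<bullet>\<^bsub>\<C>\<^esub> pB'))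
          \<in> realize \<C> SC SA
              (push \<C> SC iA (pull \<C> pC A \<delta>) \<oplus>\<^bsub>Ext \<C> SC SA\<^esub> push \<C> SC iA' (pull \<C> pC' A' \<delta>'))"
    and realize_morphism: "\<lbrakk>A \<in> Obj \<C>; C \<in> Obj \<C>; A' \<in> Obj \<C>; C' \<in> Obj \<C>;
        \<delta> \<in> exts \<C> C A; \<delta>' \<in> exts \<C> C' A';
        (B, f, g) \<in> realize \<C> C A \<delta>; (B', f', g') \<in> realize \<C> C' A' \<delta>';
        a \<in> homs \<C> A A'; c \<in> homs \<C> C C'; push \<C> C a \<delta> = pull \<C> c A' \<delta>'\<rbrakk>
      \<Longrightarrow> \<exists>b\<in>homs \<C> B B'. b \<bullet>\<^bsub>\<C>\<^esub> f = f' \<bullet>\<^bsub>\<C>\<^esub> a \<and> g' \<bullet>\<^bsub>\<C>\<^esub> b = c \<bullet>\<^bsub>\<C>\<^esub> g"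
    and ET3: "\<lbrakk>A \<in> Obj \<C>; C \<in> Obj \<C>; A' \<in> Obj \<C>; C' \<in> Obj \<C>;
        \<delta> \<in> exts \<C> C A; \<delta>' \<in> exts \<C> C' A';
        (B, f, g) \<in> realize \<C> C A \<delta>; (B', f', g') \<in> realize \<C> C' A' \<delta>';
        a \<in> homs \<C> A A'; b \<in> homs \<C> B B'; b \<bullet>\<^bsub>\<C>\<^esub> f = f' \<bullet>\<^bsub>\<C>\<^esub> a\<rbrakk>
      \<Longrightarrow> \<exists>c\<in>homs \<C> C C'. c \<bullet>\<^bsub>\<C>\<^esub> g = g' \<bullet>\<^bsub>\<C>\<^esub> b \<and> push \<C> C a \<delta> = pull \<C> c A' \<delta>'"
    and ET3_op: "\<lbrakk>A \<in> Obj \<C>; C \<in> Obj \<C>; A' \<in> Obj \<C>; C' \<in> Obj \<C>;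
        \<delta> \<in> exts \<C> C A; \<delta>' \<in> exts \<C> C' A';
        (B, f, g) \<in> realize \<C> C A \<delta>; (B', f', g') \<in> realize \<C> C' A' \<delta>';
        b \<in> homs \<C> B B'; c \<in> homs \<C> C C'; c \<bullet>\<^bsub>\<C>\<^esub> g = g' \<bullet>\<^bsub>\<C>\<^esub> b\<rbrakk>
      \<Longrightarrow> \<exists>a\<in>homs \<C> A A'. b \<bullet>\<^bsub>\<C>\<^esub> f = f' \<bullet>\<^bsub>\<C>\<^esub> a \<and> push \<C> C a \<delta> = pull \<C> c A' \<delta>'"
    and ET4: "\<lbrakk>A \<in> Obj \<C>; B \<in> Obj \<C>; D \<in> Obj \<C>; F \<in> Obj \<C>;
        \<delta> \<in> exts \<C> D A; \<delta>' \<in> exts \<C> F B;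
        (B, f, f') \<in> realize \<C> D A \<delta>; (C, g, g') \<in> realize \<C> F B \<delta>'\<rbrakk>
      \<Longrightarrow> \<exists>E\<in>Obj \<C>. \<exists>h\<in>homs \<C> C E. \<exists>d\<in>homs \<C> D E. \<exists>e\<in>homs \<C> E F. \<exists>\<delta>''\<in>exts \<C> E A.
            (C, g \<bullet>\<^bsub>\<C>\<^esub> f, h) \<in> realize \<C> E A \<delta>'' \<and>
            h \<bullet>\<^bsub>\<C>\<^esub> g = d \<bullet>\<^bsub>\<C>\<^esub> f' \<and> e \<bullet>\<^bsub>\<C>\<^esub> h = g' \<and>
            (E, d, e) \<in> realize \<C> F D (push \<C> F f' \<delta>') \<and>
            pull \<C> d A \<delta>'' = \<delta> \<and>
            push \<C> E f \<delta>'' = pull \<C> e B \<delta>'"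
    \<comment> \<open>all arrows of \<open>ET4\<close> reversed: \<open>D \<rightarrow> B \<rightarrow> A\<close> and \<open>F \<rightarrow> C \<rightarrow> B\<close> are given\<close>
    and ET4_op: "\<lbrakk>A \<in> Obj \<C>; B \<in> Obj \<C>; D \<in> Obj \<C>; F \<in> Obj \<C>;
        \<delta> \<in> exts \<C> A D; \<delta>' \<in> exts \<C> B F;
        (B, f', f) \<in> realize \<C> A D \<delta>; (C, g', g) \<in> realize \<C> B F \<delta>'\<rbrakk>
      \<Longrightarrow> \<exists>E\<in>Obj \<C>. \<exists>h\<in>homs \<C> E C. \<exists>d\<in>homs \<C> E D. \<exists>e\<in>homs \<C> F E. \<exists>\<delta>''\<in>exts \<C> A E.
            (C, h, f \<bullet>\<^bsub>\<C>\<^esub> g) \<in> realize \<C> A E \<delta>'' \<and>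
            g \<bullet>\<^bsub>\<C>\<^esub> h = f' \<bullet>\<^bsub>\<C>\<^esub> d \<and> h \<bullet>\<^bsub>\<C>\<^esub> e = g' \<and>
            (E, e, d) \<in> realize \<C> D F (pull \<C> f' F \<delta>') \<and>
            push \<C> A d \<delta>'' = \<delta> \<and>
            pull \<C> f E \<delta>'' = push \<C> B e \<delta>'"

definition conflation ::
  "('o, 'm, 'r, 'e, 'z) extri_cat_scheme \<Rightarrow> 'o \<Rightarrow> 'm \<Rightarrow> 'o \<Rightarrow> 'm \<Rightarrow> 'o \<Rightarrow> bool" where
  "conflation \<C> A f B g C \<longleftrightarrow>
     A \<in> Obj \<C> \<and> C \<in> Obj \<C> \<and> (\<exists>\<delta>\<in>exts \<C> C A. (B, f, g) \<in> realize \<C> C A \<delta>)"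


section \<open>Higher extensions\<close>

text \<open>
  All the modules \<open>\<bbbE>\<^sup>n(C,A)\<close>, \<open>n \<ge> 1\<close>, have to live in one type. An element of \<open>\<bbbE>\<^sup>1\<close> is wrapped
  by \<open>Base\<close>. An element of a coend \<open>\<integral>\<^sup>X F(X) \<otimes> \<bbbE>(C,X)\<close> is a class of finite formal sums of pure
  tensors \<open>x \<otimes> e\<close> with \<open>x \<in> F(X)\<close> and \<open>e \<in> \<bbbE>(C,X)\<close>. The sum is a multiset of triples
  \<open>(X, x, e)\<close>, and the class is replaced by a representative fixed by Hilbert choice, so that
  equality in the module is equality in the type.
\<close>

datatype ('o, 'e) hext =
    Base (base: 'e)
  | Tensors (tensors: "('o \<times> ('o, 'e) hext \<times> 'e) multiset")

type_synonym ('o, 'e) formal_sum = "('o \<times> ('o, 'e) hext \<times> 'e) multiset"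

text \<open>A contravariant functor to modules: values on objects, action \<open>f\<^sup>*\<close> of morphisms.\<close>

record ('o, 'm, 'r, 'e) presheaf =
  psh_obj :: "'o \<Rightarrow> ('r, ('o, 'e) hext) module"
  psh_mor :: "'m \<Rightarrow> ('o, 'e) hext \<Rightarrow> ('o, 'e) hext"

text \<open>
  The congruence on formal sums whose quotient is the coend: bilinearity over \<open>R\<close>
  (\<open>add_left\<close>, \<open>add_right\<close>, \<open>zero\<close>, \<open>balanced\<close>), giving \<open>\<Oplus>\<^sub>X F(X) \<otimes>\<^sub>R \<bbbE>(C,X)\<close>, together with
  the coend relation \<open>f\<^sup>*x \<otimes> e = x \<otimes> f\<^sub>*e\<close>. Formal sums only form a commutative monoid, so
  \<open>zero\<close> does not follow from additivity and has to be imposed; inverses then exist since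
  \<open>x \<otimes> e + (-x) \<otimes> e = 0\<close>, and \<open>x \<otimes> 0 = 0\<close> follows from \<open>balanced\<close>.
\<close>

inductive coend_eq ::
  "('r, 'y) ring_scheme \<Rightarrow> ('o, 'm, 'r, 'e, 'z) extri_cat_scheme \<Rightarrow> ('o, 'm, 'r, 'e) presheaf
     \<Rightarrow> 'o \<Rightarrow> ('o, 'e) formal_sum \<Rightarrow> ('o, 'e) formal_sum \<Rightarrow> bool"
  for R :: "('r, 'y) ring_scheme" and \<C> :: "('o, 'm, 'r, 'e, 'z) extri_cat_scheme"
  and F :: "('o, 'm, 'r, 'e) presheaf" and C :: 'o where
  refl: "coend_eq R \<C> F C P P"
| sym: "coend_eq R \<C> F C P Q \<Longrightarrow> coend_eq R \<C> F C Q P"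
| trans: "coend_eq R \<C> F C P Q \<Longrightarrow> coend_eq R \<C> F C Q S \<Longrightarrow> coend_eq R \<C> F C P S"
| plus: "coend_eq R \<C> F C P Q \<Longrightarrow> coend_eq R \<C> F C (P + S) (Q + S)"
| add_left: "\<lbrakk>X \<in> Obj \<C>; x \<in> carrier (psh_obj F X); x' \<in> carrier (psh_obj F X); e \<in> exts \<C> C X\<rbrakk>
    \<Longrightarrow> coend_eq R \<C> F C {#(X, x \<oplus>\<^bsub>psh_obj F X\<^esub> x', e)#} {#(X, x, e), (X, x', e)#}"
| add_right: "\<lbrakk>X \<in> Obj \<C>; x \<in> carrier (psh_obj F X); e \<in> exts \<C> C X; e' \<in> exts \<C> C X\<rbrakk>
    \<Longrightarrow> coend_eq R \<C> F C {#(X, x, e \<oplus>\<^bsub>Ext \<C> C X\<^esub> e')#} {#(X, x, e), (X, x, e')#}"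
| zero: "\<lbrakk>X \<in> Obj \<C>; e \<in> exts \<C> C X\<rbrakk>
    \<Longrightarrow> coend_eq R \<C> F C {#(X, \<zero>\<^bsub>psh_obj F X\<^esub>, e)#} {#}"
| balanced: "\<lbrakk>X \<in> Obj \<C>; r \<in> carrier R; x \<in> carrier (psh_obj F X); e \<in> exts \<C> C X\<rbrakk>
    \<Longrightarrow> coend_eq R \<C> F C {#(X, r \<odot>\<^bsub>psh_obj F X\<^esub> x, e)#} {#(X, x, r \<odot>\<^bsub>Ext \<C> C X\<^esub> e)#}"
| dinatural: "\<lbrakk>X \<in> Obj \<C>; X' \<in> Obj \<C>; f \<in> homs \<C> X X'; x \<in> carrier (psh_obj F X'); e \<in> exts \<C> C X\<rbrakk>
    \<Longrightarrow> coend_eq R \<C> F C {#(X, psh_mor F f x, e)#} {#(X', x, push \<C> C f e)#}"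

definition coend_class ::
  "('r, 'y) ring_scheme \<Rightarrow> ('o, 'm, 'r, 'e, 'z) extri_cat_scheme \<Rightarrow> ('o, 'm, 'r, 'e) presheaf
     \<Rightarrow> 'o \<Rightarrow> ('o, 'e) formal_sum \<Rightarrow> ('o, 'e) hext" where
  "coend_class R \<C> F C P = Tensors (SOME Q. coend_eq R \<C> F C P Q)"

definition pure_tensors ::
  "('o, 'm, 'r, 'e, 'z) extri_cat_scheme \<Rightarrow> ('o, 'm, 'r, 'e) presheaf
     \<Rightarrow> 'o \<Rightarrow> ('o \<times> ('o, 'e) hext \<times> 'e) set" where
  "pure_tensors \<C> F C = {(X, x, e). X \<in> Obj \<C> \<and> x \<in> carrier (psh_obj F X) \<and> e \<in> exts \<C> C X}"

definition coend_module ::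
  "('r, 'y) ring_scheme \<Rightarrow> ('o, 'm, 'r, 'e, 'z) extri_cat_scheme \<Rightarrow> ('o, 'm, 'r, 'e) presheaf
     \<Rightarrow> 'o \<Rightarrow> ('r, ('o, 'e) hext) module" where
  "coend_module R \<C> F C = \<lparr>
     carrier = coend_class R \<C> F C ` {P. set_mset P \<subseteq> pure_tensors \<C> F C},
     monoid.mult = undefined,
     one = undefined,
     zero = coend_class R \<C> F C {#},
     add = (\<lambda>u v. coend_class R \<C> F C (tensors u + tensors v)),
     smult = (\<lambda>r u. coend_class R \<C> F C
                (image_mset (\<lambda>(X, x, e). (X, r \<odot>\<^bsub>psh_obj F X\<^esub> x, e)) (tensors u)))\<rparr>"

text \<open>\<open>C \<mapsto> \<integral>\<^sup>X F(X) \<otimes>\<^sub>R \<bbbE>(C,X)\<close>, where \<open>c : C' \<rightarrow> C\<close> acts by \<open>x \<otimes> e \<mapsto> x \<otimes> c\<^sup>*e\<close>.\<close>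

definition coend_presheaf ::
  "('r, 'y) ring_scheme \<Rightarrow> ('o, 'm, 'r, 'e, 'z) extri_cat_scheme \<Rightarrow> ('o, 'm, 'r, 'e) presheaf
     \<Rightarrow> ('o, 'm, 'r, 'e) presheaf" where
  "coend_presheaf R \<C> F = \<lparr>
     psh_obj = coend_module R \<C> F,
     psh_mor = (\<lambda>c u. coend_class R \<C> F (Dom \<C> c)
                  (image_mset (\<lambda>(X, x, e). (X, x, pull \<C> c X e)) (tensors u)))\<rparr>"

definition ext_presheaf ::
  "('o, 'm, 'r, 'e, 'z) extri_cat_scheme \<Rightarrow> 'o \<Rightarrow> ('o, 'm, 'r, 'e) presheaf" where
  "ext_presheaf \<C> A = \<lparr>
     psh_obj = (\<lambda>C. \<lparr>
        carrier = Base ` exts \<C> C A,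
        monoid.mult = undefined,
        one = undefined,
        zero = Base \<zero>\<^bsub>Ext \<C> C A\<^esub>,
        add = (\<lambda>u v. Base (base u \<oplus>\<^bsub>Ext \<C> C A\<^esub> base v)),
        smult = (\<lambda>r u. Base (r \<odot>\<^bsub>Ext \<C> C A\<^esub> base u))\<rparr>),
     psh_mor = (\<lambda>c u. Base (pull \<C> c A (base u)))\<rparr>"

text \<open>\<open>higher_ext_presheaf R \<C> A n\<close> is \<open>\<bbbE>\<^sup>n(-,A)\<close>; the value at \<open>n = 0\<close> is left unspecified.\<close>

fun higher_ext_presheaf ::
  "('r, 'y) ring_scheme \<Rightarrow> ('o, 'm, 'r, 'e, 'z) extri_cat_scheme \<Rightarrow> 'o \<Rightarrow> nat
     \<Rightarrow> ('o, 'm, 'r, 'e) presheaf" where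
  "higher_ext_presheaf R \<C> A (Suc 0) = ext_presheaf \<C> A"
| "higher_ext_presheaf R \<C> A (Suc (Suc n)) =
     coend_presheaf R \<C> (higher_ext_presheaf R \<C> A (Suc n))"

definition higher_ext ::
  "('r, 'y) ring_scheme \<Rightarrow> ('o, 'm, 'r, 'e, 'z) extri_cat_scheme \<Rightarrow> nat \<Rightarrow> 'o \<Rightarrow> 'o
     \<Rightarrow> ('r, ('o, 'e) hext) module" where
  "higher_ext R \<C> n C A = psh_obj (higher_ext_presheaf R \<C> A n) C"

definition higher_ext_vanishes ::
  "('r, 'y) ring_scheme \<Rightarrow> ('o, 'm, 'r, 'e, 'z) extri_cat_scheme \<Rightarrow> nat \<Rightarrow> 'o set \<Rightarrow> 'o set
     \<Rightarrow> bool" where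
  "higher_ext_vanishes R \<C> k \<X> \<Y> \<longleftrightarrow>
     (\<forall>X\<in>\<X>. \<forall>Y\<in>\<Y>. carrier (higher_ext R \<C> k X Y) = {\<zero>\<^bsub>higher_ext R \<C> k X Y\<^esub>})"


section \<open>Subcategories\<close>

text \<open>Full subcategories are identified with their sets of objects.\<close>

definition subcategory :: "('o, 'm, 'r, 'z) lin_cat_scheme \<Rightarrow> 'o set \<Rightarrow> bool" where
  "subcategory \<C> \<X> \<longleftrightarrow> \<X> \<subseteq> Obj \<C> \<and>
     (\<forall>X f Y. X \<in> \<X> \<and> is_iso \<C> X Y f \<longrightarrow> Y \<in> \<X>) \<and>
     (\<forall>Z. zero_object \<C> Z \<longrightarrow> Z \<in> \<X>) \<and>
     (\<forall>A B S i j p q. A \<in> \<X> \<and> B \<in> \<X> \<and> is_biproduct \<C> A B S i j p q \<longrightarrow> S \<in> \<X>)"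

definition summand_closed :: "('o, 'm, 'r, 'z) lin_cat_scheme \<Rightarrow> 'o set \<Rightarrow> bool" where
  "summand_closed \<C> \<X> \<longleftrightarrow>
     (\<forall>A B S i j p q. S \<in> \<X> \<and> is_biproduct \<C> A B S i j p q \<longrightarrow> A \<in> \<X>)"

definition extension_cat ::
  "('o, 'm, 'r, 'e, 'z) extri_cat_scheme \<Rightarrow> 'o set \<Rightarrow> 'o set \<Rightarrow> 'o set" where
  "extension_cat \<C> \<X> \<Y> = {M. \<exists>X\<in>\<X>. \<exists>Y\<in>\<Y>. \<exists>f g. conflation \<C> X f M g Y}"

definition Cone :: "('o, 'm, 'r, 'e, 'z) extri_cat_scheme \<Rightarrow> 'o set \<Rightarrow> 'o set \<Rightarrow> 'o set" where
  "Cone \<C> \<X> \<Y> = {M. \<exists>X\<in>\<X>. \<exists>Y\<in>\<Y>. \<exists>f g. conflation \<C> X f Y g M}"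

definition Cocone :: "('o, 'm, 'r, 'e, 'z) extri_cat_scheme \<Rightarrow> 'o set \<Rightarrow> 'o set \<Rightarrow> 'o set" where
  "Cocone \<C> \<X> \<Y> = {M. \<exists>X\<in>\<X>. \<exists>Y\<in>\<Y>. \<exists>f g. conflation \<C> M f X g Y}"

definition is_thick :: "('o, 'm, 'r, 'e, 'z) extri_cat_scheme \<Rightarrow> 'o set \<Rightarrow> bool" where
  "is_thick \<C> \<X> \<longleftrightarrow> subcategory \<C> \<X> \<and> extension_cat \<C> \<X> \<X> \<subseteq> \<X> \<and>
     Cone \<C> \<X> \<X> \<subseteq> \<X> \<and> Cocone \<C> \<X> \<X> \<subseteq> \<X> \<and> summand_closed \<C> \<X>"

definition thick :: "('o, 'm, 'r, 'e, 'z) extri_cat_scheme \<Rightarrow> 'o set \<Rightarrow> 'o set" where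
  "thick \<C> \<X> = \<Inter>{\<T>. is_thick \<C> \<T> \<and> \<X> \<subseteq> \<T>}"

text \<open>
  \<open>wedge_n \<C> \<X> n\<close> is \<open>\<X>\<^sup>\<and>\<^sub>n\<close> and \<open>vee_n \<C> \<X> n\<close> is \<open>\<X>\<^sup>\<or>\<^sub>n\<close> for \<open>n \<ge> 0\<close>; the index \<open>-1\<close> term \<open>{0}\<close>,
  the subcategory of zero objects, is absorbed into the base case.
\<close>

primrec wedge_n :: "('o, 'm, 'r, 'e, 'z) extri_cat_scheme \<Rightarrow> 'o set \<Rightarrow> nat \<Rightarrow> 'o set" where
  "wedge_n \<C> \<X> 0 = Cone \<C> {Z. zero_object \<C> Z} \<X>"
| "wedge_n \<C> \<X> (Suc n) = Cone \<C> (wedge_n \<C> \<X> n) \<X>"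

primrec vee_n :: "('o, 'm, 'r, 'e, 'z) extri_cat_scheme \<Rightarrow> 'o set \<Rightarrow> nat \<Rightarrow> 'o set" where
  "vee_n \<C> \<X> 0 = Cocone \<C> \<X> {Z. zero_object \<C> Z}"
| "vee_n \<C> \<X> (Suc n) = Cocone \<C> \<X> (vee_n \<C> \<X> n)"

definition wedge :: "('o, 'm, 'r, 'e, 'z) extri_cat_scheme \<Rightarrow> 'o set \<Rightarrow> 'o set" where
  "wedge \<C> \<X> = (\<Union>n. wedge_n \<C> \<X> n)"

definition vee :: "('o, 'm, 'r, 'e, 'z) extri_cat_scheme \<Rightarrow> 'o set \<Rightarrow> 'o set" where
  "vee \<C> \<X> = (\<Union>n. vee_n \<C> \<X> n)"


section \<open>Cotorsion pairs and silting subcategories\<close>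

definition cotorsion_pair ::
  "('o, 'm, 'r, 'e, 'z) extri_cat_scheme \<Rightarrow> 'o set \<Rightarrow> 'o set \<Rightarrow> bool" where
  "cotorsion_pair \<C> \<X> \<Y> \<longleftrightarrow>
     subcategory \<C> \<X> \<and> subcategory \<C> \<Y> \<and> summand_closed \<C> \<X> \<and> summand_closed \<C> \<Y> \<and>
     (\<forall>X\<in>\<X>. \<forall>Y\<in>\<Y>. exts \<C> X Y = {\<zero>\<^bsub>Ext \<C> X Y\<^esub>}) \<and>
     Obj \<C> = Cone \<C> \<Y> \<X> \<and> Obj \<C> = Cocone \<C> \<Y> \<X>"

definition hereditary ::
  "('r, 'y) ring_scheme \<Rightarrow> ('o, 'm, 'r, 'e, 'z) extri_cat_scheme \<Rightarrow> 'o set \<Rightarrow> 'o set \<Rightarrow> bool" where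
  "hereditary R \<C> \<X> \<Y> \<longleftrightarrow> (\<forall>k\<ge>2. higher_ext_vanishes R \<C> k \<X> \<Y>)"

definition bounded ::
  "('o, 'm, 'r, 'e, 'z) extri_cat_scheme \<Rightarrow> 'o set \<Rightarrow> 'o set \<Rightarrow> bool" where
  "bounded \<C> \<X> \<Y> \<longleftrightarrow> Obj \<C> = wedge \<C> \<X> \<and> Obj \<C> = vee \<C> \<Y>"

definition bounded_hereditary_cotorsion_pairs ::
  "('r, 'y) ring_scheme \<Rightarrow> ('o, 'm, 'r, 'e, 'z) extri_cat_scheme \<Rightarrow> ('o set \<times> 'o set) set" where
  "bounded_hereditary_cotorsion_pairs R \<C> =
     {(\<X>, \<Y>). cotorsion_pair \<C> \<X> \<Y> \<and> hereditary R \<C> \<X> \<Y> \<and> bounded \<C> \<X> \<Y>}"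

definition silt ::
  "('r, 'y) ring_scheme \<Rightarrow> ('o, 'm, 'r, 'e, 'z) extri_cat_scheme \<Rightarrow> 'o set set" where
  "silt R \<C> = {\<M>. subcategory \<C> \<M> \<and> summand_closed \<C> \<M> \<and>
     (\<forall>k\<ge>1. higher_ext_vanishes R \<C> k \<M> \<M>) \<and> Obj \<C> = thick \<C> \<M>}"

definition \<Phi> :: "'o set \<times> 'o set \<Rightarrow> 'o set" where
  "\<Phi> = (\<lambda>(\<X>, \<Y>). \<X> \<inter> \<Y>)"

definition \<Psi> :: "('o, 'm, 'r, 'e, 'z) extri_cat_scheme \<Rightarrow> 'o set \<Rightarrow> 'o set \<times> 'o set" where
  "\<Psi> \<C> \<M> = (vee \<C> \<M>, wedge \<C> \<M>)"

end

theory Submission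
  imports Defs
begin

text \<open>
  Higher extensions enter only through three consequences of one criterion. Let
  \<open>F\<close> be a contravariant functor to modules that is exact at the middle term of every conflation, and let
  \<open>K \<rightarrow> B \<rightarrow> C\<close> realize \<open>\<xi> \<in> \<bbbE>(C,K)\<close>. The tensor \<open>x \<otimes> \<xi>\<close> in the coend
  \<open>\<integral>\<^sup>Z F(Z) \<otimes> \<bbbE>(C,Z)\<close> is zero exactly when \<open>x \<in> F(K)\<close> extends to \<open>F(B)\<close>; the forward implication is
  \<open>tensor_zero\<close>. It holds because the coend maps to the colimit, over the directed family of all
  \<open>\<xi>\<close>, of the cokernels of \<open>F(B) \<rightarrow> F(K)\<close>, and the transition maps of this colimit are injective.
  The coend is again such a functor, so the criterion applies to all \<open>\<bbbE>\<^sup>n(-,A)\<close> by induction. It yields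
  that vanishing of higher extensions passes to the end terms of a conflation at the cost of one
  degree (\<open>hvanish_kernel\<close>, \<open>hvanish_cokernel\<close>), and that \<open>\<bbbE>\<^sup>2(X,Y) = 0\<close> allows an extension of
  \<open>K\<close> by \<open>Y\<close> to be continued along an inflation \<open>K \<rightarrow> B\<close> with cone \<open>X\<close> (\<open>conf_lift\<close>).

  The rest is an argument about conflations between objects, without morphisms, carried out in
  \<open>conflation_calculus\<close>. Its axioms are self-dual, so only half of each argument has to be given.

  From silting to cotorsion: if all \<open>\<bbbE>\<^sup>k(\<M>,\<M>)\<close> vanish for positive \<open>k\<close>, then so do all
  \<open>\<bbbE>\<^sup>k(\<M>\<^sup>\<or>,\<M>\<^sup>\<and>)\<close>. It follows that \<open>\<M>\<^sup>\<or>\<close> is closed under extensions, cocones and summands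
  (\<open>cores_ext\<close>, \<open>cores_cocone\<close>, \<open>cores_summand\<close>), dually for \<open>\<M>\<^sup>\<and>\<close>, and that the
  objects \<open>C\<close> with a conflation \<open>Y \<rightarrow> X \<rightarrow> C\<close>, where \<open>Y \<in> \<M>\<^sup>\<and>\<close> and \<open>X \<in> \<M>\<^sup>\<or>\<close>, form a thick
  subcategory. It contains \<open>\<M>\<close>, hence it is everything, which gives the approximations of a cotorsion pair.
  The intersection is \<open>\<M>\<close> since a conflation \<open>Z \<rightarrow> M \<rightarrow> X'\<close> from the \<open>\<M>\<close>-coresolution of \<open>Z\<close>
  splits as soon as \<open>Z \<in> \<M>\<^sup>\<and>\<close>.

  From cotorsion to silting: orthogonality of \<open>\<X> \<inter> \<Y>\<close> to itself in all positive degrees is part of the hypotheses. An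
  object of \<open>\<X>\<close> has a coresolution by objects of \<open>\<X> \<inter> \<Y>\<close>, obtained by iterating left
  approximations; boundedness gives it another, finite, coresolution by objects of \<open>\<Y>\<close>, and a comparison in the
  style of Schanuel's lemma shows that the first one can be stopped as well (\<open>tame_summand\<close>). Therefore \<open>\<X>\<close>
  equals \<open>(\<X> \<inter> \<Y>)\<^sup>\<or>\<close>, dually \<open>\<Y>\<close> equals \<open>(\<X> \<inter> \<Y>)\<^sup>\<and>\<close>, and boundedness makes \<open>\<X> \<inter> \<Y>\<close> generate.
\<close>

section \<open>Arrows, extensions and realizations\<close>

definition arrow :: "('o, 'm, 'r, 'z) lin_cat_scheme \<Rightarrow> 'o \<Rightarrow> 'o \<Rightarrow> 'm \<Rightarrow> bool" where
  "arrow \<C> A B f \<longleftrightarrow> A \<in> Obj \<C> \<and> B \<in> Obj \<C> \<and> f \<in> homs \<C> A B"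

definition extension :: "('o, 'm, 'r, 'e, 'z) extri_cat_scheme \<Rightarrow> 'o \<Rightarrow> 'o \<Rightarrow> 'e \<Rightarrow> bool" where
  "extension \<C> C A \<delta> \<longleftrightarrow> C \<in> Obj \<C> \<and> A \<in> Obj \<C> \<and> \<delta> \<in> exts \<C> C A"

definition realizes ::
  "('o, 'm, 'r, 'e, 'z) extri_cat_scheme \<Rightarrow> 'o \<Rightarrow> 'm \<Rightarrow> 'o \<Rightarrow> 'm \<Rightarrow> 'o \<Rightarrow> 'e \<Rightarrow> bool" where
  "realizes \<C> A f B g C \<delta> \<longleftrightarrow> extension \<C> C A \<delta> \<and> (B, f, g) \<in> realize \<C> C A \<delta>"

definition op_cat :: "('o, 'm, 'r, 'e, 'z) extri_cat_scheme \<Rightarrow> ('o, 'm, 'r, 'e) extri_cat" where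
  "op_cat \<C> = \<lparr> Obj = Obj \<C>, Hom = (\<lambda>A B. Hom \<C> B A), Dom = Cod \<C>, Cod = Dom \<C>,
     Ide = Ide \<C>, Comp = (\<lambda>g f. f \<bullet>\<^bsub>\<C>\<^esub> g), Ext = (\<lambda>C A. Ext \<C> A C),
     push = (\<lambda>C a. pull \<C> a C), pull = (\<lambda>c A. push \<C> A c),
     realize = (\<lambda>C A \<delta>. {(B, f, g). (B, g, f) \<in> realize \<C> A C \<delta>}) \<rparr>"

lemma op_cat_sel [simp]:
  "Obj (op_cat \<C>) = Obj \<C>" "Hom (op_cat \<C>) A B = Hom \<C> B A" "Dom (op_cat \<C>) = Cod \<C>"
  "Cod (op_cat \<C>) = Dom \<C>" "Ide (op_cat \<C>) = Ide \<C>" "g \<bullet>\<^bsub>op_cat \<C>\<^esub> f = f \<bullet>\<^bsub>\<C>\<^esub> g"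
  "Ext (op_cat \<C>) C A = Ext \<C> A C" "push (op_cat \<C>) C a = pull \<C> a C"
  "pull (op_cat \<C>) c A = push \<C> A c"
  "(B, f, g) \<in> realize (op_cat \<C>) C A \<delta> \<longleftrightarrow> (B, g, f) \<in> realize \<C> A C \<delta>"
  by (simp_all add: op_cat_def)

lemma op_cat_simps [simp]:
  "arrow (op_cat \<C>) A B f \<longleftrightarrow> arrow \<C> B A f"
  "extension (op_cat \<C>) C A \<delta> \<longleftrightarrow> extension \<C> A C \<delta>"
  "realizes (op_cat \<C>) A f B g C \<delta> \<longleftrightarrow> realizes \<C> C g B f A \<delta>"
  "zero_object (op_cat \<C>) Z \<longleftrightarrow> zero_object \<C> Z"
  "is_iso (op_cat \<C>) A B f \<longleftrightarrow> is_iso \<C> B A f"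
  "is_biproduct (op_cat \<C>) A B S i j p q \<longleftrightarrow> is_biproduct \<C> A B S p q i j"
  by (auto simp: arrow_def extension_def realizes_def zero_object_def is_iso_def
      is_biproduct_def)

lemma additive_map_zero:
  assumes "abelian_group G" "abelian_group H"
    and "\<And>x. x \<in> carrier G \<Longrightarrow> \<phi> x \<in> carrier H"
    and "\<And>x y. x \<in> carrier G \<Longrightarrow> y \<in> carrier G \<Longrightarrow> \<phi> (x \<oplus>\<^bsub>G\<^esub> y) = \<phi> x \<oplus>\<^bsub>H\<^esub> \<phi> y"
  shows "\<phi> \<zero>\<^bsub>G\<^esub> = \<zero>\<^bsub>H\<^esub>"
proof -
  interpret G: abelian_group G by fact
  interpret H: abelian_group H by fact
  have "\<phi> \<zero>\<^bsub>G\<^esub> \<oplus>\<^bsub>H\<^esub> \<phi> \<zero>\<^bsub>G\<^esub> = \<phi> \<zero>\<^bsub>G\<^esub>"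
    using assms(4)[of "\<zero>\<^bsub>G\<^esub>" "\<zero>\<^bsub>G\<^esub>"] by simp
  then show ?thesis
    using assms(3)[of "\<zero>\<^bsub>G\<^esub>"] by (simp add: H.add.r_cancel_one')
qed

lemma additive_map_minus:
  assumes "abelian_group G" "abelian_group H"
    and "\<And>x. x \<in> carrier G \<Longrightarrow> \<phi> x \<in> carrier H"
    and "\<And>x y. x \<in> carrier G \<Longrightarrow> y \<in> carrier G \<Longrightarrow> \<phi> (x \<oplus>\<^bsub>G\<^esub> y) = \<phi> x \<oplus>\<^bsub>H\<^esub> \<phi> y"
    and "x \<in> carrier G"
  shows "\<phi> (\<ominus>\<^bsub>G\<^esub> x) = \<ominus>\<^bsub>H\<^esub> \<phi> x"
proof -
  interpret G: abelian_group G by fact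
  interpret H: abelian_group H by fact
  have "\<phi> (\<ominus>\<^bsub>G\<^esub> x) \<oplus>\<^bsub>H\<^esub> \<phi> x = \<zero>\<^bsub>H\<^esub>"
    using assms(4)[of "\<ominus>\<^bsub>G\<^esub> x" x] assms(5) additive_map_zero[OF assms(1-4)] by (simp add: G.l_neg)
  then show ?thesis
    using assms(3,5) by (metis G.a_inv_closed H.minus_equality)
qed

context extriangulated_category
begin

abbreviation comp (infixr \<open>\<cdot>\<close> 75) where "g \<cdot> f \<equiv> g \<bullet>\<^bsub>\<C>\<^esub> f"
abbreviation arr where "arr \<equiv> arrow \<C>"
abbreviation ext where "ext \<equiv> extension \<C>"
abbreviation rlz where "rlz \<equiv> realizes \<C>"
abbreviation zm where "zm A B \<equiv> \<zero>\<^bsub>Hom \<C> A B\<^esub>"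
abbreviation ze where "ze C A \<equiv> \<zero>\<^bsub>Ext \<C> C A\<^esub>"

lemma arr_obj: "arr A B f \<Longrightarrow> A \<in> Obj \<C>" "arr A B f \<Longrightarrow> B \<in> Obj \<C>"
  by (simp_all add: arrow_def)
lemma ext_obj: "ext C A \<delta> \<Longrightarrow> A \<in> Obj \<C>" "ext C A \<delta> \<Longrightarrow> C \<in> Obj \<C>"
  by (simp_all add: extension_def)

lemma hom_group: "\<lbrakk>A \<in> Obj \<C>; B \<in> Obj \<C>\<rbrakk> \<Longrightarrow> abelian_group (Hom \<C> A B)"
  using hom_module by (simp add: module_def)
lemma ext_group: "\<lbrakk>A \<in> Obj \<C>; B \<in> Obj \<C>\<rbrakk> \<Longrightarrow> abelian_group (Ext \<C> A B)"
  using ext_module by (simp add: module_def)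

lemma arr_comp: "\<lbrakk>arr A B f; arr B C g\<rbrakk> \<Longrightarrow> arr A C (g \<cdot> f)"
  unfolding arrow_def using Comp_closed by blast
lemma arr_id: "A \<in> Obj \<C> \<Longrightarrow> arr A A (Ide \<C> A)"
  unfolding arrow_def using Ide_closed by blast
lemma arr_zero: "\<lbrakk>A \<in> Obj \<C>; B \<in> Obj \<C>\<rbrakk> \<Longrightarrow> arr A B (zm A B)"
  by (simp add: arrow_def hom_group abelian_group.axioms(1) abelian_monoid.zero_closed)
lemma arr_add: "\<lbrakk>arr A B f; arr A B g\<rbrakk> \<Longrightarrow> arr A B (f \<oplus>\<^bsub>Hom \<C> A B\<^esub> g)"
  by (simp add: arrow_def hom_group abelian_group.axioms(1) abelian_monoid.a_closed)
lemma arr_neg: "arr A B f \<Longrightarrow> arr A B (\<ominus>\<^bsub>Hom \<C> A B\<^esub> f)"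
  by (simp add: arrow_def hom_group abelian_group.a_inv_closed)
lemma arr_smult: "\<lbrakk>r \<in> carrier R; arr A B f\<rbrakk> \<Longrightarrow> arr A B (r \<odot>\<^bsub>Hom \<C> A B\<^esub> f)"
  by (auto simp: arrow_def intro: module.smult_closed[OF hom_module])

lemma assoc: "\<lbrakk>arr A B f; arr B C g; arr C D h\<rbrakk> \<Longrightarrow> (h \<cdot> g) \<cdot> f = h \<cdot> g \<cdot> f"
  unfolding arrow_def using Comp_assoc by blast
lemma assoc_mid: "\<lbrakk>arr A B f; arr B C g; arr C D h; arr D E k\<rbrakk> \<Longrightarrow> (k \<cdot> h) \<cdot> g \<cdot> f = k \<cdot> (h \<cdot> g) \<cdot> f"
  by (simp add: assoc[of A B f C g D h] assoc[of A C "g \<cdot> f" D h E k] arr_comp)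
lemma comp_id: "arr A B f \<Longrightarrow> f \<cdot> Ide \<C> A = f"
  unfolding arrow_def using Comp_Ide by blast
lemma id_comp: "arr A B f \<Longrightarrow> Ide \<C> B \<cdot> f = f"
  unfolding arrow_def using Ide_Comp by blast
lemma comp_add_left: "\<lbrakk>arr A B f; arr B C g; arr B C g'\<rbrakk>
   \<Longrightarrow> (g \<oplus>\<^bsub>Hom \<C> B C\<^esub> g') \<cdot> f = (g \<cdot> f) \<oplus>\<^bsub>Hom \<C> A C\<^esub> (g' \<cdot> f)"
  unfolding arrow_def using Comp_add_left by blast
lemma comp_add_right: "\<lbrakk>arr A B f; arr A B f'; arr B C g\<rbrakk>
   \<Longrightarrow> g \<cdot> (f \<oplus>\<^bsub>Hom \<C> A B\<^esub> f') = (g \<cdot> f) \<oplus>\<^bsub>Hom \<C> A C\<^esub> (g \<cdot> f')"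
  unfolding arrow_def using Comp_add_right by blast

lemma comp_zero: "\<lbrakk>arr B C g; A \<in> Obj \<C>\<rbrakk> \<Longrightarrow> g \<cdot> zm A B = zm A C"
  by (rule additive_map_zero[OF hom_group hom_group])
     (auto simp: arrow_def Comp_closed Comp_add_right)
lemma zero_comp: "\<lbrakk>arr A B f; C \<in> Obj \<C>\<rbrakk> \<Longrightarrow> zm B C \<cdot> f = zm A C"
  by (rule additive_map_zero[OF hom_group hom_group, where \<phi> = "\<lambda>g. g \<cdot> f"])
     (auto simp: arrow_def Comp_closed Comp_add_left)
lemma comp_neg: "\<lbrakk>arr A B f; arr B C g\<rbrakk> \<Longrightarrow> g \<cdot> (\<ominus>\<^bsub>Hom \<C> A B\<^esub> f) = \<ominus>\<^bsub>Hom \<C> A C\<^esub> (g \<cdot> f)"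
  by (rule additive_map_minus[OF hom_group hom_group])
     (auto simp: arrow_def Comp_closed Comp_add_right)
lemma neg_comp: "\<lbrakk>arr A B f; arr B C g\<rbrakk> \<Longrightarrow> (\<ominus>\<^bsub>Hom \<C> B C\<^esub> g) \<cdot> f = \<ominus>\<^bsub>Hom \<C> A C\<^esub> (g \<cdot> f)"
  by (rule additive_map_minus[OF hom_group hom_group, where \<phi> = "\<lambda>g. g \<cdot> f"])
     (auto simp: arrow_def Comp_closed Comp_add_left)

lemma add_zero: "arr A B f \<Longrightarrow> f \<oplus>\<^bsub>Hom \<C> A B\<^esub> zm A B = f"
  by (simp add: arrow_def hom_group abelian_group.axioms(1) abelian_monoid.r_zero)

lemma ext_zero: "\<lbrakk>C \<in> Obj \<C>; A \<in> Obj \<C>\<rbrakk> \<Longrightarrow> ext C A (ze C A)"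
  by (simp add: extension_def ext_group abelian_group.axioms(1) abelian_monoid.zero_closed)
lemma ext_add: "\<lbrakk>ext C A d; ext C A d'\<rbrakk> \<Longrightarrow> ext C A (d \<oplus>\<^bsub>Ext \<C> C A\<^esub> d')"
  by (simp add: extension_def ext_group abelian_group.axioms(1) abelian_monoid.a_closed)
lemma ext_smult: "\<lbrakk>r \<in> carrier R; ext C A d\<rbrakk> \<Longrightarrow> ext C A (r \<odot>\<^bsub>Ext \<C> C A\<^esub> d)"
  by (auto simp: extension_def intro: module.smult_closed[OF ext_module])
lemma ext_add_zero: "ext C A d \<Longrightarrow> d \<oplus>\<^bsub>Ext \<C> C A\<^esub> ze C A = d"
  and ext_zero_add: "ext C A d \<Longrightarrow> ze C A \<oplus>\<^bsub>Ext \<C> C A\<^esub> d = d"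
  by (simp_all add: extension_def ext_group abelian_group.axioms(1) abelian_monoid.r_zero
      abelian_monoid.l_zero)

lemma ext_push: "\<lbrakk>ext C A d; arr A A' a\<rbrakk> \<Longrightarrow> ext C A' (push \<C> C a d)"
  unfolding arrow_def extension_def using push_closed by blast
lemma ext_pull: "\<lbrakk>ext C A d; arr C' C c\<rbrakk> \<Longrightarrow> ext C' A (pull \<C> c A d)"
  unfolding arrow_def extension_def using pull_closed by blast
lemma push_id: "ext C A d \<Longrightarrow> push \<C> C (Ide \<C> A) d = d"
  unfolding extension_def using push_Ide by blast
lemma pull_id: "ext C A d \<Longrightarrow> pull \<C> (Ide \<C> C) A d = d"
  unfolding extension_def using pull_Ide by blast
lemma push_comp: "\<lbrakk>ext C A d; arr A A' a; arr A' A'' a'\<rbrakk>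
   \<Longrightarrow> push \<C> C (a' \<cdot> a) d = push \<C> C a' (push \<C> C a d)"
  unfolding arrow_def extension_def using push_Comp by blast
lemma pull_comp: "\<lbrakk>ext C A d; arr C' C c; arr C'' C' c'\<rbrakk>
   \<Longrightarrow> pull \<C> (c \<cdot> c') A d = pull \<C> c' A (pull \<C> c A d)"
  unfolding arrow_def extension_def using pull_Comp by blast
lemma push_pull_commute: "\<lbrakk>ext C A d; arr A A' a; arr C' C c\<rbrakk>
   \<Longrightarrow> push \<C> C' a (pull \<C> c A d) = pull \<C> c A' (push \<C> C a d)"
  unfolding arrow_def extension_def using push_pull by blast
lemma push_additive: "\<lbrakk>ext C A d; ext C A d'; arr A A' a\<rbrakk>
   \<Longrightarrow> push \<C> C a (d \<oplus>\<^bsub>Ext \<C> C A\<^esub> d') = push \<C> C a d \<oplus>\<^bsub>Ext \<C> C A'\<^esub> push \<C> C a d'"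
  unfolding arrow_def extension_def using push_add by blast
lemma pull_additive: "\<lbrakk>ext C A d; ext C A d'; arr C' C c\<rbrakk>
   \<Longrightarrow> pull \<C> c A (d \<oplus>\<^bsub>Ext \<C> C A\<^esub> d') = pull \<C> c A d \<oplus>\<^bsub>Ext \<C> C' A\<^esub> pull \<C> c A d'"
  unfolding arrow_def extension_def using pull_add by blast
lemma additive_push: "\<lbrakk>ext C A d; arr A A' a; arr A A' a'\<rbrakk>
   \<Longrightarrow> push \<C> C (a \<oplus>\<^bsub>Hom \<C> A A'\<^esub> a') d = push \<C> C a d \<oplus>\<^bsub>Ext \<C> C A'\<^esub> push \<C> C a' d"
  unfolding arrow_def extension_def using add_push by blast
lemma additive_pull: "\<lbrakk>ext C A d; arr C' C c; arr C' C c'\<rbrakk>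
   \<Longrightarrow> pull \<C> (c \<oplus>\<^bsub>Hom \<C> C' C\<^esub> c') A d = pull \<C> c A d \<oplus>\<^bsub>Ext \<C> C' A\<^esub> pull \<C> c' A d"
  unfolding arrow_def extension_def using add_pull by blast

lemma push_ze: "\<lbrakk>C \<in> Obj \<C>; arr A A' a\<rbrakk> \<Longrightarrow> push \<C> C a (ze C A) = ze C A'"
  by (rule additive_map_zero[OF ext_group ext_group])
     (auto simp: arrow_def push_closed push_add)
lemma zero_push: "\<lbrakk>ext C A d; A' \<in> Obj \<C>\<rbrakk> \<Longrightarrow> push \<C> C (zm A A') d = ze C A'"
  by (rule additive_map_zero[OF hom_group ext_group, where \<phi> = "\<lambda>a. push \<C> C a d"])
     (auto simp: extension_def push_closed add_push)
lemma zero_pull: "\<lbrakk>ext C A d; C' \<in> Obj \<C>\<rbrakk> \<Longrightarrow> pull \<C> (zm C' C) A d = ze C' A"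
  by (rule additive_map_zero[OF hom_group ext_group, where \<phi> = "\<lambda>c. pull \<C> c A d"])
     (auto simp: extension_def pull_closed add_pull)
lemma neg_push: "\<lbrakk>ext C A d; arr A A' a\<rbrakk>
   \<Longrightarrow> push \<C> C (\<ominus>\<^bsub>Hom \<C> A A'\<^esub> a) d = \<ominus>\<^bsub>Ext \<C> C A'\<^esub> push \<C> C a d"
  by (rule additive_map_minus[OF hom_group ext_group, where \<phi> = "\<lambda>a. push \<C> C a d"])
     (auto simp: arrow_def extension_def push_closed add_push)

lemma isoI: "\<lbrakk>arr A B f; arr B A g; g \<cdot> f = Ide \<C> A; f \<cdot> g = Ide \<C> B\<rbrakk> \<Longrightarrow> is_iso \<C> A B f"
  by (auto simp: is_iso_def arrow_def)

lemma isoE: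
  assumes "is_iso \<C> A B f"
  obtains g where "arr A B f" "arr B A g" "g \<cdot> f = Ide \<C> A" "f \<cdot> g = Ide \<C> B"
  using assms by (auto simp: is_iso_def arrow_def)

lemma iso_id: "A \<in> Obj \<C> \<Longrightarrow> is_iso \<C> A A (Ide \<C> A)"
  using arr_id[of A] id_comp[of A A "Ide \<C> A"] by (intro isoI) auto

lemma comp_iso:
  assumes "is_iso \<C> A B f" "is_iso \<C> B C g"
  shows "is_iso \<C> A C (g \<cdot> f)"
proof -
  from assms obtain f' g' where f: "arr A B f" "arr B A f'" "f' \<cdot> f = Ide \<C> A" "f \<cdot> f' = Ide \<C> B"
    and g: "arr B C g" "arr C B g'" "g' \<cdot> g = Ide \<C> B" "g \<cdot> g' = Ide \<C> C"
    by (elim isoE) blast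
  have "(f' \<cdot> g') \<cdot> g \<cdot> f = f' \<cdot> (g' \<cdot> g) \<cdot> f"
    using assoc_mid f g by blast
  moreover have "(g \<cdot> f) \<cdot> f' \<cdot> g' = g \<cdot> (f \<cdot> f') \<cdot> g'"
    using assoc_mid f g by blast
  ultimately show ?thesis
    using f g id_comp[OF f(1)] id_comp[OF g(2)] arr_comp[OF f(1) g(1)] arr_comp[OF g(2) f(2)]
    by (intro isoI[of A C _ "f' \<cdot> g'"]) simp_all
qed

lemma iso_of_both_inverses:
  assumes "arr A B b" "arr B A l" "arr B A r" "l \<cdot> b = Ide \<C> A" "b \<cdot> r = Ide \<C> B"
  shows "is_iso \<C> A B b"
proof -
  have "l = r"
    using assoc[OF assms(3,1,2)] assms comp_id[OF assms(2)] id_comp[OF assms(3)] by simp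
  then show ?thesis using assms by (auto intro: isoI)
qed

lemma realizesD:
  assumes "rlz A f B g C \<delta>"
  shows "ext C A \<delta>" "arr A B f" "arr B C g" "g \<cdot> f = zm A C" "A \<in> Obj \<C>" "B \<in> Obj \<C>" "C \<in> Obj \<C>"
proof -
  from assms have *: "C \<in> Obj \<C>" "A \<in> Obj \<C>" "\<delta> \<in> exts \<C> C A" "(B, f, g) \<in> realize \<C> C A \<delta>"
    by (auto simp: realizes_def extension_def)
  then have "is_complex \<C> A C (B, f, g)"
    using realize_class[OF *(1-3)] by (auto simp: complex_class_def)
  then show "ext C A \<delta>" "arr A B f" "arr B C g" "g \<cdot> f = zm A C" "A \<in> Obj \<C>" "B \<in> Obj \<C>" "C \<in> Obj \<C>"
    using * by (auto simp: is_complex_def arrow_def extension_def)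
qed

lemma realization:
  assumes "ext C A \<delta>"
  obtains f B g where "rlz A f B g C \<delta>"
proof -
  from assms obtain s where s: "is_complex \<C> A C s" "realize \<C> C A \<delta> = complex_class \<C> A C s"
    using realize_class[of C A \<delta>] by (auto simp: extension_def)
  obtain B f g where [simp]: "s = (B, f, g)" by (cases s)
  have "arr A B f" "arr B C g" using s(1) by (auto simp: is_complex_def arrow_def)
  then have "complex_equiv \<C> s s"
    using iso_id[of B] by (auto simp: complex_equiv_def comp_id id_comp arr_obj intro!: exI[of _ "Ide \<C> B"])
  then show thesis using that s assms by (auto simp: realizes_def complex_class_def)
qed

lemma realizes_unique:
  assumes "rlz A f B g C \<delta>" "rlz A f' B' g' C \<delta>"
  obtains b where "is_iso \<C> B B' b" "b \<cdot> f = f'" "g' \<cdot> b = g"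
proof -
  from assms obtain s where s: "is_complex \<C> A C s" "realize \<C> C A \<delta> = complex_class \<C> A C s"
    using realize_class[of C A \<delta>] by (auto simp: realizes_def extension_def)
  obtain S u v where [simp]: "s = (S, u, v)" by (cases s)
  from assms s obtain b1 b2 where b1: "is_iso \<C> S B b1" "b1 \<cdot> u = f" "g \<cdot> b1 = v"
    and b2: "is_iso \<C> S B' b2" "b2 \<cdot> u = f'" "g' \<cdot> b2 = v"
    by (auto simp: realizes_def complex_class_def complex_equiv_def)
  note B = realizesD[OF assms(1)] realizesD[OF assms(2)]
  have u: "arr A S u" using s(1) by (auto simp: is_complex_def arrow_def)
  obtain c where c: "arr S B b1" "arr B S c" "c \<cdot> b1 = Ide \<C> S" "b1 \<cdot> c = Ide \<C> B"
    using isoE[OF b1(1)] by blast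
  then have ciso: "is_iso \<C> B S c" by (auto intro: isoI)
  have b2a: "arr S B' b2" using isoE[OF b2(1)] by blast
  have "(b2 \<cdot> c) \<cdot> f = f'"
  proof -
    have "(b2 \<cdot> c) \<cdot> b1 \<cdot> u = b2 \<cdot> (c \<cdot> b1) \<cdot> u" using assoc_mid c b2a u by blast
    then show ?thesis using b1 b2 c u by (simp add: id_comp)
  qed
  moreover have "g' \<cdot> b2 \<cdot> c = g"
  proof -
    have "g' \<cdot> b2 \<cdot> c = (g' \<cdot> b2) \<cdot> c" using assoc[OF c(2) b2a B(10)] by simp
    also have "\<dots> = (g \<cdot> b1) \<cdot> c" using b1 b2 by simp
    also have "\<dots> = g" using B c by (simp add: assoc[of B S c B b1 C g] comp_id)
    finally show ?thesis .
  qed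
  ultimately show thesis
    using that comp_iso[OF ciso b2(1)] by blast
qed

lemma realizes_iso_middle:
  assumes "rlz A f B g C \<delta>" "is_iso \<C> B B' b" "arr A B' f'" "arr B' C g'" "b \<cdot> f = f'" "g' \<cdot> b = g"
  shows "rlz A f' B' g' C \<delta>"
proof -
  from assms obtain s where s: "is_complex \<C> A C s" "realize \<C> C A \<delta> = complex_class \<C> A C s"
    using realize_class[of C A \<delta>] by (auto simp: realizes_def extension_def)
  obtain S u v where [simp]: "s = (S, u, v)" by (cases s)
  from assms s obtain b1 where b1: "is_iso \<C> S B b1" "b1 \<cdot> u = f" "g \<cdot> b1 = v"
    by (auto simp: realizes_def complex_class_def complex_equiv_def)
  note B = realizesD[OF assms(1)]
  have u: "arr A S u" using s(1) by (auto simp: is_complex_def arrow_def)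
  have b1a: "arr S B b1" using isoE[OF b1(1)] by blast
  have ba: "arr B B' b" using isoE[OF assms(2)] by blast
  have "(b \<cdot> b1) \<cdot> u = f'" using assoc[OF u b1a ba] b1 assms by simp
  moreover have "g' \<cdot> b \<cdot> b1 = v" using assoc[OF b1a ba assms(4)] b1 assms by simp
  ultimately have "complex_equiv \<C> s (B', f', g')"
    using comp_iso[OF b1(1) assms(2)] by (auto simp: complex_equiv_def)
  moreover have "g' \<cdot> f' = zm A C"
  proof -
    have "g' \<cdot> b \<cdot> f = (g' \<cdot> b) \<cdot> f" using assoc[OF B(2) ba assms(4)] by simp
    then show ?thesis using assms B by simp
  qed
  ultimately show ?thesis
    using s assms B by (auto simp: realizes_def complex_class_def is_complex_def arrow_def)
qed

end

section \<open>The opposite extriangulated category\<close>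

context extriangulated_category
begin

text \<open>
  Reversing arrows turns the isomorphism of middle terms into one in the other direction, so
  its inverse is used.
\<close>

lemma complex_equiv_op:
  assumes "is_complex \<C> A C (B, f, g)" "is_complex \<C> A C (B', f', g')"
  shows "complex_equiv (op_cat \<C>) (B, g, f) (B', g', f') \<longleftrightarrow> complex_equiv \<C> (B, f, g) (B', f', g')"
proof -
  have B: "arr A B f" "arr B C g" "arr A B' f'" "arr B' C g'"
    using assms by (auto simp: is_complex_def arrow_def)
  have 1: "\<exists>c. is_iso \<C> B' B c \<and> g \<cdot> c = g' \<and> c \<cdot> f' = f"
    if b: "is_iso \<C> B B' b" "b \<cdot> f = f'" "g' \<cdot> b = g" and B: "arr A B f" "arr B' C g'" for B B' b f f' g g'
  proof -
    obtain c where c: "arr B B' b" "arr B' B c" "c \<cdot> b = Ide \<C> B" "b \<cdot> c = Ide \<C> B'"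
      using isoE[OF b(1)] by blast
    have "g \<cdot> c = g'" using assoc[OF c(2,1) B(2)] b c comp_id[OF B(2)] by simp
    moreover have "c \<cdot> f' = f" using assoc[OF B(1) c(1,2)] b c id_comp[OF B(1)] by simp
    ultimately show ?thesis using c isoI[OF c(2,1)] by auto
  qed
  show ?thesis
    unfolding complex_equiv_def
    using 1[of B B' _ f f' g' g] 1[of B' B _ f' f g g'] B by (fastforce simp: complex_equiv_def)
qed

lemma biproduct_swap:
  assumes "is_biproduct \<C> A B S i j p q"
  shows "is_biproduct \<C> B A S j i q p"
proof -
  have "i \<cdot> p \<in> homs \<C> S S" "j \<cdot> q \<in> homs \<C> S S" "S \<in> Obj \<C>"
    using assms Comp_closed[of S A S p i] Comp_closed[of S B S q j] by (simp_all add: is_biproduct_def)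
  from abelian_monoid.a_comm[OF abelian_group.axioms(1)[OF hom_group[OF this(3,3)]] this(1,2)]
  show ?thesis using assms by (simp add: is_biproduct_def)
qed

text \<open>
  Every axiom is turned into its dual, (ET3) and (ET4) into their opposites. Each statement proved for
  extriangulated categories therefore also holds with all arrows reversed; this is how the
  dual exactness and pushout statements below are obtained.
\<close>

lemma op_extriangulated: "extriangulated_category R (op_cat \<C>)"
proof (rule extriangulated_category.intro[OF additive_linear_category.intro[OF is_cring
      additive_linear_category_axioms.intro] extriangulated_category_axioms.intro], goal_cases)
  case (1 A B) then show ?case by (simp add: hom_module)
next
  case (2 A B f) then show ?case using hom_Dom_Cod[of B A f] by simp
next
  case (3 A) then show ?case by (simp add: Ide_closed)
next
  case (4 A B C f g) then show ?case using Comp_closed[of C B A g f] by simp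
next
  case (5 A B f) then show ?case using Ide_Comp[of B A f] by simp
next
  case (6 A B f) then show ?case using Comp_Ide[of B A f] by simp
next
  case (7 A B C D f g h) then show ?case using Comp_assoc[of D C B A h g f] by simp
next
  case (8 A B C f g g') then show ?case using Comp_add_right[of C B A g g' f] by simp
next
  case (9 A B C f f' g) then show ?case using Comp_add_left[of C B A g f f'] by simp
next
  case (10 A B C r f g) then show ?case using Comp_smult_right[of C B A r g f] by simp
next
  case (11 A B C r f g) then show ?case using Comp_smult_left[of C B A r g f] by simp
next
  case 12 then show ?case using ex_zero_object by simp
next
  case (13 A B) then show ?case using ex_biproduct[of A B] by simp blast
next
  case (14 C A) then show ?case by (simp add: ext_module)
next
  case (15 C A A' a \<delta>) then show ?case by (simp add: pull_closed)
next
  case (16 C C' A c \<delta>) then show ?case by (simp add: push_closed)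
next
  case (17 C A \<delta>) then show ?case by (simp add: pull_Ide)
next
  case (18 C A \<delta>) then show ?case by (simp add: push_Ide)
next
  case (19 C A A' A'' a a' \<delta>) then show ?case using pull_Comp[of A A' A'' C a a' \<delta>] by simp
next
  case (20 C C' C'' A c c' \<delta>) then show ?case using push_Comp[of A C C' C'' c c' \<delta>] by simp
next
  case (21 C C' A A' a c \<delta>) then show ?case using push_pull[of A A' C C' c a \<delta>] by simp
next
  case (22 C A A' a \<delta> \<delta>') then show ?case using pull_add[of A A' C a \<delta> \<delta>'] by simp
next
  case (23 C C' A c \<delta> \<delta>') then show ?case using push_add[of A C C' c \<delta> \<delta>'] by simp
next
  case (24 C A A' a r \<delta>) then show ?case using pull_smult[of A A' C a r \<delta>] by simp
next
  case (25 C C' A c r \<delta>) then show ?case using push_smult[of A C C' c r \<delta>] by simp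
next
  case (26 C A A' a a' \<delta>) then show ?case using add_pull[of A A' C a a' \<delta>] by simp
next
  case (27 C C' A c c' \<delta>) then show ?case using add_push[of A C C' c c' \<delta>] by simp
next
  case (28 C A A' r a \<delta>) then show ?case using smult_pull[of A A' C r a \<delta>] by simp
next
  case (29 C C' A r c \<delta>) then show ?case using smult_push[of A C C' r c \<delta>] by simp
next
  case (30 C A \<delta>)
  then have 0: "A \<in> Obj \<C>" "C \<in> Obj \<C>" "\<delta> \<in> exts \<C> A C" by simp_all
  from realize_class[OF this] obtain B f g where
    s: "is_complex \<C> C A (B, f, g)" "realize \<C> A C \<delta> = complex_class \<C> C A (B, f, g)"
    by (metis surj_pair)
  have c: "is_complex (op_cat \<C>) A C (B', g', f') \<longleftrightarrow> is_complex \<C> C A (B', f', g')" for B' f' g'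
    by (auto simp: is_complex_def)
  have "t \<in> realize (op_cat \<C>) C A \<delta> \<longleftrightarrow> t \<in> complex_class (op_cat \<C>) A C (B, g, f)" for t
  proof -
    obtain B' g' f' where [simp]: "t = (B', g', f')" by (cases t)
    show ?thesis
      using s complex_equiv_op[of C A B f g B' f' g'] by (auto simp: complex_class_def c)
  qed
  then show ?case using s(1) c by blast
next
  case (31 A C S i j p q)
  then have "is_biproduct \<C> A C S p q i j" by simp
  from realize_zero[OF biproduct_swap[OF this]] show ?case by simp
next
  case (32 \<delta> C A \<delta>' C' A' B f g B' f' g' SA iA iA' pA pA' SB iB iB' pB pB' SC iC iC' pC pC')
  then have bp: "is_biproduct \<C> A A' SA pA pA' iA iA'" "is_biproduct \<C> B B' SB pB pB' iB iB'"
    "is_biproduct \<C> C C' SC pC pC' iC iC'"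
    by (simp_all only: op_cat_simps)
  have d: "\<delta> \<in> exts \<C> A C" "\<delta>' \<in> exts \<C> A' C'" "(B, g, f) \<in> realize \<C> A C \<delta>" "(B', g', f') \<in> realize \<C> A' C' \<delta>'"
    using 32(1-4) by (simp_all only: op_cat_sel)
  have o: "A \<in> Obj \<C>" "C \<in> Obj \<C>" "A' \<in> Obj \<C>" "C' \<in> Obj \<C>"
    using bp by (simp_all add: is_biproduct_def)
  have r: "rlz C g B f A \<delta>" "rlz C' g' B' f' A' \<delta>'"
    using d o by (simp_all add: realizes_def extension_def)
  have a: "arr SA A iA" "arr SA A' iA'" "arr B SB pB" "arr B' SB pB'" "arr C SC pC" "arr C' SC pC'"
     "arr SB B iB" "arr SB B' iB'" "arr SC C iC" "arr SC C' iC'" "arr A SA pA" "arr A' SA pA'"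
    using bp by (simp_all add: is_biproduct_def arrow_def)
  have e: "pull \<C> iA SC (push \<C> A pC \<delta>) = push \<C> SA pC (pull \<C> iA C \<delta>)"
     "pull \<C> iA' SC (push \<C> A' pC' \<delta>') = push \<C> SA pC' (pull \<C> iA' C' \<delta>')"
    using push_pull_commute realizesD(1)[OF r(1)] realizesD(1)[OF r(2)] a by simp_all
  note rr = realizesD(2,3)[OF r(1)] realizesD(2,3)[OF r(2)]
  from realize_sum[OF d bp(3,2,1)] show ?case
    by (simp only: op_cat_sel e assoc[OF a(7) rr(2) a(11)] assoc[OF a(8) rr(4) a(12)]
       assoc[OF a(9) rr(1) a(3)] assoc[OF a(10) rr(3) a(4)])
next
  case (33 A C A' C' \<delta> \<delta>' B f g B' f' g' a c)
  then show ?case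
    using realize_morphism[of C' A' C A \<delta>' \<delta> B' g' f' B g f c a] by (simp only: op_cat_sel) auto
next
  case (34 A C A' C' \<delta> \<delta>' B f g B' f' g' a b)
  then show ?case
    using ET3_op[of C' A' C A \<delta>' \<delta> B' g' f' B g f b a] by (simp only: op_cat_sel) metis
next
  case (35 A C A' C' \<delta> \<delta>' B f g B' f' g' b c)
  then show ?case
    using ET3[of C' A' C A \<delta>' \<delta> B' g' f' B g f c b] by (simp only: op_cat_sel) metis
next
  case (36 A B D F \<delta> \<delta>' f f' C g g')
  then show ?case
    using ET4_op[of A B D F \<delta> \<delta>' f' f C g' g] by (simp only: op_cat_sel)
next
  case (37 A B D F \<delta> \<delta>' f' f C g' g)
  then show ?case
    using ET4[of A B D F \<delta> \<delta>' f f' C g g'] by (simp only: op_cat_sel)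
qed

end

section \<open>Exact sequences and split conflations\<close>

context extriangulated_category
begin

lemma realizesI: "\<lbrakk>ext C A \<delta>; (B, f, g) \<in> realize \<C> C A \<delta>\<rbrakk> \<Longrightarrow> rlz A f B g C \<delta>"
  by (simp add: realizes_def)

lemma morphism_middle:
  assumes "rlz A f B g C \<delta>" "rlz A' f' B' g' C' \<delta>'" "arr A A' a" "arr C C' c"
    "push \<C> C a \<delta> = pull \<C> c A' \<delta>'"
  obtains b where "arr B B' b" "b \<cdot> f = f' \<cdot> a" "g' \<cdot> b = c \<cdot> g"
  using realize_morphism[of A C A' C' \<delta> \<delta>' B f g B' f' g' a c] realizesD(6)[OF assms(1)]
    realizesD(6)[OF assms(2)] assms
  unfolding realizes_def extension_def arrow_def by blast

lemma morphism_right: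
  assumes "rlz A f B g C \<delta>" "rlz A' f' B' g' C' \<delta>'" "arr A A' a" "arr B B' b" "b \<cdot> f = f' \<cdot> a"
  obtains c where "arr C C' c" "c \<cdot> g = g' \<cdot> b" "push \<C> C a \<delta> = pull \<C> c A' \<delta>'"
  using ET3[of A C A' C' \<delta> \<delta>' B f g B' f' g' a b] assms
  unfolding realizes_def extension_def arrow_def by blast

lemma morphism_left:
  assumes "rlz A f B g C \<delta>" "rlz A' f' B' g' C' \<delta>'" "arr B B' b" "arr C C' c" "c \<cdot> g = g' \<cdot> b"
  obtains a where "arr A A' a" "b \<cdot> f = f' \<cdot> a" "push \<C> C a \<delta> = pull \<C> c A' \<delta>'"
  using ET3_op[of A C A' C' \<delta> \<delta>' B f g B' f' g' b c] assms
  unfolding realizes_def extension_def arrow_def by blast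

lemma compose_inflations:
  assumes "rlz A f B f' D \<delta>" "rlz B g C g' F \<delta>'"
  obtains E h d e \<delta>'' where "rlz A (g \<cdot> f) C h E \<delta>''" "rlz D d E e F (push \<C> F f' \<delta>')"
    "h \<cdot> g = d \<cdot> f'" "e \<cdot> h = g'" "pull \<C> d A \<delta>'' = \<delta>" "push \<C> E f \<delta>'' = pull \<C> e B \<delta>'"
proof -
  note 1 = realizesD[OF assms(1)] and 2 = realizesD[OF assms(2)]
  from assms have "\<delta> \<in> exts \<C> D A" "\<delta>' \<in> exts \<C> F B" "(B, f, f') \<in> realize \<C> D A \<delta>" "(C, g, g') \<in> realize \<C> F B \<delta>'"
    by (simp_all add: realizes_def extension_def)
  from ET4[OF 1(5,6,7) 2(7) this] obtain E h d e \<delta>'' where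
    *: "E \<in> Obj \<C>" "h \<in> homs \<C> C E" "d \<in> homs \<C> D E" "e \<in> homs \<C> E F" "\<delta>'' \<in> exts \<C> E A"
      "(C, g \<cdot> f, h) \<in> realize \<C> E A \<delta>''"
      "h \<cdot> g = d \<cdot> f'" "e \<cdot> h = g'" "(E, d, e) \<in> realize \<C> F D (push \<C> F f' \<delta>')"
      "pull \<C> d A \<delta>'' = \<delta>" "push \<C> E f \<delta>'' = pull \<C> e B \<delta>'"
    by auto
  have "rlz A (g \<cdot> f) C h E \<delta>''"
    using * 1 by (simp add: realizes_def extension_def)
  moreover have "rlz D d E e F (push \<C> F f' \<delta>')"
    using * ext_push[OF 2(1) 1(3)] by (simp add: realizes_def)
  ultimately show thesis using that * by blast
qed

lemma compose_deflations:
  assumes "rlz D f' B f A \<delta>" "rlz F g' C g B \<delta>'"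
  obtains E h d e \<delta>'' where "rlz E h C (f \<cdot> g) A \<delta>''" "rlz F e E d D (pull \<C> f' F \<delta>')"
    "g \<cdot> h = f' \<cdot> d" "h \<cdot> e = g'" "push \<C> A d \<delta>'' = \<delta>" "pull \<C> f E \<delta>'' = push \<C> B e \<delta>'"
proof -
  interpret op: extriangulated_category R "op_cat \<C>" by (rule op_extriangulated)
  from assms have "op.rlz A f B f' D \<delta>" "op.rlz B g C g' F \<delta>'" by simp_all
  from op.compose_inflations[OF this] show thesis using that by simp metis
qed

lemma zero_hom: "\<lbrakk>zero_object \<C> Z; arr Z A f\<rbrakk> \<Longrightarrow> f = zm Z A"
  by (auto simp: zero_object_def arrow_def)

lemma zero_obj: "zero_object \<C> Z \<Longrightarrow> Z \<in> Obj \<C>"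
  by (simp add: zero_object_def)

lemma biproduct_realizes:
  assumes "is_biproduct \<C> A C S i j p q"
  shows "rlz A i S q C (ze C A)"
  using realize_zero[OF assms] assms ext_zero[of C A] by (simp add: realizes_def is_biproduct_def)

lemma biproduct_arr:
  assumes "is_biproduct \<C> A B S i j p q"
  shows "arr A S i" "arr B S j" "arr S A p" "arr S B q" "p \<cdot> i = Ide \<C> A" "q \<cdot> j = Ide \<C> B"
    "q \<cdot> i = zm A B" "p \<cdot> j = zm B A" "(i \<cdot> p) \<oplus>\<^bsub>Hom \<C> S S\<^esub> (j \<cdot> q) = Ide \<C> S"
  using assms by (auto simp: is_biproduct_def arrow_def)

lemma biproductI:
  assumes "arr A S i" "arr B S j" "arr S A p" "arr S B q" "p \<cdot> i = Ide \<C> A" "q \<cdot> j = Ide \<C> B"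
    "q \<cdot> i = zm A B" "p \<cdot> j = zm B A" "(i \<cdot> p) \<oplus>\<^bsub>Hom \<C> S S\<^esub> (j \<cdot> q) = Ide \<C> S"
  shows "is_biproduct \<C> A B S i j p q"
  using assms by (auto simp: is_biproduct_def arrow_def)

lemma biproduct_zero:
  assumes Z: "zero_object \<C> Z" and A: "A \<in> Obj \<C>"
  shows "is_biproduct \<C> A Z A (Ide \<C> A) (zm Z A) (Ide \<C> A) (zm A Z)"
proof (rule biproductI)
  note z = zero_obj[OF Z]
  note i = arr_id[OF A] arr_zero[OF z A] arr_zero[OF A z]
  show "arr A A (Ide \<C> A)" "arr Z A (zm Z A)" "arr A A (Ide \<C> A)" "arr A Z (zm A Z)" by (fact i)+
  show "zm A Z \<cdot> zm Z A = Ide \<C> Z"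
    using zero_hom[OF Z arr_comp[OF i(2,3)]] zero_hom[OF Z arr_id[OF z]] by simp
  show "Ide \<C> A \<cdot> Ide \<C> A \<oplus>\<^bsub>Hom \<C> A A\<^esub> zm Z A \<cdot> zm A Z = Ide \<C> A"
    using comp_id[OF i(1)] zero_comp[OF i(3) A] add_zero[OF i(1)] by simp
qed (use A zero_obj[OF Z] in \<open>auto simp: comp_id[OF arr_id] zero_comp[OF arr_id] comp_zero[OF arr_id]\<close>)

lemma realizes_id_zero:
  assumes "zero_object \<C> Z" "A \<in> Obj \<C>"
  shows "rlz A (Ide \<C> A) A (zm A Z) Z (ze Z A)"
  by (rule biproduct_realizes[OF biproduct_zero[OF assms]])

lemma realizes_zero_id:
  assumes "zero_object \<C> Z" "A \<in> Obj \<C>"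
  shows "rlz Z (zm Z A) A (Ide \<C> A) A (ze A Z)"
  by (rule biproduct_realizes[OF biproduct_swap[OF biproduct_zero[OF assms]]])

text \<open>
  Exactness of \<open>Hom(X,-)\<close> at \<open>B\<close> and at \<open>C\<close> comes from morphisms between a realization and the trivial
  conflations \<open>X \<rightarrow> X \<rightarrow> 0\<close> and \<open>0 \<rightarrow> X \<rightarrow> X\<close>.
\<close>

lemma kernel_lift:
  assumes r: "rlz A f B g C \<delta>" and u: "arr X B u" "g \<cdot> u = zm X C"
  obtains a where "arr X A a" "f \<cdot> a = u"
proof -
  obtain Z where Z: "zero_object \<C> Z" using ex_zero_object by blast
  note X = arr_obj(1)[OF u(1)] and C = realizesD(7)[OF r]
  have "zm Z C \<cdot> zm X Z = g \<cdot> u"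
    using zero_comp[OF arr_zero[OF X zero_obj[OF Z]] C] u by simp
  from morphism_left[OF realizes_id_zero[OF Z X] r u(1) arr_zero[OF zero_obj[OF Z] C] this]
  obtain a where "arr X A a" "u \<cdot> Ide \<C> X = f \<cdot> a" by blast
  then show thesis using that comp_id[OF u(1)] by simp
qed

lemma deflation_lift:
  assumes r: "rlz A f B g C \<delta>" and c: "arr X C c" "pull \<C> c A \<delta> = ze X A"
  obtains b where "arr X B b" "g \<cdot> b = c"
proof -
  obtain Z where Z: "zero_object \<C> Z" using ex_zero_object by blast
  note X = arr_obj(1)[OF c(1)] and A = realizesD(5)[OF r]
  have "push \<C> X (zm Z A) (ze X Z) = pull \<C> c A \<delta>"
    using push_ze[OF X arr_zero[OF zero_obj[OF Z] A]] c by simp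
  from morphism_middle[OF realizes_zero_id[OF Z X] r arr_zero[OF zero_obj[OF Z] A] c(1) this]
  obtain b where "arr X B b" "g \<cdot> b = c \<cdot> Ide \<C> X" by blast
  then show thesis using that comp_id[OF c(1)] by simp
qed

lemma pull_deflation:
  assumes r: "rlz A f B g C \<delta>"
  shows "pull \<C> g A \<delta> = ze B A"
proof -
  obtain Z where Z: "zero_object \<C> Z" using ex_zero_object by blast
  note A = realizesD(5)[OF r] and B = realizesD(6)[OF r]
  note z = arr_zero[OF zero_obj[OF Z] A]
  have "Ide \<C> B \<cdot> zm Z B = f \<cdot> zm Z A"
    using zero_hom[OF Z arr_comp[OF arr_zero[OF zero_obj[OF Z] B] arr_id[OF B]]]
      comp_zero[OF realizesD(2)[OF r] zero_obj[OF Z]] by simp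
  from morphism_right[OF realizes_zero_id[OF Z B] r z arr_id[OF B] this]
  obtain c where "arr B C c" "c \<cdot> Ide \<C> B = g \<cdot> Ide \<C> B"
    "push \<C> B (zm Z A) (ze B Z) = pull \<C> c A \<delta>" by blast
  then show ?thesis using comp_id realizesD(3)[OF r] push_ze[OF B z] by metis
qed

lemma cokernel_extend:
  assumes r: "rlz A f B g C \<delta>" and u: "arr B X u" "u \<cdot> f = zm A X"
  obtains c where "arr C X c" "c \<cdot> g = u"
proof -
  interpret op: extriangulated_category R "op_cat \<C>" by (rule op_extriangulated)
  show thesis using op.kernel_lift[of C g B f A \<delta> X u] assms that by auto
qed

lemma inflation_extend:
  assumes r: "rlz A f B g C \<delta>" and a: "arr A X a" "push \<C> C a \<delta> = ze C X"
  obtains b where "arr B X b" "b \<cdot> f = a"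
proof -
  interpret op: extriangulated_category R "op_cat \<C>" by (rule op_extriangulated)
  show thesis using op.deflation_lift[of C g B f A \<delta> X a] assms that by auto
qed

lemma push_inflation:
  assumes r: "rlz A f B g C \<delta>"
  shows "push \<C> C f \<delta> = ze C B"
proof -
  interpret op: extriangulated_category R "op_cat \<C>" by (rule op_extriangulated)
  show ?thesis using op.pull_deflation[of C g B f A \<delta>] assms by auto
qed

text \<open>
  Exactness of \<open>\<bbbE>(X,A) \<rightarrow> \<bbbE>(X,B) \<rightarrow> \<bbbE>(X,C)\<close>. By (ET4) the zero extension \<open>g\<^sub>*\<theta>\<close> is realized by a
  conflation \<open>C \<rightarrow> E \<rightarrow> X\<close>, and \<open>E\<close> carries an extension by \<open>A\<close>. A section of \<open>E \<rightarrow> X\<close> pulls it back to a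
  preimage of \<open>\<theta>\<close>.
\<close>

lemma push_exact:
  assumes r: "rlz A f B g C \<delta>" and \<theta>: "ext X B \<theta>" "push \<C> X g \<theta> = ze X C"
  obtains \<theta>' where "ext X A \<theta>'" "push \<C> X f \<theta>' = \<theta>"
proof -
  obtain x D y where D: "rlz B x D y X \<theta>" using realization[OF \<theta>(1)] by blast
  from compose_inflations[OF r D] obtain E h d e \<delta>'' where
    E: "rlz A (x \<cdot> f) D h E \<delta>''" "rlz C d E e X (push \<C> X g \<theta>)" "push \<C> E f \<delta>'' = pull \<C> e B \<theta>"
    by metis
  note X = ext_obj(2)[OF \<theta>(1)]
  have "pull \<C> (Ide \<C> X) C (push \<C> X g \<theta>) = ze X C"
    using \<theta>(2) pull_id[OF ext_zero[OF X realizesD(7)[OF r]]] by simp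
  from deflation_lift[OF E(2) arr_id[OF X] this] obtain s where s: "arr X E s" "e \<cdot> s = Ide \<C> X" by blast
  have "push \<C> X f (pull \<C> s A \<delta>'') = pull \<C> s B (push \<C> E f \<delta>'')"
    using push_pull_commute[OF realizesD(1)[OF E(1)] realizesD(2)[OF r] s(1)] .
  also have "\<dots> = pull \<C> (e \<cdot> s) B \<theta>"
    using pull_comp[OF \<theta>(1) realizesD(3)[OF E(2)] s(1)] E(3) by simp
  also have "\<dots> = \<theta>" using s(2) pull_id[OF \<theta>(1)] by simp
  finally show thesis using that ext_pull[OF realizesD(1)[OF E(1)] s(1)] by blast
qed

lemma pull_exact:
  assumes r: "rlz A f B g C \<delta>" and \<theta>: "ext B X \<theta>" "pull \<C> f X \<theta> = ze A X"
  obtains \<theta>' where "ext C X \<theta>'" "pull \<C> g X \<theta>' = \<theta>"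
proof -
  interpret op: extriangulated_category R "op_cat \<C>" by (rule op_extriangulated)
  show thesis using op.push_exact[of C g B f A \<delta> X \<theta>] assms that by auto
qed

lemma biproduct_iso:
  assumes "is_biproduct \<C> A C S i j p q" "arr S B b" "arr B S c" "c \<cdot> b = Ide \<C> S" "b \<cdot> c = Ide \<C> B"
  shows "is_biproduct \<C> A C B (b \<cdot> i) (b \<cdot> j) (p \<cdot> c) (q \<cdot> c)"
proof -
  note B = biproduct_arr[OF assms(1)]
  have m: "(p' \<cdot> c) \<cdot> (b \<cdot> i') = p' \<cdot> i'" if "arr X S i'" "arr S Y p'" for p' i' X Y
    using assoc_mid[OF that(1) assms(2,3) that(2)] assms(4) id_comp[OF that(1)] by simp
  have n: "(b \<cdot> i') \<cdot> (p' \<cdot> c) = b \<cdot> (i' \<cdot> p') \<cdot> c" if "arr S X p'" "arr X S i'" for p' i' X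
    using assoc_mid[OF assms(3) that assms(2)] .
  have "(b \<cdot> i) \<cdot> (p \<cdot> c) \<oplus>\<^bsub>Hom \<C> B B\<^esub> (b \<cdot> j) \<cdot> (q \<cdot> c) =
     b \<cdot> ((i \<cdot> p) \<oplus>\<^bsub>Hom \<C> S S\<^esub> (j \<cdot> q)) \<cdot> c"
    using B assms(2,3) n[OF B(3,1)] n[OF B(4,2)] comp_add_left[OF assms(3) arr_comp[OF B(3,1)] arr_comp[OF B(4,2)]]
      comp_add_right[OF arr_comp[OF assms(3) arr_comp[OF B(3,1)]] arr_comp[OF assms(3) arr_comp[OF B(4,2)]] assms(2)] by simp
  also have "\<dots> = Ide \<C> B" using B(9) id_comp[OF assms(3)] assms(5) by simp
  finally show ?thesis
    using B arr_comp[OF B(1) assms(2)] arr_comp[OF B(2) assms(2)] arr_comp[OF assms(3) B(3)]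
      arr_comp[OF assms(3) B(4)] by (intro biproductI) (simp_all add: m[OF B(1,3)] m[OF B(2,4)] m[OF B(1,4)] m[OF B(2,3)])
qed

lemma realizes_split:
  assumes r: "rlz A f B g C (ze C A)"
  obtains s t where "is_biproduct \<C> A C B f s t g"
proof -
  obtain S i j p q where S: "is_biproduct \<C> A C S i j p q"
    using ex_biproduct[OF realizesD(5,7)[OF r]] by blast
  from realizes_unique[OF biproduct_realizes[OF S] r] obtain b where
    b: "is_iso \<C> S B b" "b \<cdot> i = f" "g \<cdot> b = q" by blast
  obtain c where c: "arr S B b" "arr B S c" "c \<cdot> b = Ide \<C> S" "b \<cdot> c = Ide \<C> B"
    using isoE[OF b(1)] by blast
  have "g = q \<cdot> c"
    using assoc[OF c(2,1) realizesD(3)[OF r]] b(3) c(4) comp_id[OF realizesD(3)[OF r]] by simp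
  then show thesis using that biproduct_iso[OF S c] b(2) by simp
qed

text \<open>
  The difference \<open>m\<close> of \<open>n\<close> and the identity kills \<open>f\<close>, so it factors through \<open>g\<close>; it is also killed by \<open>g\<close>.
  Hence \<open>m\<close> has square zero, and \<open>1 + m\<close> is inverted by \<open>1 - m\<close>.
\<close>

lemma middle_endo_iso:
  assumes r: "rlz A f B g C \<delta>" and n: "arr B B n" "n \<cdot> f = f" "g \<cdot> n = g"
  shows "is_iso \<C> B B n"
proof -
  note D = realizesD[OF r]
  interpret H: abelian_group "Hom \<C> B B" using hom_group D(6) by blast
  note I = arr_id[OF D(6)]
  define m where "m = n \<oplus>\<^bsub>Hom \<C> B B\<^esub> (\<ominus>\<^bsub>Hom \<C> B B\<^esub> Ide \<C> B)"
  define k where "k = Ide \<C> B \<oplus>\<^bsub>Hom \<C> B B\<^esub> (\<ominus>\<^bsub>Hom \<C> B B\<^esub> m)"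
  have m: "arr B B m" unfolding m_def by (intro arr_add arr_neg n I)
  have k: "arr B B k" unfolding k_def by (intro arr_add arr_neg m I)
  have c: "n \<in> homs \<C> B B" "m \<in> homs \<C> B B" "Ide \<C> B \<in> homs \<C> B B" "k \<in> homs \<C> B B"
    using n m I k by (auto simp: arrow_def)
  have n': "n = Ide \<C> B \<oplus>\<^bsub>Hom \<C> B B\<^esub> m"
    unfolding m_def using c by (simp add: H.a_lcomm[of _ n] H.r_neg)
  interpret HA: abelian_group "Hom \<C> A B" using hom_group D(5,6) by blast
  interpret HC: abelian_group "Hom \<C> B C" using hom_group D(6,7) by blast
  have "m \<cdot> f = f \<oplus>\<^bsub>Hom \<C> A B\<^esub> (\<ominus>\<^bsub>Hom \<C> A B\<^esub> f)"
    unfolding m_def using comp_add_left[OF D(2) n(1) arr_neg[OF I]] n neg_comp[OF D(2) I] id_comp[OF D(2)] by simp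
  then have "m \<cdot> f = zm A B" using D(2) HA.r_neg by (simp add: arrow_def)
  then obtain c' where c': "arr C B c'" "c' \<cdot> g = m" using cokernel_extend[OF r m] by blast
  have "g \<cdot> m = g \<oplus>\<^bsub>Hom \<C> B C\<^esub> (\<ominus>\<^bsub>Hom \<C> B C\<^esub> g)"
    unfolding m_def using comp_add_right[OF n(1) arr_neg[OF I] D(3)] n comp_neg[OF I D(3)] comp_id[OF D(3)] by simp
  then have "g \<cdot> m = zm B C" using D(3) HC.r_neg by (simp add: arrow_def)
  then have mm: "m \<cdot> m = zm B B"
    using assoc[OF m D(3) c'(1)] comp_zero[OF c'(1) D(6)] c'(2) by simp
  have "m \<cdot> k = m"
    unfolding k_def using comp_add_right[OF I arr_neg[OF m] m] comp_id[OF m] comp_neg[OF m m] mm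
      c add_zero[OF m] by (simp add: H.add.inv_one[folded a_inv_def])
  then have 1: "n \<cdot> k = Ide \<C> B"
    using n' comp_add_left[OF k I m] id_comp[OF k] c \<open>m \<cdot> k = m\<close> by (simp add: k_def H.a_assoc H.l_neg)
  have "k \<cdot> m = m"
    unfolding k_def using comp_add_left[OF m I arr_neg[OF m]] id_comp[OF m] neg_comp[OF m m] mm
      c add_zero[OF m] by (simp add: H.add.inv_one[folded a_inv_def])
  then have "k \<cdot> n = Ide \<C> B"
    using n' comp_add_right[OF I m k] comp_id[OF k] c \<open>k \<cdot> m = m\<close> by (simp add: k_def H.a_assoc H.l_neg)
  with 1 show ?thesis by (intro isoI[OF n(1) k])
qed

end

section \<open>Pullbacks of conflations\<close>

context extriangulated_category
begin

lemma iso_of_composites: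
  assumes b: "arr A B b" and c: "arr B A c" and "is_iso \<C> A A (c \<cdot> b)" "is_iso \<C> B B (b \<cdot> c)"
  shows "is_iso \<C> A B b"
proof -
  obtain w where w: "arr A A w" "w \<cdot> c \<cdot> b = Ide \<C> A" using isoE[OF assms(3)] by metis
  obtain v where v: "arr B B v" "(b \<cdot> c) \<cdot> v = Ide \<C> B" using isoE[OF assms(4)] by metis
  show ?thesis
    using iso_of_both_inverses[OF b arr_comp[OF c w(1)] arr_comp[OF v(1) c]]
      assoc[OF b c w(1)] assoc[OF v(1) c b] w v by simp
qed

text \<open>
  Comparing with any realization of the transported extension, in both directions, gives two morphisms of middle
  terms whose composites are isomorphisms by \<open>middle_endo_iso\<close>.
\<close>

lemma realizes_iso_right:
  assumes r: "rlz A f B g C \<delta>" and c: "arr C C' c" "arr C' C c'" "c' \<cdot> c = Ide \<C> C" "c \<cdot> c' = Ide \<C> C'"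
  shows "rlz A f B (c \<cdot> g) C' (pull \<C> c' A \<delta>)"
proof -
  note D = realizesD[OF r]
  obtain f1 B1 g1 where r1: "rlz A f1 B1 g1 C' (pull \<C> c' A \<delta>)"
    using realization[OF ext_pull[OF D(1) c(2)]] by blast
  note D1 = realizesD[OF r1]
  have "push \<C> C (Ide \<C> A) \<delta> = pull \<C> c A (pull \<C> c' A \<delta>)"
    using push_id[OF D(1)] pull_comp[OF D(1) c(2,1)] c(3) pull_id[OF D(1)] by simp
  from morphism_middle[OF r r1 arr_id[OF D(5)] c(1) this] comp_id[OF D1(2)]
  obtain b where b: "arr B B1 b" "b \<cdot> f = f1" "g1 \<cdot> b = c \<cdot> g" by metis
  from morphism_middle[OF r1 r arr_id[OF D(5)] c(2)] push_id[OF D1(1)] comp_id[OF D(2)]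
  obtain b' where b': "arr B1 B b'" "b' \<cdot> f1 = f" "g \<cdot> b' = c' \<cdot> g1" by metis
  have "g \<cdot> b' \<cdot> b = g"
    using assoc[OF b(1) b'(1) D(3)] assoc[OF b(1) D1(3) c(2)] b(3) b'(3) assoc[OF D(3) c(1,2)] c(3)
      id_comp[OF D(3)] by simp
  then have 1: "is_iso \<C> B B (b' \<cdot> b)"
    using middle_endo_iso[OF r arr_comp[OF b(1) b'(1)]] assoc[OF D(2) b(1) b'(1)] b(2) b'(2) by simp
  have "g1 \<cdot> b \<cdot> b' = g1"
    using assoc[OF b'(1) b(1) D1(3)] assoc[OF b'(1) D(3) c(1)] b(3) b'(3) assoc[OF D1(3) c(2,1)] c(4)
      id_comp[OF D1(3)] by simp
  then have 2: "is_iso \<C> B1 B1 (b \<cdot> b')"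
    using middle_endo_iso[OF r1 arr_comp[OF b'(1) b(1)]] assoc[OF D1(2) b'(1) b(1)] b(2) b'(2) by simp
  have "(c \<cdot> g) \<cdot> b' = g1"
    using assoc[OF b'(1) D(3) c(1)] b'(3) assoc[OF D1(3) c(2,1)] c(4) id_comp[OF D1(3)] by simp
  with realizes_iso_middle[OF r1 iso_of_composites[OF b'(1) b(1) 2 1] D(2) arr_comp[OF D(3) c(1)] b'(2)]
  show ?thesis by simp
qed

lemma realizes_iso_left:
  assumes r: "rlz A f B g C \<delta>" and c: "arr A A' a" "arr A' A a'" "a' \<cdot> a = Ide \<C> A" "a \<cdot> a' = Ide \<C> A'"
  shows "rlz A' (f \<cdot> a') B g C (push \<C> C a \<delta>)"
proof -
  interpret op: extriangulated_category R "op_cat \<C>" by (rule op_extriangulated)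
  show ?thesis
    using op.realizes_iso_right[of C g B f A \<delta> A' a' a] assms by simp
qed

text \<open>
  (ET4) for the split inflation of \<open>A1\<close> into \<open>E\<close>: the cone of the composite \<open>A1 \<rightarrow> M\<close> is the middle term of a
  realization of the second component of \<open>\<delta>\<close>, so it is \<open>B2\<close> up to isomorphism.
\<close>

lemma pullback_half:
  assumes bp: "is_biproduct \<C> A1 A2 E i1 i2 p1 p2" and r: "rlz E g M h C \<delta>"
    and r2: "rlz A2 f2 B2 g2 C (push \<C> C p2 \<delta>)"
  obtains e2 where "rlz A1 (g \<cdot> i1) M e2 B2 (pull \<C> g2 A1 (push \<C> C p1 \<delta>))" "e2 \<cdot> g \<cdot> i2 = f2"
proof -
  note P = biproduct_arr[OF bp] and D = realizesD[OF r] and D2 = realizesD[OF r2]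
  from compose_inflations[OF biproduct_realizes[OF bp] r] obtain E' h' d e \<delta>3 where
    E: "rlz A1 (g \<cdot> i1) M h' E' \<delta>3" "rlz A2 d E' e C (push \<C> C p2 \<delta>)" "h' \<cdot> g = d \<cdot> p2"
      "push \<C> E' i1 \<delta>3 = pull \<C> e E \<delta>" by metis
  obtain \<beta> where \<beta>: "is_iso \<C> E' B2 \<beta>" "\<beta> \<cdot> d = f2" "g2 \<cdot> \<beta> = e"
    using realizes_unique[OF E(2) r2] by blast
  obtain \<beta>' where b: "arr E' B2 \<beta>" "arr B2 E' \<beta>'" "\<beta>' \<cdot> \<beta> = Ide \<C> E'" "\<beta> \<cdot> \<beta>' = Ide \<C> B2"
    using isoE[OF \<beta>(1)] by blast
  note DE = realizesD[OF E(1)] and DE2 = realizesD[OF E(2)]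
  have "\<delta>3 = push \<C> E' (p1 \<cdot> i1) \<delta>3" using P(5) push_id[OF DE(1)] by simp
  also have "\<dots> = push \<C> E' p1 (pull \<C> e E \<delta>)" using push_comp[OF DE(1) P(1,3)] E(4) by simp
  also have "\<dots> = pull \<C> e A1 (push \<C> C p1 \<delta>)" using push_pull_commute[OF D(1) P(3) DE2(3)] .
  finally have "pull \<C> \<beta>' A1 \<delta>3 = pull \<C> (e \<cdot> \<beta>') A1 (push \<C> C p1 \<delta>)"
    using pull_comp[OF ext_push[OF D(1) P(3)] DE2(3) b(2)] by simp
  also have "e \<cdot> \<beta>' = g2" using assoc[OF b(2,1) D2(3)] \<beta>(3) b(4) comp_id[OF D2(3)] by simp
  finally have "rlz A1 (g \<cdot> i1) M (\<beta> \<cdot> h') B2 (pull \<C> g2 A1 (push \<C> C p1 \<delta>))"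
    using realizes_iso_right[OF E(1) b] by simp
  moreover have "(\<beta> \<cdot> h') \<cdot> g \<cdot> i2 = f2"
    using assoc_mid[OF P(2) D(2) DE(3) b(1)] E(3) assoc[OF P(2) P(4) DE2(2)] P(6) comp_id[OF DE2(2)] \<beta>(2) by simp
  ultimately show thesis using that by blast
qed

text \<open>
  The object \<open>M\<close> is the middle term of the sum of both extensions in \<open>\<bbbE>(C, A1 \<oplus> A2)\<close>; the two conflations
  are then exchanged by symmetry. The last equation states that the sum is killed by its own inflation; it is
  what identifies a retraction of \<open>m1\<close> on \<open>A2\<close> up to maps that extend to \<open>B2\<close>.
\<close>

lemma pullback:
  assumes r1: "rlz A1 f1 B1 g1 C \<delta>1" and r2: "rlz A2 f2 B2 g2 C \<delta>2"
  obtains M m1 m2 e1 e2 where "rlz A1 m1 M e2 B2 (pull \<C> g2 A1 \<delta>1)" "rlz A2 m2 M e1 B1 (pull \<C> g1 A2 \<delta>2)"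
    "e1 \<cdot> m1 = f1" "e2 \<cdot> m2 = f2" "push \<C> C m1 \<delta>1 \<oplus>\<^bsub>Ext \<C> C M\<^esub> push \<C> C m2 \<delta>2 = ze C M"
proof -
  note D1 = realizesD[OF r1] and D2 = realizesD[OF r2]
  obtain E i1 i2 p1 p2 where bp: "is_biproduct \<C> A1 A2 E i1 i2 p1 p2"
    using ex_biproduct[OF D1(5) D2(5)] by blast
  note P = biproduct_arr[OF bp]
  define \<delta> where "\<delta> = push \<C> C i1 \<delta>1 \<oplus>\<^bsub>Ext \<C> C E\<^esub> push \<C> C i2 \<delta>2"
  have e: "ext C E (push \<C> C i1 \<delta>1)" "ext C E (push \<C> C i2 \<delta>2)"
    using ext_push D1 D2 P by blast+
  then have \<delta>: "ext C E \<delta>" unfolding \<delta>_def by (rule ext_add)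
  have p: "push \<C> C p (push \<C> C i d) = push \<C> C (p \<cdot> i) d" if "ext C X d" "arr X E i" "arr E Y p" for X d Y p i
    using push_comp[OF that] by simp
  have 1: "push \<C> C p1 \<delta> = \<delta>1"
    unfolding \<delta>_def using push_additive[OF e P(3)] p[OF D1(1) P(1,3)] p[OF D2(1) P(2,3)] P(5,8)
      push_id[OF D1(1)] zero_push[OF D2(1) D1(5)] ext_add_zero[OF D1(1)] by simp
  have 2: "push \<C> C p2 \<delta> = \<delta>2"
    unfolding \<delta>_def using push_additive[OF e P(4)] p[OF D1(1) P(1,4)] p[OF D2(1) P(2,4)] P(6,7)
      push_id[OF D2(1)] zero_push[OF D1(1) D2(5)] ext_zero_add[OF D2(1)] by simp
  obtain g M h where r: "rlz E g M h C \<delta>" using realization[OF \<delta>] by blast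
  obtain e2 where e2: "rlz A1 (g \<cdot> i1) M e2 B2 (pull \<C> g2 A1 \<delta>1)" "e2 \<cdot> g \<cdot> i2 = f2"
    using pullback_half[OF bp r, of f2 B2 g2] r2 1 2 by metis
  obtain e1 where e1: "rlz A2 (g \<cdot> i2) M e1 B1 (pull \<C> g1 A2 \<delta>2)" "e1 \<cdot> g \<cdot> i1 = f1"
    using pullback_half[OF biproduct_swap[OF bp] r, of f1 B1 g1] r1 1 2 by metis
  have "push \<C> C (g \<cdot> i1) \<delta>1 \<oplus>\<^bsub>Ext \<C> C M\<^esub> push \<C> C (g \<cdot> i2) \<delta>2 = push \<C> C g \<delta>"
    unfolding \<delta>_def using push_additive[OF e realizesD(2)[OF r]] push_comp[OF D1(1) P(1) realizesD(2)[OF r]]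
      push_comp[OF D2(1) P(2) realizesD(2)[OF r]] by simp
  also have "\<dots> = ze C M" by (rule push_inflation[OF r])
  finally show thesis using that e1 e2 by blast
qed

end

section \<open>The calculus of conflations\<close>

definition conf :: "('o, 'm, 'r, 'e, 'z) extri_cat_scheme \<Rightarrow> 'o \<Rightarrow> 'o \<Rightarrow> 'o \<Rightarrow> bool" where
  "conf \<C> A B C \<longleftrightarrow> (\<exists>f g \<delta>. realizes \<C> A f B g C \<delta>)"

definition biproduct_of :: "('o, 'm, 'r, 'z) lin_cat_scheme \<Rightarrow> 'o \<Rightarrow> 'o \<Rightarrow> 'o \<Rightarrow> bool" where
  "biproduct_of \<C> A B S \<longleftrightarrow> (\<exists>i j p q. is_biproduct \<C> A B S i j p q)"

definition orth :: "('o, 'm, 'r, 'e, 'z) extri_cat_scheme \<Rightarrow> 'o \<Rightarrow> 'o \<Rightarrow> bool" where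
  "orth \<C> C A \<longleftrightarrow> C \<in> Obj \<C> \<and> A \<in> Obj \<C> \<and> exts \<C> C A = {\<zero>\<^bsub>Ext \<C> C A\<^esub>}"

lemma op_conf [simp]: "conf (op_cat \<C>) A B C \<longleftrightarrow> conf \<C> C B A"
  unfolding conf_def op_cat_simps by blast

lemma op_orth [simp]: "orth (op_cat \<C>) C A \<longleftrightarrow> orth \<C> A C"
  by (auto simp: orth_def)

lemma op_biproduct_of [simp]: "biproduct_of (op_cat \<C>) A B S \<longleftrightarrow> biproduct_of \<C> A B S"
  unfolding biproduct_of_def op_cat_simps by blast

text \<open>
  The properties of conflations that remain when morphisms are forgotten: \<open>bp A B S\<close> says that \<open>S\<close> is a biproduct,
  \<open>cf A B C\<close> that there is a conflation \<open>A \<rightarrow> B \<rightarrow> C\<close>, and \<open>ort C A\<close> that \<open>\<bbbE>(C,A)\<close> is zero. Isomorphism is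
  expressed by a biproduct with a zero object.
\<close>

locale conflation_calculus =
  fixes ob :: "'o set" and null :: "'o \<Rightarrow> bool" and bp :: "'o \<Rightarrow> 'o \<Rightarrow> 'o \<Rightarrow> bool"
    and cf :: "'o \<Rightarrow> 'o \<Rightarrow> 'o \<Rightarrow> bool" and ort :: "'o \<Rightarrow> 'o \<Rightarrow> bool"
  assumes ex_null: "\<exists>Z. null Z"
    and null_ob: "null Z \<Longrightarrow> Z \<in> ob"
    and bp_ob: "bp A B S \<Longrightarrow> A \<in> ob \<and> B \<in> ob \<and> S \<in> ob"
    and cf_ob: "cf A B C \<Longrightarrow> A \<in> ob \<and> B \<in> ob \<and> C \<in> ob"
    and ex_bp: "\<lbrakk>A \<in> ob; B \<in> ob\<rbrakk> \<Longrightarrow> \<exists>S. bp A B S"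
    and bp_swap: "bp A B S \<Longrightarrow> bp B A S"
    and bp_assoc: "\<lbrakk>bp A B S; bp S T U\<rbrakk> \<Longrightarrow> \<exists>W. bp B T W \<and> bp A W U"
    and bp_null: "\<lbrakk>null Z; A \<in> ob\<rbrakk> \<Longrightarrow> bp A Z A"
    and cf_bp: "bp A C B \<Longrightarrow> cf A B C"
    and cf_sum: "\<lbrakk>cf A B C; cf A' B' C'; bp A A' SA; bp B B' SB; bp C C' SC\<rbrakk> \<Longrightarrow> cf SA SB SC"
    and cf_split: "\<lbrakk>cf A B C; ort C A\<rbrakk> \<Longrightarrow> bp A C B"
    and cf_comp_left: "\<lbrakk>cf A B D; cf B C F\<rbrakk> \<Longrightarrow> \<exists>E. cf A C E \<and> cf D E F"
    and cf_comp_right: "\<lbrakk>cf D B A; cf F C B\<rbrakk> \<Longrightarrow> \<exists>E. cf E C A \<and> cf F E D"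
    and cf_pullback: "\<lbrakk>cf A1 B1 C; cf A2 B2 C\<rbrakk> \<Longrightarrow> \<exists>M. cf A1 M B2 \<and> cf A2 M B1"
    and cf_pushout: "\<lbrakk>cf A B1 C1; cf A B2 C2\<rbrakk> \<Longrightarrow> \<exists>M. cf B1 M C2 \<and> cf B2 M C1"
    and ort_null_left: "\<lbrakk>null Z; A \<in> ob\<rbrakk> \<Longrightarrow> ort Z A"
    and ort_null_right: "\<lbrakk>null Z; A \<in> ob\<rbrakk> \<Longrightarrow> ort A Z"
    and ort_middle_right: "\<lbrakk>cf A B C; ort X A; ort X C\<rbrakk> \<Longrightarrow> ort X B"
    and ort_middle_left: "\<lbrakk>cf A B C; ort A X; ort C X\<rbrakk> \<Longrightarrow> ort B X"
    and ort_summand_right: "\<lbrakk>bp A B S; ort X S\<rbrakk> \<Longrightarrow> ort X A"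
    and ort_summand_left: "\<lbrakk>bp A B S; ort S X\<rbrakk> \<Longrightarrow> ort A X"

lemma (in conflation_calculus) dual:
  "conflation_calculus ob null bp (\<lambda>A B C. cf C B A) (\<lambda>C A. ort A C)"
proof (unfold_locales, goal_cases)
  case 1 show ?case by (rule ex_null)
next
  case (2 Z) then show ?case by (rule null_ob)
next
  case (3 A B S) then show ?case by (rule bp_ob)
next
  case (4 A B C) then show ?case using cf_ob by blast
next
  case (5 A B) then show ?case by (rule ex_bp)
next
  case (6 A B S) then show ?case by (rule bp_swap)
next
  case (7 A B S T U) then show ?case by (rule bp_assoc)
next
  case (8 Z A) then show ?case by (rule bp_null)
next
  case (9 A C B) then show ?case by (rule cf_bp[OF bp_swap])
next
  case (10 A B C A' B' C' SA SB SC) then show ?case using cf_sum by blast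
next
  case (11 A B C) then show ?case using bp_swap[OF cf_split] by blast
next
  case (12 A B D C F) then show ?case using cf_comp_right by blast
next
  case (13 D B A F C) then show ?case using cf_comp_left by blast
next
  case (14 A1 B1 C A2 B2) then show ?case using cf_pushout by blast
next
  case (15 A B1 C1 B2 C2) then show ?case using cf_pullback by blast
next
  case (16 Z A) then show ?case by (rule ort_null_right)
next
  case (17 Z A) then show ?case by (rule ort_null_left)
next
  case (18 A B C X) then show ?case using ort_middle_left by blast
next
  case (19 A B C X) then show ?case using ort_middle_right by blast
next
  case (20 A B S X) then show ?case by (rule ort_summand_left)
next
  case (21 A B S X) then show ?case by (rule ort_summand_right)
qed

context extriangulated_category
begin

lemma orthI: "\<lbrakk>C \<in> Obj \<C>; A \<in> Obj \<C>; \<And>d. ext C A d \<Longrightarrow> d = ze C A\<rbrakk> \<Longrightarrow> orth \<C> C A"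
  using ext_zero[of C A] unfolding orth_def extension_def by blast

lemma orthD: "\<lbrakk>orth \<C> C A; ext C A d\<rbrakk> \<Longrightarrow> d = ze C A"
  unfolding orth_def extension_def by blast

lemma orth_middle_right:
  assumes "conf \<C> A B C" "orth \<C> X A" "orth \<C> X C"
  shows "orth \<C> X B"
proof -
  obtain f g \<delta> where r: "rlz A f B g C \<delta>" using assms(1) by (auto simp: conf_def)
  note D = realizesD[OF r]
  have X: "X \<in> Obj \<C>" using assms(2) by (simp add: orth_def)
  show ?thesis
  proof (rule orthI[OF X D(6)])
    fix d assume d: "ext X B d"
    have "push \<C> X g d = ze X C" using orthD[OF assms(3) ext_push[OF d D(3)]] .
    then obtain d' where "ext X A d'" "push \<C> X f d' = d" using push_exact[OF r d] by blast
    then show "d = ze X B" using orthD[OF assms(2)] push_ze[OF X D(2)] by metis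
  qed
qed

lemma orth_summand_right:
  assumes "biproduct_of \<C> A B S" "orth \<C> X S"
  shows "orth \<C> X A"
proof -
  obtain i j p q where bp: "is_biproduct \<C> A B S i j p q" using assms(1) by (auto simp: biproduct_of_def)
  note P = biproduct_arr[OF bp]
  have X: "X \<in> Obj \<C>" using assms(2) by (simp add: orth_def)
  show ?thesis
  proof (rule orthI[OF X arr_obj(1)[OF P(1)]])
    fix d assume d: "ext X A d"
    have "d = push \<C> X p (push \<C> X i d)" using push_comp[OF d P(1,3)] P(5) push_id[OF d] by simp
    also have "\<dots> = ze X A" using orthD[OF assms(2) ext_push[OF d P(1)]] push_ze[OF X P(3)] by simp
    finally show "d = ze X A" .
  qed
qed

text \<open>
  Apply (ET4) to the two split inflations: the composite inflation is split by the composite of the projections, so the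
  conflation that it starts is a biproduct as well.
\<close>

lemma biproduct_of_assoc:
  assumes "biproduct_of \<C> A B S" "biproduct_of \<C> S T U"
  shows "\<exists>W. biproduct_of \<C> B T W \<and> biproduct_of \<C> A W U"
proof -
  obtain i j p q where 1: "is_biproduct \<C> A B S i j p q" using assms(1) by (auto simp: biproduct_of_def)
  obtain k l r s where 2: "is_biproduct \<C> S T U k l r s" using assms(2) by (auto simp: biproduct_of_def)
  note P = biproduct_arr[OF 1] and Q = biproduct_arr[OF 2]
  obtain W h d e \<delta> where W: "rlz A (k \<cdot> i) U h W \<delta>" "rlz B d W e T (push \<C> T q (ze T S))"
    using compose_inflations[OF biproduct_realizes[OF 1] biproduct_realizes[OF 2]] by metis
  note D = realizesD[OF W(1)]
  have "(p \<cdot> r) \<cdot> k \<cdot> i = Ide \<C> A"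
    using assoc_mid[OF P(1) Q(1,3) P(3)] P(5) Q(5) id_comp[OF P(1)] by simp
  then have "\<delta> = push \<C> W (p \<cdot> r) (push \<C> W (k \<cdot> i) \<delta>)"
    using push_comp[OF D(1,2) arr_comp[OF Q(3) P(3)]] push_id[OF D(1)] by simp
  then have "\<delta> = ze W A"
    using push_inflation[OF W(1)] push_ze[OF D(7) arr_comp[OF Q(3) P(3)]] by simp
  then obtain u v where "is_biproduct \<C> A W U (k \<cdot> i) u v h" using realizes_split W(1) by metis
  moreover obtain u' v' where "is_biproduct \<C> B T W d u' v' e"
    using realizes_split W(2) push_ze[OF arr_obj(1)[OF Q(2)] P(4)] by metis
  ultimately show ?thesis unfolding biproduct_of_def by blast
qed

lemma conflation_calculus_instance:
  "conflation_calculus (Obj \<C>) (zero_object \<C>) (biproduct_of \<C>) (conf \<C>) (orth \<C>)"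
proof (unfold_locales, goal_cases)
  case 1 then show ?case by (rule ex_zero_object)
next
  case (2 Z) then show ?case by (rule zero_obj)
next
  case (3 A B S) then show ?case by (auto simp: biproduct_of_def is_biproduct_def)
next
  case (4 A B C) then show ?case unfolding conf_def using realizesD(5-7) by blast
next
  case (5 A B) then show ?case using ex_biproduct by (auto simp: biproduct_of_def)
next
  case (6 A B S) then show ?case unfolding biproduct_of_def using biproduct_swap by blast
next
  case (7 A B S T U) then show ?case by (rule biproduct_of_assoc)
next
  case (8 Z A) then show ?case unfolding biproduct_of_def using biproduct_zero by blast
next
  case (9 A C B) then show ?case unfolding biproduct_of_def conf_def using biproduct_realizes by blast
next
  case (10 A B C A' B' C' SA SB SC)
  then obtain f g \<delta> f' g' \<delta>' where r: "rlz A f B g C \<delta>" "rlz A' f' B' g' C' \<delta>'"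
    unfolding conf_def by blast
  from 10 obtain iA iA' pA pA' iB iB' pB pB' iC iC' pC pC' where
    b: "is_biproduct \<C> A A' SA iA iA' pA pA'" "is_biproduct \<C> B B' SB iB iB' pB pB'"
    "is_biproduct \<C> C C' SC iC iC' pC pC'" unfolding biproduct_of_def by blast
  note PA = biproduct_arr[OF b(1)] and PC = biproduct_arr[OF b(3)]
  have "ext SC SA (push \<C> SC iA (pull \<C> pC A \<delta>) \<oplus>\<^bsub>Ext \<C> SC SA\<^esub> push \<C> SC iA' (pull \<C> pC' A' \<delta>'))"
    by (intro ext_add ext_push[OF ext_pull[OF realizesD(1)[OF r(1)] PC(3)] PA(1)]
         ext_push[OF ext_pull[OF realizesD(1)[OF r(2)] PC(4)] PA(2)])
  from realizesI[OF this realize_sum[OF _ _ _ _ b]] r show ?case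
    unfolding conf_def realizes_def extension_def by metis
next
  case (11 A B C)
  then obtain f g \<delta> where r: "rlz A f B g C \<delta>" unfolding conf_def by blast
  with 11(2) have "rlz A f B g C (ze C A)" using orthD[OF 11(2) realizesD(1)[OF r]] by simp
  then show ?case by (rule realizes_split) (auto simp: biproduct_of_def)
next
  case (12 A B D C F) then show ?case unfolding conf_def by (elim exE) (erule (1) compose_inflations, blast)
next
  case (13 D B A F C) then show ?case unfolding conf_def by (elim exE) (erule (1) compose_deflations, blast)
next
  case (14 A1 B1 C A2 B2) then show ?case unfolding conf_def by (elim exE) (erule (1) pullback, blast)
next
  case (15 A B1 C1 B2 C2)
  interpret op: extriangulated_category R "op_cat \<C>" by (rule op_extriangulated)
  have "\<exists>M. conf (op_cat \<C>) C1 M B2 \<and> conf (op_cat \<C>) C2 M B1"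
    if "conf (op_cat \<C>) C1 B1 A" "conf (op_cat \<C>) C2 B2 A"
    using that unfolding conf_def by (elim exE) (erule (1) op.pullback, blast)
  then show ?case using 15 by auto
next
  case (16 Z A)
  show ?case
  proof (rule orthI)
    fix d assume d: "ext Z A d"
    have "Ide \<C> Z = zm Z Z" using zero_hom[OF 16(1) arr_id[OF zero_obj[OF 16(1)]]] .
    then show "d = ze Z A" using pull_id[OF d] zero_pull[OF d zero_obj[OF 16(1)]] by simp
  qed (use 16 zero_obj in auto)
next
  case (17 Z A)
  show ?case
  proof (rule orthI)
    fix d assume d: "ext A Z d"
    have "Ide \<C> Z = zm Z Z" using zero_hom[OF 17(1) arr_id[OF zero_obj[OF 17(1)]]] .
    then show "d = ze A Z" using push_id[OF d] zero_push[OF d zero_obj[OF 17(1)]] by simp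
  qed (use 17 zero_obj in auto)
next
  case (18 A B C X) then show ?case by (rule orth_middle_right)
next
  case (19 A B C X)
  interpret op: extriangulated_category R "op_cat \<C>" by (rule op_extriangulated)
  show ?case using op.orth_middle_right[of C B A X] 19 by simp
next
  case (20 A B S X) then show ?case by (rule orth_summand_right)
next
  case (21 A B S X)
  interpret op: extriangulated_category R "op_cat \<C>" by (rule op_extriangulated)
  show ?case using op.orth_summand_right[of A B S X] 21 by simp
qed

end

section \<open>Zero tensors in the coend of an exact presheaf\<close>

text \<open>
  A contravariant functor to abelian groups, compatible with scalars and exact at the middle term of each
  conflation. By \<open>scalar_mor\<close>, a scalar acts as its multiple of the identity morphism, which
  determines the module structure.
\<close>

locale exact_presheaf = extriangulated_category R \<C>
  for R :: "('r, 'y) ring_scheme" (structure)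
  and \<C> :: "('o, 'm, 'r, 'e, 'z) extri_cat_scheme"
  and F :: "('o, 'm, 'r, 'e) presheaf" +
  assumes obj_group: "X \<in> Obj \<C> \<Longrightarrow> abelian_group (psh_obj F X)"
    and mor_closed: "\<lbrakk>arrow \<C> X Y f; x \<in> carrier (psh_obj F Y)\<rbrakk> \<Longrightarrow> psh_mor F f x \<in> carrier (psh_obj F X)"
    and mor_add: "\<lbrakk>arrow \<C> X Y f; x \<in> carrier (psh_obj F Y); y \<in> carrier (psh_obj F Y)\<rbrakk>
      \<Longrightarrow> psh_mor F f (x \<oplus>\<^bsub>psh_obj F Y\<^esub> y) = psh_mor F f x \<oplus>\<^bsub>psh_obj F X\<^esub> psh_mor F f y"
    and mor_id: "\<lbrakk>X \<in> Obj \<C>; x \<in> carrier (psh_obj F X)\<rbrakk> \<Longrightarrow> psh_mor F (Ide \<C> X) x = x"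
    and mor_comp: "\<lbrakk>arrow \<C> X Y f; arrow \<C> Y W g; x \<in> carrier (psh_obj F W)\<rbrakk>
      \<Longrightarrow> psh_mor F (g \<bullet>\<^bsub>\<C>\<^esub> f) x = psh_mor F f (psh_mor F g x)"
    and add_mor: "\<lbrakk>arrow \<C> X Y f; arrow \<C> X Y g; x \<in> carrier (psh_obj F Y)\<rbrakk>
      \<Longrightarrow> psh_mor F (f \<oplus>\<^bsub>Hom \<C> X Y\<^esub> g) x = psh_mor F f x \<oplus>\<^bsub>psh_obj F X\<^esub> psh_mor F g x"
    and scalar_closed: "\<lbrakk>r \<in> carrier R; X \<in> Obj \<C>; x \<in> carrier (psh_obj F X)\<rbrakk>
      \<Longrightarrow> r \<odot>\<^bsub>psh_obj F X\<^esub> x \<in> carrier (psh_obj F X)"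
    and scalar_mor: "\<lbrakk>r \<in> carrier R; arrow \<C> X Y f; x \<in> carrier (psh_obj F Y)\<rbrakk>
      \<Longrightarrow> psh_mor F (r \<odot>\<^bsub>Hom \<C> X Y\<^esub> f) x = psh_mor F f (r \<odot>\<^bsub>psh_obj F Y\<^esub> x)"
    and half_exact: "\<lbrakk>realizes \<C> A f B g C \<delta>; x \<in> carrier (psh_obj F B); psh_mor F f x = \<zero>\<^bsub>psh_obj F A\<^esub>\<rbrakk>
      \<Longrightarrow> \<exists>y\<in>carrier (psh_obj F C). psh_mor F g y = x"
begin

abbreviation el where "el X \<equiv> carrier (psh_obj F X)"
abbreviation act where "act \<equiv> psh_mor F"
abbreviation zF where "zF X \<equiv> \<zero>\<^bsub>psh_obj F X\<^esub>"
abbreviation ceq where "ceq \<equiv> coend_eq R \<C> F"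
abbreviation cl where "cl \<equiv> coend_class R \<C> F"
abbreviation typed where "typed C P \<equiv> set_mset P \<subseteq> pure_tensors \<C> F C"

lemma zero_el: "X \<in> Obj \<C> \<Longrightarrow> zF X \<in> el X"
  using abelian_group.axioms(1)[OF obj_group] abelian_monoid.zero_closed by blast
lemma add_el: "\<lbrakk>X \<in> Obj \<C>; x \<in> el X; y \<in> el X\<rbrakk> \<Longrightarrow> x \<oplus>\<^bsub>psh_obj F X\<^esub> y \<in> el X"
  using abelian_group.axioms(1)[OF obj_group] abelian_monoid.a_closed by metis
lemma neg_el: "\<lbrakk>X \<in> Obj \<C>; x \<in> el X\<rbrakk> \<Longrightarrow> \<ominus>\<^bsub>psh_obj F X\<^esub> x \<in> el X"
  using abelian_group.a_inv_closed[OF obj_group] by blast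

lemma act_zero: "arr X Y f \<Longrightarrow> act f (zF Y) = zF X"
  by (rule additive_map_zero[OF obj_group obj_group]) (auto simp: arr_obj mor_closed mor_add)
lemma act_neg: "\<lbrakk>arr X Y f; x \<in> el Y\<rbrakk> \<Longrightarrow> act f (\<ominus>\<^bsub>psh_obj F Y\<^esub> x) = \<ominus>\<^bsub>psh_obj F X\<^esub> act f x"
  by (rule additive_map_minus[OF obj_group obj_group]) (auto simp: arr_obj mor_closed mor_add)
lemma zero_act: "\<lbrakk>X \<in> Obj \<C>; Y \<in> Obj \<C>; x \<in> el Y\<rbrakk> \<Longrightarrow> act (zm X Y) x = zF X"
  by (rule additive_map_zero[OF hom_group obj_group, where \<phi> = "\<lambda>f. act f x"])
     (auto simp: arrow_def mor_closed add_mor)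
lemma neg_act: "\<lbrakk>arr X Y f; x \<in> el Y\<rbrakk> \<Longrightarrow> act (\<ominus>\<^bsub>Hom \<C> X Y\<^esub> f) x = \<ominus>\<^bsub>psh_obj F X\<^esub> act f x"
  by (rule additive_map_minus[OF hom_group obj_group, where \<phi> = "\<lambda>f. act f x"])
     (auto simp: arrow_def mor_closed add_mor)
lemma scalar_via_mor:
  assumes "r \<in> carrier R" "X \<in> Obj \<C>" "x \<in> el X"
  shows "r \<odot>\<^bsub>psh_obj F X\<^esub> x = act (r \<odot>\<^bsub>Hom \<C> X X\<^esub> Ide \<C> X) x"
  using scalar_mor[OF assms(1) arr_id[OF assms(2)] assms(3)] mor_id[OF assms(2) scalar_closed[OF assms]] by simp

lemma pure_iff: "(X, x, e) \<in> pure_tensors \<C> F C \<longleftrightarrow> X \<in> Obj \<C> \<and> x \<in> el X \<and> e \<in> exts \<C> C X"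
  by (auto simp: pure_tensors_def)

text \<open>
  The congruence relates arbitrary formal sums, also those with entries outside the modules, so it has to be
  checked that it never leads from a meaningful sum to a meaningless one.
\<close>

lemma ceq_typed:
  assumes "ceq C P Q" "C \<in> Obj \<C>"
  shows "typed C P \<longleftrightarrow> typed C Q"
  using assms
proof induction
  case (add_left X x x' e) then show ?case by (simp add: pure_iff add_el)
next
  case (add_right X x e e') then show ?case
    using ext_add[of C X e e'] by (simp add: pure_iff extension_def)
next
  case (zero X e) then show ?case by (simp add: pure_iff zero_el)
next
  case (balanced X r x e) then show ?case
    using ext_smult[of r C X e] by (simp add: pure_iff scalar_closed extension_def)
next
  case (dinatural X X' f x e) then show ?case
    using ext_push[of C X e X' f] mor_closed[of X X' f x] by (simp add: pure_iff extension_def arrow_def)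
qed auto

lemma ceq_add: "\<lbrakk>ceq C P P'; ceq C Q Q'\<rbrakk> \<Longrightarrow> ceq C (P + Q) (P' + Q')"
  by (metis coend_eq.plus coend_eq.trans add.commute)

text \<open>
  \<open>eval C K \<xi> P w\<close> records a way to rewrite the formal sum \<open>P\<close> as \<open>w \<otimes> \<xi>\<close>: each of its tensors has the form
  \<open>x \<otimes> k\<^sub>*\<xi>\<close>, which equals \<open>k\<^sup>*x \<otimes> \<xi>\<close>, and \<open>w\<close> is the sum of the \<open>k\<^sup>*x\<close>. The maps \<open>k\<close> may be chosen
  freely, so this is a relation.
\<close>

inductive eval for C K \<xi> where
  eval_empty: "eval C K \<xi> {#} (zF K)"
| eval_add: "\<lbrakk>eval C K \<xi> P w; arrow \<C> K Z k; x \<in> carrier (psh_obj F Z); push \<C> C k \<xi> = e\<rbrakk>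
    \<Longrightarrow> eval C K \<xi> (add_mset (Z, x, e) P) (w \<oplus>\<^bsub>psh_obj F K\<^esub> act k x)"

lemma eval_closed: "\<lbrakk>eval C K \<xi> P w; K \<in> Obj \<C>\<rbrakk> \<Longrightarrow> w \<in> el K"
  by (induction rule: eval.induct) (auto intro: zero_el add_el mor_closed)

lemma eval_emptyD: "eval C K \<xi> {#} w \<Longrightarrow> w = zF K"
  by (auto elim: eval.cases)

text \<open>
  A derivation may have added the tensors of a multiset in any order; they can be permuted so that a given one
  comes last.
\<close>

lemma eval_addD:
  assumes "eval C K \<xi> Q w" "K \<in> Obj \<C>" "Q = add_mset (Z, x, e) P"
  shows "\<exists>k w0. arr K Z k \<and> x \<in> el Z \<and> push \<C> C k \<xi> = e \<and> eval C K \<xi> P w0 \<and>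
     w = w0 \<oplus>\<^bsub>psh_obj F K\<^esub> act k x"
  using assms
proof (induction arbitrary: P rule: eval.induct)
  case eval_empty then show ?case by simp
next
  case (eval_add P' w' Z' k' x' e')
  interpret G: abelian_group "psh_obj F K" using obj_group eval_add.prems(1) by blast
  show ?case
  proof (cases "(Z', x', e') = (Z, x, e) \<and> P' = P")
    case True then show ?thesis using eval_add by auto
  next
    case False
    then obtain P'' where P: "P' = add_mset (Z, x, e) P''" "P = add_mset (Z', x', e') P''"
      using eval_add.prems(2) by (auto simp: add_eq_conv_ex)
    from eval_add.IH[OF eval_add.prems(1) P(1)] obtain k w0 where
      k: "arr K Z k" "x \<in> el Z" "push \<C> C k \<xi> = e" "eval C K \<xi> P'' w0"
        "w' = w0 \<oplus>\<^bsub>psh_obj F K\<^esub> act k x" by blast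
    have c: "w0 \<in> el K" "act k x \<in> el K" "act k' x' \<in> el K"
      using eval_closed[OF k(4) eval_add.prems(1)] mor_closed k eval_add.hyps by blast+
    have "eval C K \<xi> P (w0 \<oplus>\<^bsub>psh_obj F K\<^esub> act k' x')"
      unfolding P using eval.eval_add[OF k(4) eval_add.hyps(2-4)] .
    moreover have "w' \<oplus>\<^bsub>psh_obj F K\<^esub> act k' x' = (w0 \<oplus>\<^bsub>psh_obj F K\<^esub> act k' x') \<oplus>\<^bsub>psh_obj F K\<^esub> act k x"
      using c k(5) by (simp add: G.a_ac)
    ultimately show ?thesis using k by blast
  qed
qed

lemma eval_union:
  assumes "eval C K \<xi> P w" "eval C K \<xi> Q w'" "K \<in> Obj \<C>"
  shows "eval C K \<xi> (P + Q) (w \<oplus>\<^bsub>psh_obj F K\<^esub> w')"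
  using assms
proof (induction rule: eval.induct)
  case eval_empty
  interpret G: abelian_group "psh_obj F K" using obj_group eval_empty by blast
  show ?case using eval_empty eval_closed[OF eval_empty] by simp
next
  case (eval_add P w Z k x e)
  interpret G: abelian_group "psh_obj F K" using obj_group eval_add.prems by blast
  have c: "w \<in> el K" "act k x \<in> el K" "w' \<in> el K"
    using eval_closed eval_add mor_closed by blast+
  show ?case
    using eval.eval_add[OF eval_add.IH[OF eval_add.prems] eval_add.hyps(2-4)] c by (simp add: G.a_ac)
qed

lemma eval_single:
  assumes "arr K Z k" "x \<in> el Z" "push \<C> C k \<xi> = e"
  shows "eval C K \<xi> {#(Z, x, e)#} (act k x)"
proof -
  interpret G: abelian_group "psh_obj F K" using obj_group arr_obj[OF assms(1)] by blast
  show ?thesis using eval.eval_add[OF eval.eval_empty assms] mor_closed[OF assms(1,2)] by simp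
qed

lemma eval_single_id:
  assumes "ext C K \<xi>" "x \<in> el K"
  shows "eval C K \<xi> {#(K, x, \<xi>)#} x"
  using eval_single[OF arr_id[OF ext_obj(1)[OF assms(1)]] assms(2) push_id[OF assms(1)]]
    mor_id[OF ext_obj(1)[OF assms(1)] assms(2)] by simp

text \<open>
  The image of \<open>F(B)\<close> in \<open>F(K)\<close> for a realization \<open>K \<rightarrow> B \<rightarrow> C\<close> of \<open>\<xi>\<close>; by \<open>vanishD\<close> it is the same for all
  realizations.
\<close>

definition vanish where
  "vanish C K \<xi> v \<longleftrightarrow> (\<exists>i B p y. rlz K i B p C \<xi> \<and> y \<in> el B \<and> v = act i y)"

lemma vanishD:
  assumes "vanish C K \<xi> v" "rlz K i B p C \<xi>"
  obtains y where "y \<in> el B" "act i y = v"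
proof -
  from assms(1) obtain i0 B0 p0 y where r: "rlz K i0 B0 p0 C \<xi>" "y \<in> el B0" "v = act i0 y"
    unfolding vanish_def by blast
  from realizes_unique[OF assms(2) r(1)] obtain b where b: "is_iso \<C> B B0 b" "b \<cdot> i = i0" by blast
  then have ba: "arr B B0 b" by (elim isoE)
  from that[of "act b y"] show thesis
    using mor_comp[OF realizesD(2)[OF assms(2)] ba r(2)] b(2) r(3) mor_closed[OF ba r(2)] by simp
qed

lemma vanish_zero: "ext C K \<xi> \<Longrightarrow> vanish C K \<xi> (zF K)"
  unfolding vanish_def by (erule realization) (metis act_zero realizesD(2,6) zero_el)

lemma vanish_add:
  assumes "vanish C K \<xi> v" "vanish C K \<xi> v'"
  shows "vanish C K \<xi> (v \<oplus>\<^bsub>psh_obj F K\<^esub> v')"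
proof -
  from assms(1) obtain i B p y where r: "rlz K i B p C \<xi>" "y \<in> el B" "v = act i y"
    unfolding vanish_def by blast
  obtain y' where y': "y' \<in> el B" "act i y' = v'" using vanishD[OF assms(2) r(1)] by blast
  show ?thesis
    unfolding vanish_def using r y' mor_add[OF realizesD(2)[OF r(1)] r(2) y'(1)] add_el[OF realizesD(6)[OF r(1)] r(2) y'(1)]
    by metis
qed

lemma vanish_neg: "vanish C K \<xi> v \<Longrightarrow> vanish C K \<xi> (\<ominus>\<^bsub>psh_obj F K\<^esub> v)"
  unfolding vanish_def by (metis act_neg neg_el realizesD(2,6))

text \<open>
  Two maps \<open>k\<close>, \<open>k'\<close> with \<open>k\<^sub>*\<xi> = k'\<^sub>*\<xi>\<close> differ by a map that kills \<open>\<xi>\<close>, hence extends over the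
  inflation of \<open>\<xi>\<close>. Its action on \<open>F\<close> has values in the image of \<open>F(B)\<close>.
\<close>

lemma eval_unique:
  assumes "ext C K \<xi>" "eval C K \<xi> P w" "eval C K \<xi> P w'"
  shows "vanish C K \<xi> (w \<oplus>\<^bsub>psh_obj F K\<^esub> \<ominus>\<^bsub>psh_obj F K\<^esub> w')"
  using assms(2,3)
proof (induction P arbitrary: w w')
  case empty
  interpret G: abelian_group "psh_obj F K" using obj_group ext_obj(1)[OF assms(1)] by blast
  show ?case using eval_emptyD[OF empty(1)] eval_emptyD[OF empty(2)] vanish_zero[OF assms(1)]
    by (simp add: G.r_neg)
next
  case (add t P)
  obtain Z x e where t: "t = (Z, x, e)" by (cases t)
  note K = ext_obj(1)[OF assms(1)]
  interpret G: abelian_group "psh_obj F K" using obj_group K by blast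
  from eval_addD[OF add.prems(1) K, unfolded t, OF HOL.refl] obtain k w0 where
    k: "arr K Z k" "x \<in> el Z" "push \<C> C k \<xi> = e" "eval C K \<xi> P w0" "w = w0 \<oplus>\<^bsub>psh_obj F K\<^esub> act k x" by blast
  from eval_addD[OF add.prems(2) K, unfolded t, OF HOL.refl] obtain k' w0' where
    k': "arr K Z k'" "push \<C> C k' \<xi> = e" "eval C K \<xi> P w0'" "w' = w0' \<oplus>\<^bsub>psh_obj F K\<^esub> act k' x" by blast
  define m where "m = k \<oplus>\<^bsub>Hom \<C> K Z\<^esub> (\<ominus>\<^bsub>Hom \<C> K Z\<^esub> k')"
  have m: "arr K Z m" unfolding m_def by (intro arr_add arr_neg k k')
  interpret E: abelian_group "Ext \<C> C Z" using ext_group ext_obj[OF assms(1)] arr_obj[OF m] by blast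
  have "push \<C> C m \<xi> = e \<oplus>\<^bsub>Ext \<C> C Z\<^esub> (\<ominus>\<^bsub>Ext \<C> C Z\<^esub> e)"
    unfolding m_def using additive_push[OF assms(1) k(1) arr_neg[OF k'(1)]] neg_push[OF assms(1) k'(1)] k k' by simp
  also have "\<dots> = ze C Z" using ext_push[OF assms(1) k(1)] k(3) by (simp add: extension_def E.r_neg)
  finally have m0: "push \<C> C m \<xi> = ze C Z" .
  obtain i B p where r: "rlz K i B p C \<xi>" using realization[OF assms(1)] by blast
  obtain b where b: "arr B Z b" "b \<cdot> i = m" using inflation_extend[OF r m m0] by blast
  have "act m x = act i (act b x)" using mor_comp[OF realizesD(2)[OF r] b(1) k(2)] b(2) by simp
  then have v: "vanish C K \<xi> (act m x)" unfolding vanish_def using r mor_closed[OF b(1) k(2)] by blast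
  have am: "act m x = act k x \<oplus>\<^bsub>psh_obj F K\<^esub> \<ominus>\<^bsub>psh_obj F K\<^esub> act k' x"
    unfolding m_def using add_mor[OF k(1) arr_neg[OF k'(1)] k(2)] neg_act[OF k'(1) k(2)] by simp
  have c: "w0 \<in> el K" "w0' \<in> el K" "act k x \<in> el K" "act k' x \<in> el K"
    using eval_closed[OF k(4) K] eval_closed[OF k'(3) K] mor_closed[OF k(1,2)] mor_closed[OF k'(1) k(2)] by auto
  have "w \<oplus>\<^bsub>psh_obj F K\<^esub> \<ominus>\<^bsub>psh_obj F K\<^esub> w' =
     (w0 \<oplus>\<^bsub>psh_obj F K\<^esub> \<ominus>\<^bsub>psh_obj F K\<^esub> w0') \<oplus>\<^bsub>psh_obj F K\<^esub> act m x"
    unfolding am k(5) k'(4) using c by (simp add: G.minus_add G.a_ac)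
  then show ?case using vanish_add[OF add.IH[OF k(4) k'(3)] v] by simp
qed

lemma eval_refine:
  assumes "ext C K' \<xi>'" "arr K' K l" "push \<C> C l \<xi>' = \<xi>" "eval C K \<xi> P w"
  shows "eval C K' \<xi>' P (act l w)"
  using assms(4)
proof (induction rule: eval.induct)
  case eval_empty show ?case using act_zero[OF assms(2)] eval.eval_empty[of C K' \<xi>'] by simp
next
  case (eval_add P w Z k x e)
  have "push \<C> C (k \<cdot> l) \<xi>' = e" using push_comp[OF assms(1,2) eval_add(2)] assms(3) eval_add by simp
  from eval.eval_add[OF eval_add.IH arr_comp[OF assms(2) eval_add(2)] eval_add(3) this]
  show ?case
    using mor_add[OF assms(2) eval_closed[OF eval_add(1) arr_obj(2)[OF assms(2)]] mor_closed[OF eval_add(2,3)]]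
      mor_comp[OF assms(2) eval_add(2,3)] by simp
qed

lemma vanish_refine:
  assumes "ext C K' \<xi>'" "arr K' K l" "push \<C> C l \<xi>' = \<xi>" "vanish C K \<xi> v"
  shows "vanish C K' \<xi>' (act l v)"
proof -
  from assms(4) obtain i B p y where r: "rlz K i B p C \<xi>" "y \<in> el B" "v = act i y"
    unfolding vanish_def by blast
  obtain i' B' p' where r': "rlz K' i' B' p' C \<xi>'" using realization[OF assms(1)] by blast
  have "push \<C> C l \<xi>' = pull \<C> (Ide \<C> C) K \<xi>" using assms(3) pull_id[OF realizesD(1)[OF r(1)]] by simp
  from morphism_middle[OF r' r(1) assms(2) arr_id[OF realizesD(7)[OF r']] this]
  obtain b where b: "arr B' B b" "b \<cdot> i' = i \<cdot> l" by blast
  have "act l v = act i' (act b y)"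
    using mor_comp[OF assms(2) realizesD(2)[OF r(1)] r(2)] mor_comp[OF realizesD(2)[OF r'] b(1) r(2)] b(2) r(3) by simp
  then show ?thesis unfolding vanish_def using r' mor_closed[OF b(1) r(2)] by blast
qed

text \<open>
  The sum of two extensions pushes forward to both of them along the projections.
\<close>

lemma extension_directed:
  assumes "ext C K1 \<xi>1" "ext C K2 \<xi>2"
  obtains K \<xi> l1 l2 where "ext C K \<xi>" "arr K K1 l1" "arr K K2 l2" "push \<C> C l1 \<xi> = \<xi>1" "push \<C> C l2 \<xi> = \<xi>2"
proof -
  obtain K i j p q where bp: "is_biproduct \<C> K1 K2 K i j p q"
    using ex_biproduct[OF ext_obj(1)[OF assms(1)] ext_obj(1)[OF assms(2)]] by blast
  note P = biproduct_arr[OF bp]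
  define \<xi> where "\<xi> = push \<C> C i \<xi>1 \<oplus>\<^bsub>Ext \<C> C K\<^esub> push \<C> C j \<xi>2"
  have e: "ext C K (push \<C> C i \<xi>1)" "ext C K (push \<C> C j \<xi>2)"
    using ext_push[OF assms(1) P(1)] ext_push[OF assms(2) P(2)] .
  have "push \<C> C p \<xi> = \<xi>1"
    unfolding \<xi>_def using push_additive[OF e P(3)] push_comp[OF assms(1) P(1,3)] push_comp[OF assms(2) P(2,3)]
      P(5,8) push_id[OF assms(1)] zero_push[OF assms(2) ext_obj(1)[OF assms(1)]] ext_add_zero[OF assms(1)] by simp
  moreover have "push \<C> C q \<xi> = \<xi>2"
    unfolding \<xi>_def using push_additive[OF e P(4)] push_comp[OF assms(1) P(1,4)] push_comp[OF assms(2) P(2,4)]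
      P(6,7) push_id[OF assms(2)] zero_push[OF assms(1) ext_obj(1)[OF assms(2)]] ext_zero_add[OF assms(2)] by simp
  moreover have "ext C K \<xi>" unfolding \<xi>_def by (rule ext_add[OF e])
  ultimately show thesis using that P by blast
qed

lemma eval_exists:
  assumes "C \<in> Obj \<C>" "typed C P"
  shows "\<exists>K \<xi> w. ext C K \<xi> \<and> eval C K \<xi> P w"
  using assms(2)
proof (induction P)
  case empty show ?case using ext_zero[OF assms(1,1)] eval_empty by blast
next
  case (add t P)
  obtain Z x e where t: "t = (Z, x, e)" by (cases t)
  from add obtain K \<xi> w where 1: "ext C K \<xi>" "eval C K \<xi> P w" by auto
  have 2: "ext C Z e" "x \<in> el Z" using add.prems assms(1) by (auto simp: t pure_iff extension_def)
  obtain K' \<xi>' l k where "ext C K' \<xi>'" "arr K' K l" "arr K' Z k" "push \<C> C l \<xi>' = \<xi>" "push \<C> C k \<xi>' = e"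
    using extension_directed[OF 1(1) 2(1)] by metis
  then show ?case unfolding t using eval_add[OF eval_refine[OF _ _ _ 1(2)]] 2(2) by blast
qed

text \<open>
  Equality in the colimit over all \<open>\<xi> \<in> \<bbbE>(C,K)\<close> of the cokernels of \<open>F(B) \<rightarrow> F(K)\<close>.
\<close>

definition agree where
  "agree C P Q \<longleftrightarrow> (\<exists>K \<xi> w w'. ext C K \<xi> \<and> eval C K \<xi> P w \<and> eval C K \<xi> Q w' \<and>
     vanish C K \<xi> (w \<oplus>\<^bsub>psh_obj F K\<^esub> \<ominus>\<^bsub>psh_obj F K\<^esub> w'))"

lemma agree_same:
  assumes "ext C K \<xi>" "eval C K \<xi> P w" "eval C K \<xi> Q w"
  shows "agree C P Q"
proof -
  interpret G: abelian_group "psh_obj F K" using obj_group ext_obj(1)[OF assms(1)] by blast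
  show ?thesis
    unfolding agree_def using assms vanish_zero[OF assms(1)] eval_closed[OF assms(2) ext_obj(1)[OF assms(1)]] G.r_neg by metis
qed

lemma agree_sym:
  assumes "agree C P Q"
  shows "agree C Q P"
proof -
  from assms obtain K \<xi> w w' where 1: "ext C K \<xi>" "eval C K \<xi> P w" "eval C K \<xi> Q w'"
     "vanish C K \<xi> (w \<oplus>\<^bsub>psh_obj F K\<^esub> \<ominus>\<^bsub>psh_obj F K\<^esub> w')" unfolding agree_def by blast
  note K = ext_obj(1)[OF 1(1)]
  interpret G: abelian_group "psh_obj F K" using obj_group K by blast
  have "\<ominus>\<^bsub>psh_obj F K\<^esub> (w \<oplus>\<^bsub>psh_obj F K\<^esub> \<ominus>\<^bsub>psh_obj F K\<^esub> w') = w' \<oplus>\<^bsub>psh_obj F K\<^esub> \<ominus>\<^bsub>psh_obj F K\<^esub> w"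
    using eval_closed[OF 1(2) K] eval_closed[OF 1(3) K] by (simp add: G.minus_add G.a_ac)
  then show ?thesis unfolding agree_def using 1 vanish_neg[OF 1(4)] by metis
qed

lemma agree_refine:
  assumes "agree C P Q" "ext C K2 \<xi>2"
  obtains K \<xi> l w w' where "ext C K \<xi>" "arr K K2 l" "push \<C> C l \<xi> = \<xi>2"
    "eval C K \<xi> P w" "eval C K \<xi> Q w'" "vanish C K \<xi> (w \<oplus>\<^bsub>psh_obj F K\<^esub> \<ominus>\<^bsub>psh_obj F K\<^esub> w')"
proof -
  from assms(1) obtain K1 \<xi>1 w w' where 1: "ext C K1 \<xi>1" "eval C K1 \<xi>1 P w" "eval C K1 \<xi>1 Q w'"
     "vanish C K1 \<xi>1 (w \<oplus>\<^bsub>psh_obj F K1\<^esub> \<ominus>\<^bsub>psh_obj F K1\<^esub> w')" unfolding agree_def by blast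
  obtain K \<xi> l1 l2 where l: "ext C K \<xi>" "arr K K1 l1" "arr K K2 l2" "push \<C> C l1 \<xi> = \<xi>1" "push \<C> C l2 \<xi> = \<xi>2"
    using extension_directed[OF 1(1) assms(2)] by metis
  note K1 = ext_obj(1)[OF 1(1)]
  note c = eval_closed[OF 1(2) K1] eval_closed[OF 1(3) K1]
  have "vanish C K \<xi> (act l1 w \<oplus>\<^bsub>psh_obj F K\<^esub> \<ominus>\<^bsub>psh_obj F K\<^esub> act l1 w')"
    using vanish_refine[OF l(1,2,4) 1(4)] mor_add[OF l(2) c(1) neg_el[OF K1 c(2)]] act_neg[OF l(2) c(2)] by simp
  then show thesis
    using that[OF l(1,3,5) eval_refine[OF l(1,2,4) 1(2)] eval_refine[OF l(1,2,4) 1(3)]] by blast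
qed

lemma agree_trans:
  assumes "agree C P Q" "agree C Q S"
  shows "agree C P S"
proof -
  from assms(1) obtain K1 \<xi>1 w1 w1' where 1: "ext C K1 \<xi>1" "eval C K1 \<xi>1 P w1" "eval C K1 \<xi>1 Q w1'"
     "vanish C K1 \<xi>1 (w1 \<oplus>\<^bsub>psh_obj F K1\<^esub> \<ominus>\<^bsub>psh_obj F K1\<^esub> w1')" unfolding agree_def by blast
  obtain K \<xi> l y z where l: "ext C K \<xi>" "arr K K1 l" "push \<C> C l \<xi> = \<xi>1" and
    e: "eval C K \<xi> Q y" "eval C K \<xi> S z" and v: "vanish C K \<xi> (y \<oplus>\<^bsub>psh_obj F K\<^esub> \<ominus>\<^bsub>psh_obj F K\<^esub> z)"
    using agree_refine[OF assms(2) 1(1)] by metis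
  note K = ext_obj(1)[OF l(1)] and K1 = ext_obj(1)[OF 1(1)]
  interpret G: abelian_group "psh_obj F K" using obj_group K by blast
  let ?d = "\<lambda>x y. x \<oplus>\<^bsub>psh_obj F K\<^esub> \<ominus>\<^bsub>psh_obj F K\<^esub> y"
  note e1 = eval_refine[OF l 1(2)] eval_refine[OF l 1(3)] and c1 = eval_closed[OF 1(2) K1] eval_closed[OF 1(3) K1]
  have v1: "vanish C K \<xi> (?d (act l w1) (act l w1'))"
    using vanish_refine[OF l 1(4)] mor_add[OF l(2) c1(1) neg_el[OF K1 c1(2)]] act_neg[OF l(2) c1(2)] by simp
  have tel: "?d x y \<oplus>\<^bsub>psh_obj F K\<^esub> ?d y z = ?d x z" if "x \<in> el K" "y \<in> el K" "z \<in> el K" for x y z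
    using that by (simp add: G.a_assoc G.r_neg1)
  note c = eval_closed[OF e1(1) K] eval_closed[OF e1(2) K] eval_closed[OF e(1) K] eval_closed[OF e(2) K]
  have "vanish C K \<xi> (?d (act l w1) z)"
    using vanish_add[OF vanish_add[OF v1 eval_unique[OF l(1) e1(2) e(1)]] v] tel[OF c(1-3)] tel[OF c(1,3,4)] by simp
  then show ?thesis unfolding agree_def using l(1) e e1 by blast
qed

lemma agree_plus:
  assumes "agree C P Q" "typed C S" "C \<in> Obj \<C>"
  shows "agree C (P + S) (Q + S)"
proof -
  obtain K2 \<xi>2 s where 2: "ext C K2 \<xi>2" "eval C K2 \<xi>2 S s" using eval_exists[OF assms(3,2)] by blast
  obtain K \<xi> l w w' where l: "ext C K \<xi>" "arr K K2 l" "push \<C> C l \<xi> = \<xi>2" and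
    e: "eval C K \<xi> P w" "eval C K \<xi> Q w'" and v: "vanish C K \<xi> (w \<oplus>\<^bsub>psh_obj F K\<^esub> \<ominus>\<^bsub>psh_obj F K\<^esub> w')"
    using agree_refine[OF assms(1) 2(1)] by metis
  note K = ext_obj(1)[OF l(1)] and e2 = eval_refine[OF l 2(2)]
  interpret G: abelian_group "psh_obj F K" using obj_group K by blast
  note c = eval_closed[OF e(1) K] eval_closed[OF e(2) K] eval_closed[OF e2 K]
  have "(w \<oplus>\<^bsub>psh_obj F K\<^esub> act l s) \<oplus>\<^bsub>psh_obj F K\<^esub> \<ominus>\<^bsub>psh_obj F K\<^esub> (w' \<oplus>\<^bsub>psh_obj F K\<^esub> act l s)
     = w \<oplus>\<^bsub>psh_obj F K\<^esub> \<ominus>\<^bsub>psh_obj F K\<^esub> w'"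
    using c by (simp add: G.minus_add G.a_ac G.r_neg1 G.r_neg2 G.r_neg G.l_neg)
  then show ?thesis
    unfolding agree_def using l(1) eval_union[OF e(1) e2 K] eval_union[OF e(2) e2 K] v by metis
qed

text \<open>
  The map from the coend to the colimit is well defined: each defining relation of the coend holds after
  evaluation at a suitable extension.
\<close>

lemma ceq_agree:
  assumes "ceq C P Q" "C \<in> Obj \<C>" "typed C P"
  shows "agree C P Q"
  using assms
proof induction
  case (refl P)
  then show ?case using eval_exists agree_same by metis
next
  case (sym P Q) then show ?case using ceq_typed agree_sym by blast
next
  case (trans P Q S) then show ?case using ceq_typed agree_trans by blast
next
  case (plus P Q S) then show ?case using agree_plus by auto
next
  case (add_left X x x' e)
  then have e: "ext C X e" by (simp add: extension_def)
  from eval_union[OF eval_single_id[OF e add_left(2)] eval_single_id[OF e add_left(3)] add_left(1)]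
    eval_single_id[OF e add_el[OF add_left(1-3)]]
  show ?case using agree_same[OF e] by (simp add: add_mset_commute)
next
  case (add_right X x e e')
  then have e: "ext C X e" "ext C X e'" by (simp_all add: extension_def)
  obtain K \<xi> l1 l2 where l: "ext C K \<xi>" "arr K X l1" "arr K X l2" "push \<C> C l1 \<xi> = e" "push \<C> C l2 \<xi> = e'"
    using extension_directed[OF e] by metis
  have "eval C K \<xi> {#(X, x, e \<oplus>\<^bsub>Ext \<C> C X\<^esub> e')#} (act (l1 \<oplus>\<^bsub>Hom \<C> K X\<^esub> l2) x)"
    by (rule eval_single[OF arr_add[OF l(2,3)] add_right(2)]) (use additive_push[OF l(1-3)] l(4,5) in simp)
  moreover have "eval C K \<xi> ({#(X, x, e)#} + {#(X, x, e')#}) (act l1 x \<oplus>\<^bsub>psh_obj F K\<^esub> act l2 x)"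
    by (rule eval_union[OF eval_single[OF l(2) add_right(2) l(4)] eval_single[OF l(3) add_right(2) l(5)] ext_obj(1)[OF l(1)]])
  ultimately show ?case using agree_same[OF l(1)] add_mor[OF l(2,3) add_right(2)] by (simp add: add_mset_commute)
next
  case (zero X e)
  then have e: "ext C X e" by (simp add: extension_def)
  show ?case using agree_same[OF e eval_single_id[OF e zero_el[OF zero(1)]] eval_empty] .
next
  case (balanced X r x e)
  then have e: "ext C X e" by (simp add: extension_def)
  have "push \<C> C (r \<odot>\<^bsub>Hom \<C> X X\<^esub> Ide \<C> X) e = r \<odot>\<^bsub>Ext \<C> C X\<^esub> e"
    using smult_push[of C X X r "Ide \<C> X" e] push_id[OF e] e balanced(2) Ide_closed by (simp add: extension_def)
  from eval_single[OF arr_smult[OF balanced(2) arr_id[OF balanced(1)]] balanced(3) this]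
  show ?case
    using agree_same[OF e eval_single_id[OF e scalar_closed[OF balanced(2,1,3)]]] scalar_via_mor[OF balanced(2,1,3)] by simp
next
  case (dinatural X X' f x e)
  then have e: "ext C X e" and f: "arr X X' f" by (simp_all add: extension_def arrow_def)
  show ?case
    using agree_same[OF e eval_single_id[OF e mor_closed[OF f dinatural(4)]] eval_single[OF f dinatural(4) HOL.refl]] .
qed

text \<open>
  Injectivity of the transition maps. Pull back the two realizations along each other to get \<open>M\<close>. The pulled back extension of
  \<open>B'\<close> by \<open>K\<close> is zero because \<open>\<xi>\<close> is a pushforward of \<open>\<xi>'\<close>, so \<open>M\<close> is a sum of
  \<open>K\<close> and \<open>B'\<close>. From \<open>x\<close> and an extension of \<open>k\<^sup>*x\<close> to \<open>B'\<close> one forms an element of \<open>F(M)\<close> that restricts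
  to zero on \<open>K'\<close>, and half exactness along \<open>K' \<rightarrow> M \<rightarrow> B\<close> provides the extension of \<open>x\<close> to \<open>B\<close>.
\<close>

lemma vanish_reflect:
  assumes \<xi>': "ext C K' \<xi>'" and k: "arr K' K k" "push \<C> C k \<xi>' = \<xi>" and x: "x \<in> el K"
    and v: "vanish C K' \<xi>' (act k x)"
  shows "vanish C K \<xi> x"
proof -
  have \<xi>: "ext C K \<xi>" using ext_push[OF \<xi>' k(1)] k(2) by simp
  obtain i B p where r: "rlz K i B p C \<xi>" using realization[OF \<xi>] by blast
  obtain i' B' p' where r': "rlz K' i' B' p' C \<xi>'" using realization[OF \<xi>'] by blast
  obtain y' where y': "y' \<in> el B'" "act i' y' = act k x" using vanishD[OF v r'] by blast
  obtain M n m q \<pi> where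
    1: "rlz K n M \<pi> B' (pull \<C> p' K \<xi>)" and 2: "rlz K' m M q B (pull \<C> p K' \<xi>')"
    and qn: "q \<cdot> n = i" and \<pi>m: "\<pi> \<cdot> m = i'"
    and sum: "push \<C> C n \<xi> \<oplus>\<^bsub>Ext \<C> C M\<^esub> push \<C> C m \<xi>' = ze C M"
    using pullback[OF r r'] by metis
  note D = realizesD[OF r] and D' = realizesD[OF r'] and D1 = realizesD[OF 1] and D2 = realizesD[OF 2]
  have "pull \<C> p' K \<xi> = push \<C> B' k (pull \<C> p' K' \<xi>')"
    using push_pull_commute[OF \<xi>' k(1) D'(3)] k(2) by simp
  also have "\<dots> = ze B' K" using pull_deflation[OF r'] push_ze[OF D'(6) k(1)] by simp
  finally have z: "pull \<C> p' K \<xi> = ze B' K" .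
  have "push \<C> B' (Ide \<C> K) (pull \<C> p' K \<xi>) = ze B' K" using z push_id[OF ext_zero[OF D'(6) D(5)]] by simp
  from inflation_extend[OF 1 arr_id[OF D(5)] this] obtain \<rho> where \<rho>: "arr M K \<rho>" "\<rho> \<cdot> n = Ide \<C> K" by blast
  interpret E: abelian_group "Ext \<C> C K" using ext_group D by blast
  interpret H: abelian_group "Hom \<C> K' K" using hom_group D'(5) D(5) by blast
  interpret G: abelian_group "psh_obj F K'" using obj_group D'(5) by blast
  interpret GK: abelian_group "psh_obj F K" using obj_group D(5) by blast
  have \<rho>m: "arr K' K (\<rho> \<cdot> m)" using arr_comp[OF D2(2) \<rho>(1)] .
  have "ze C K = push \<C> C \<rho> (push \<C> C n \<xi> \<oplus>\<^bsub>Ext \<C> C M\<^esub> push \<C> C m \<xi>')"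
    using sum push_ze[OF D(7) \<rho>(1)] by simp
  also have "\<dots> = \<xi> \<oplus>\<^bsub>Ext \<C> C K\<^esub> push \<C> C (\<rho> \<cdot> m) \<xi>'"
    using push_additive[OF ext_push[OF \<xi> D1(2)] ext_push[OF \<xi>' D2(2)] \<rho>(1)] push_comp[OF \<xi> D1(2) \<rho>(1)] \<rho>(2)
      push_id[OF \<xi>] push_comp[OF \<xi>' D2(2) \<rho>(1)] by simp
  also have "\<dots> = push \<C> C (k \<oplus>\<^bsub>Hom \<C> K' K\<^esub> \<rho> \<cdot> m) \<xi>'"
    using additive_push[OF \<xi>' k(1) \<rho>m] k(2) by simp
  finally have "push \<C> C (k \<oplus>\<^bsub>Hom \<C> K' K\<^esub> \<rho> \<cdot> m) \<xi>' = ze C K" by simp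
  \<comment> \<open>The relation between the two inflations of the pullback makes \<open>\<rho> m\<close> equal to \<open>-k\<close> up to a map \<open>u\<close> on \<open>B'\<close>.\<close>
  from inflation_extend[OF r' arr_add[OF k(1) \<rho>m] this]
  obtain u where u: "arr B' K u" "u \<cdot> i' = k \<oplus>\<^bsub>Hom \<C> K' K\<^esub> \<rho> \<cdot> m" by blast
  \<comment> \<open>The correction by \<open>u\<^sup>*x\<close> makes the restriction of \<open>?z\<close> to \<open>K'\<close> exactly zero.\<close>
  let ?t = "y' \<oplus>\<^bsub>psh_obj F B'\<^esub> \<ominus>\<^bsub>psh_obj F B'\<^esub> act u x"
  have ux: "act u x \<in> el B'" using mor_closed[OF u(1) x] .
  have t: "?t \<in> el B'" by (intro add_el[OF D'(6) y'(1) neg_el[OF D'(6) ux]])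
  let ?z = "act \<rho> x \<oplus>\<^bsub>psh_obj F M\<^esub> act \<pi> ?t"
  have z0: "act \<rho> x \<in> el M" "act \<pi> ?t \<in> el M" using mor_closed[OF \<rho>(1) x] mor_closed[OF D1(3) t] .
  have z1: "?z \<in> el M" by (rule add_el[OF D1(6) z0])
  have c: "act k x \<in> el K'" "act (\<rho> \<cdot> m) x \<in> el K'" using mor_closed k(1) \<rho>m x by blast+
  have "act m (act \<pi> ?t) = act i' ?t" using mor_comp[OF D2(2) D1(3) t] \<pi>m by simp
  also have "\<dots> = act k x \<oplus>\<^bsub>psh_obj F K'\<^esub> \<ominus>\<^bsub>psh_obj F K'\<^esub> (act k x \<oplus>\<^bsub>psh_obj F K'\<^esub> act (\<rho> \<cdot> m) x)"
    using mor_add[OF D'(2) y'(1) neg_el[OF D'(6) ux]] act_neg[OF D'(2) ux] y'(2) mor_comp[OF D'(2) u(1) x] u(2)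
      add_mor[OF k(1) \<rho>m x] by simp
  also have "\<dots> = \<ominus>\<^bsub>psh_obj F K'\<^esub> act (\<rho> \<cdot> m) x"
    using c by (simp add: G.minus_add G.r_neg2 G.r_neg1)
  finally have "act m ?z = zF K'"
    using mor_add[OF D2(2) z0] mor_comp[OF D2(2) \<rho>(1) x] c by (simp add: G.r_neg)
  from half_exact[OF 2 z1 this] obtain y where y: "y \<in> el B" "act q y = ?z" by blast
  have "act i y = act n ?z" using mor_comp[OF D1(2) D2(3) y(1)] qn y(2) by simp
  also have "\<dots> = act (\<rho> \<cdot> n) x \<oplus>\<^bsub>psh_obj F K\<^esub> act (\<pi> \<cdot> n) ?t"
    using mor_add[OF D1(2) z0] mor_comp[OF D1(2) \<rho>(1) x] mor_comp[OF D1(2,3) t] by simp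
  also have "\<dots> = x" using \<rho>(2) D1(4) mor_id[OF D(5) x] zero_act[OF D(5) D'(6) t] x by simp
  finally show ?thesis unfolding vanish_def using r y(1) by metis
qed

text \<open>
  A zero tensor is zero in the colimit, so it vanishes over some extension that maps to \<open>\<xi>\<close>; by
  \<open>vanish_reflect\<close> it already vanishes over \<open>\<xi>\<close>.
\<close>

theorem tensor_zero:
  assumes r: "rlz K i B p C \<xi>" and x: "x \<in> el K" and z: "ceq C {#(K, x, \<xi>)#} {#}"
  obtains y where "y \<in> el B" "act i y = x"
proof -
  note D = realizesD[OF r]
  have "typed C {#(K, x, \<xi>)#}" using x D by (simp add: pure_iff extension_def)
  from ceq_agree[OF z D(7) this] obtain K' \<xi>' w w' where 1: "ext C K' \<xi>'" "eval C K' \<xi>' {#(K, x, \<xi>)#} w"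
     "eval C K' \<xi>' {#} w'" "vanish C K' \<xi>' (w \<oplus>\<^bsub>psh_obj F K'\<^esub> \<ominus>\<^bsub>psh_obj F K'\<^esub> w')" unfolding agree_def by blast
  note K' = ext_obj(1)[OF 1(1)]
  interpret G: abelian_group "psh_obj F K'" using obj_group K' by blast
  from eval_addD[OF 1(2) K' HOL.refl] obtain k w0 where
    k: "arr K' K k" "push \<C> C k \<xi>' = \<xi>" "eval C K' \<xi>' {#} w0" "w = w0 \<oplus>\<^bsub>psh_obj F K'\<^esub> act k x" by blast
  have "w = act k x" using k eval_emptyD[OF k(3)] mor_closed[OF k(1) x] by simp
  then have "vanish C K' \<xi>' (act k x)"
    using 1(4) eval_emptyD[OF 1(3)] mor_closed[OF k(1) x] G.add.inv_one[folded a_inv_def] by simp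
  from vanishD[OF vanish_reflect[OF 1(1) k(1,2) x this] r] that show thesis by blast
qed

end

section \<open>Higher extensions as exact presheaves\<close>

context extriangulated_category
begin

definition effaceable where
  "effaceable F \<longleftrightarrow> (\<forall>W\<in>Obj \<C>. \<forall>w\<in>carrier (psh_obj F W). \<exists>Z j V q \<eta>.
     rlz Z j V q W \<eta> \<and> psh_mor F q w = \<zero>\<^bsub>psh_obj F V\<^esub>)"

end

context exact_presheaf
begin

lemma ceq_sym: "ceq C P Q \<Longrightarrow> ceq C Q P"
  by (rule coend_eq.sym)
lemma ceq_trans: "\<lbrakk>ceq C P Q; ceq C Q S\<rbrakk> \<Longrightarrow> ceq C P S"
  by (rule coend_eq.trans)
lemma ceq_refl: "ceq C P P"
  by (rule coend_eq.refl)

lemma cl_eq: "cl C P = cl C Q \<longleftrightarrow> ceq C P Q"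
proof
  assume "cl C P = cl C Q"
  then have "Eps (ceq C P) = Eps (ceq C Q)" by (simp add: coend_class_def)
  then have "ceq C Q (Eps (ceq C P))" using someI[of "ceq C Q" Q, OF ceq_refl] by simp
  from ceq_trans[OF someI[of "ceq C P" P, OF ceq_refl] ceq_sym[OF this]]
  show "ceq C P Q" .
next
  assume "ceq C P Q"
  then have "ceq C P = ceq C Q"
    using ceq_sym ceq_trans
    by (intro HOL.ext iffI) blast+
  then show "cl C P = cl C Q" by (simp add: coend_class_def)
qed

lemma tensors_cl: "ceq C P (tensors (cl C P))"
  unfolding coend_class_def using someI[of "ceq C P" P, OF ceq_refl] by simp

lemma carrier_coend: "carrier (coend_module R \<C> F C) = {cl C P |P. typed C P}"
  by (auto simp: coend_module_def)

lemma cl_closed: "typed C P \<Longrightarrow> cl C P \<in> carrier (coend_module R \<C> F C)"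
  unfolding carrier_coend by blast

lemma zero_coend: "\<zero>\<^bsub>coend_module R \<C> F C\<^esub> = cl C {#}"
  by (simp add: coend_module_def)

lemma add_coend: "cl C P \<oplus>\<^bsub>coend_module R \<C> F C\<^esub> cl C Q = cl C (P + Q)"
proof -
  have "cl C P \<oplus>\<^bsub>coend_module R \<C> F C\<^esub> cl C Q = cl C (tensors (cl C P) + tensors (cl C Q))"
    by (simp add: coend_module_def)
  also have "\<dots> = cl C (P + Q)"
    unfolding cl_eq by (intro ceq_add ceq_sym[OF tensors_cl])
  finally show ?thesis .
qed

lemma typed_tensors: "\<lbrakk>typed C P; C \<in> Obj \<C>\<rbrakk> \<Longrightarrow> typed C (tensors (cl C P))"
  using ceq_typed[OF tensors_cl] by blast

lemma tensor_neg:
  assumes "C \<in> Obj \<C>" "X \<in> Obj \<C>" "x \<in> el X" "e \<in> exts \<C> C X"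
  shows "ceq C {#(X, \<ominus>\<^bsub>psh_obj F X\<^esub> x, e), (X, x, e)#} {#}"
proof -
  interpret G: abelian_group "psh_obj F X" using obj_group assms by blast
  have "ceq C {#(X, \<ominus>\<^bsub>psh_obj F X\<^esub> x \<oplus>\<^bsub>psh_obj F X\<^esub> x, e)#} {#(X, \<ominus>\<^bsub>psh_obj F X\<^esub> x, e), (X, x, e)#}"
    by (rule coend_eq.add_left) (use assms in auto)
  moreover have "ceq C {#(X, \<ominus>\<^bsub>psh_obj F X\<^esub> x \<oplus>\<^bsub>psh_obj F X\<^esub> x, e)#} {#}"
    using coend_eq.zero[of X \<C> e C R F] assms by (simp add: G.l_neg)
  ultimately show ?thesis using ceq_sym ceq_trans by blast
qed

lemma coend_inverse:
  assumes "C \<in> Obj \<C>" "typed C P"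
  shows "\<exists>Q. typed C Q \<and> ceq C (Q + P) {#}"
  using assms(2)
proof (induction P)
  case empty show ?case using ceq_refl[of C "{#}"] by (intro exI[of _ "{#}"]) simp
next
  case (add t P)
  then obtain Q where Q: "typed C Q" "ceq C (Q + P) {#}" by auto
  obtain X x e where t: "t = (X, x, e)" by (cases t)
  with add.prems have X: "X \<in> Obj \<C>" "x \<in> el X" "e \<in> exts \<C> C X" by (auto simp: pure_iff)
  have "ceq C ({#(X, \<ominus>\<^bsub>psh_obj F X\<^esub> x, e), (X, x, e)#} + (Q + P)) ({#} + {#})"
    by (intro ceq_add tensor_neg assms(1) X Q(2))
  then have "ceq C (add_mset (X, \<ominus>\<^bsub>psh_obj F X\<^esub> x, e) Q + add_mset t P) {#}"
    by (simp add: t add_mset_commute)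
  moreover have "typed C (add_mset (X, \<ominus>\<^bsub>psh_obj F X\<^esub> x, e) Q)"
    using Q X neg_el by (simp add: pure_iff)
  ultimately show ?case by blast
qed

lemma coend_group:
  assumes C: "C \<in> Obj \<C>"
  shows "abelian_group (coend_module R \<C> F C)"
proof (rule abelian_groupI)
  show "\<exists>y\<in>carrier (coend_module R \<C> F C). y \<oplus>\<^bsub>coend_module R \<C> F C\<^esub> x = \<zero>\<^bsub>coend_module R \<C> F C\<^esub>"
    if x: "x \<in> carrier (coend_module R \<C> F C)" for x
  proof -
    obtain P where P: "typed C P" "x = cl C P" using x by (auto simp: carrier_coend)
    then obtain Q where "typed C Q" "ceq C (Q + P) {#}" using coend_inverse[OF C] by blast
    then show ?thesis
      using P by (intro bexI[of _ "cl C Q"]) (simp_all add: add_coend zero_coend cl_eq cl_closed)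
  qed
next
  fix x y assume "x \<in> carrier (coend_module R \<C> F C)" "y \<in> carrier (coend_module R \<C> F C)"
  then obtain P Q where "typed C P" "x = cl C P" "typed C Q" "y = cl C Q" by (auto simp: carrier_coend)
  then show "x \<oplus>\<^bsub>coend_module R \<C> F C\<^esub> y \<in> carrier (coend_module R \<C> F C)"
    by (simp add: add_coend cl_closed)
next
  show "\<zero>\<^bsub>coend_module R \<C> F C\<^esub> \<in> carrier (coend_module R \<C> F C)"
    by (simp add: zero_coend cl_closed)
qed (auto simp: carrier_coend add_coend zero_coend ac_simps)

lemma tensor_zero_right:
  assumes "C \<in> Obj \<C>" "X \<in> Obj \<C>" "x \<in> el X"
  shows "ceq C {#(X, x, ze C X)#} {#}"
proof -
  have z: "ze C X \<in> exts \<C> C X" using ext_zero[OF assms(1,2)] by (simp add: extension_def)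
  have "ceq C {#(X, act (zm X X) x, ze C X)#} {#(X, x, push \<C> C (zm X X) (ze C X))#}"
    by (rule coend_eq.dinatural) (use assms arr_zero[OF assms(2,2)] z in \<open>auto simp: arrow_def\<close>)
  then have "ceq C {#(X, zF X, ze C X)#} {#(X, x, ze C X)#}"
    using zero_act[OF assms(2,2,3)] push_ze[OF assms(1) arr_zero[OF assms(2,2)]] by simp
  then show ?thesis using coend_eq.zero[of X \<C> "ze C X" C R F] assms z ceq_sym ceq_trans by metis
qed

text \<open>
  With \<open>y = p\<^sup>*x + q\<^sup>*x'\<close> on the biproduct, the tensor of \<open>y\<close> with the sum of both extensions is the sum of the two
  tensors. Hence all elements of the coend are pure tensors.
\<close>

lemma tensor_merge:
  assumes C: "C \<in> Obj \<C>" and "(X, x, e) \<in> pure_tensors \<C> F C" "(X', x', e') \<in> pure_tensors \<C> F C"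
  shows "\<exists>t\<in>pure_tensors \<C> F C. ceq C {#(X, x, e), (X', x', e')#} {#t#}"
proof -
  have X: "X \<in> Obj \<C>" "x \<in> el X" "ext C X e" and X': "X' \<in> Obj \<C>" "x' \<in> el X'" "ext C X' e'"
    using assms by (auto simp: pure_iff extension_def)
  obtain S i j p q where bp: "is_biproduct \<C> X X' S i j p q" using ex_biproduct[OF X(1) X'(1)] by blast
  note P = biproduct_arr[OF bp]
  define y where "y = act p x \<oplus>\<^bsub>psh_obj F S\<^esub> act q x'"
  note S = arr_obj(2)[OF P(1)]
  have y: "act p x \<in> el S" "act q x' \<in> el S" "y \<in> el S"
    unfolding y_def using mor_closed[OF P(3) X(2)] mor_closed[OF P(4) X'(2)] add_el[OF S] by auto
  have e: "ext C S (push \<C> C i e)" "ext C S (push \<C> C j e')"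
    using ext_push X X' P by blast+
  interpret G: abelian_group "psh_obj F X" using obj_group X by blast
  interpret G': abelian_group "psh_obj F X'" using obj_group X' by blast
  have "act i (act p x) = x" "act i (act q x') = zF X" "act j (act p x) = zF X'" "act j (act q x') = x'"
    using mor_comp[OF P(1,3) X(2)] mor_comp[OF P(1,4) X'(2)] mor_comp[OF P(2,3) X(2)] mor_comp[OF P(2,4) X'(2)]
      P(5-8) mor_id[OF X(1,2)] mor_id[OF X'(1,2)] zero_act[OF X(1) X'(1,2)] zero_act[OF X'(1) X(1,2)] by simp_all
  then have iy: "act i y = x" and jy: "act j y = x'"
    unfolding y_def using mor_add[OF P(1) y(1,2)] mor_add[OF P(2) y(1,2)] X(2) X'(2) by simp_all
  have "ceq C {#(X, act i y, e)#} {#(S, y, push \<C> C i e)#}" "ceq C {#(X', act j y, e')#} {#(S, y, push \<C> C j e')#}"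
    using P X X' y S by (auto intro!: coend_eq.dinatural simp: arrow_def extension_def)
  from ceq_add[OF this] have "ceq C {#(X, x, e), (X', x', e')#} {#(S, y, push \<C> C i e), (S, y, push \<C> C j e')#}"
    by (simp add: iy jy add_mset_commute)
  moreover have "ceq C {#(S, y, push \<C> C i e), (S, y, push \<C> C j e')#} {#(S, y, push \<C> C i e \<oplus>\<^bsub>Ext \<C> C S\<^esub> push \<C> C j e')#}"
    by (rule ceq_sym, rule coend_eq.add_right) (use S y e in \<open>auto simp: extension_def\<close>)
  moreover have "(S, y, push \<C> C i e \<oplus>\<^bsub>Ext \<C> C S\<^esub> push \<C> C j e') \<in> pure_tensors \<C> F C"
    using S y ext_add[OF e] by (simp add: pure_iff extension_def)
  ultimately show ?thesis using ceq_trans by blast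
qed

lemma typed_pure:
  assumes C: "C \<in> Obj \<C>" and P: "typed C P"
  shows "\<exists>t\<in>pure_tensors \<C> F C. ceq C P {#t#}"
  using P
proof (induction P)
  case empty
  obtain Z where Z: "zero_object \<C> Z" using ex_zero_object by blast
  note z = zero_obj[OF Z]
  have "(Z, zF Z, ze C Z) \<in> pure_tensors \<C> F C"
    using z zero_el ext_zero[OF C z] by (simp add: pure_iff extension_def)
  then show ?case using ceq_sym[OF tensor_zero_right[OF C z zero_el[OF z]]] by blast
next
  case (add t P)
  then obtain s where s: "s \<in> pure_tensors \<C> F C" "ceq C P {#s#}" by auto
  obtain X x e X' x' e' where ts: "t = (X, x, e)" "s = (X', x', e')" by (cases t, cases s)
  then obtain u where "u \<in> pure_tensors \<C> F C" "ceq C {#t, s#} {#u#}"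
    using tensor_merge[OF C, of X x e X' x' e'] add.prems s by auto
  moreover have "ceq C (add_mset t P) {#t, s#}"
    using ceq_add[OF ceq_refl[of C "{#t#}"] s(2)] by (simp add: add_mset_commute)
  ultimately show ?case using ceq_trans by blast
qed

lemma coend_pure:
  assumes "C \<in> Obj \<C>" "u \<in> carrier (coend_module R \<C> F C)"
  obtains X x e where "X \<in> Obj \<C>" "x \<in> el X" "ext C X e" "u = cl C {#(X, x, e)#}"
proof -
  obtain P where P: "typed C P" "u = cl C P" using assms(2) by (auto simp: carrier_coend)
  obtain t where t: "t \<in> pure_tensors \<C> F C" "ceq C P {#t#}" using typed_pure[OF assms(1) P(1)] by blast
  obtain X x e where [simp]: "t = (X, x, e)" by (cases t)
  show thesis using that[of X x e] t P assms(1) by (simp add: pure_iff extension_def cl_eq)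
qed

lemma pure_coend: "\<lbrakk>x \<in> el X; ext C X e\<rbrakk> \<Longrightarrow> cl C {#(X, x, e)#} \<in> carrier (coend_module R \<C> F C)"
  by (rule cl_closed) (simp add: pure_iff extension_def)

abbreviation pullT where "pullT c \<equiv> (\<lambda>(X, x, e). (X, x, pull \<C> c X e))"
abbreviation scaleT where "scaleT r \<equiv> (\<lambda>(X, x, e). (X, r \<odot>\<^bsub>psh_obj F X\<^esub> x, e))"

lemma ceq_pull:
  assumes "ceq C P Q" and c: "arr C' C c"
  shows "ceq C' (image_mset (pullT c) P) (image_mset (pullT c) Q)"
  using assms(1)
proof induction
  case (plus P Q S) then show ?case by (simp add: coend_eq.plus)
next
  case (trans P Q S) then show ?case by (blast intro: ceq_trans)
next
  case (add_left X x x' e)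
  then have "pull \<C> c X e \<in> exts \<C> C' X" using ext_pull[of C X e C' c] c by (simp add: extension_def arrow_def)
  then show ?case using coend_eq.add_left[OF add_left(1-3)] by simp
next
  case (add_right X x e e')
  then have e: "ext C X e" "ext C X e'" using c by (simp_all add: extension_def arrow_def)
  then have "pull \<C> c X e \<in> exts \<C> C' X" "pull \<C> c X e' \<in> exts \<C> C' X" using ext_pull[OF _ c] by (simp_all add: extension_def)
  then show ?case using coend_eq.add_right[OF add_right(1,2)] pull_additive[OF e c] by simp
next
  case (zero X e)
  then have "pull \<C> c X e \<in> exts \<C> C' X" using ext_pull[of C X e C' c] c by (simp add: extension_def arrow_def)
  then show ?case using coend_eq.zero[OF zero(1)] by simp
next
  case (balanced X r x e)
  then have "pull \<C> c X e \<in> exts \<C> C' X" using ext_pull[of C X e C' c] c by (simp add: extension_def arrow_def)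
  moreover have "pull \<C> c X (r \<odot>\<^bsub>Ext \<C> C X\<^esub> e) = r \<odot>\<^bsub>Ext \<C> C' X\<^esub> pull \<C> c X e"
    using pull_smult[of C C' X c r e] balanced c by (simp add: arrow_def)
  ultimately show ?case using coend_eq.balanced[OF balanced(1-3)] by simp
next
  case (dinatural X X' f x e)
  then have e: "ext C X e" and f: "arr X X' f" using c by (simp_all add: extension_def arrow_def)
  then have 1: "pull \<C> c X e \<in> exts \<C> C' X" using ext_pull[OF e c] by (simp add: extension_def)
  show ?case using coend_eq.dinatural[OF dinatural(1-4) 1] push_pull_commute[OF e f c] by simp
qed (auto intro: ceq_refl ceq_sym)

lemma pull_coend:
  assumes c: "arr C' C c"
  shows "psh_mor (coend_presheaf R \<C> F) c (cl C P) = cl C' (image_mset (pullT c) P)"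
proof -
  have "Dom \<C> c = C'" using hom_Dom_Cod c by (auto simp: arrow_def)
  then have "psh_mor (coend_presheaf R \<C> F) c (cl C P) = cl C' (image_mset (pullT c) (tensors (cl C P)))"
    by (simp add: coend_presheaf_def)
  also have "\<dots> = cl C' (image_mset (pullT c) P)"
    unfolding cl_eq by (rule ceq_sym, rule ceq_pull[OF tensors_cl c])
  finally show ?thesis .
qed

lemma typed_pull: "\<lbrakk>typed C P; arr C' C c\<rbrakk> \<Longrightarrow> typed C' (image_mset (pullT c) P)"
  using ext_pull[of C _ _ C' c] by (fastforce simp: pure_tensors_def extension_def arrow_def)

lemma typed_scale: "\<lbrakk>typed C P; r \<in> carrier R\<rbrakk> \<Longrightarrow> typed C (image_mset (scaleT r) P)"
  using scalar_closed by (fastforce simp: pure_tensors_def)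

lemma ceq_map_all:
  assumes "typed C P" and "\<And>X x e. (X, x, e) \<in> pure_tensors \<C> F C \<Longrightarrow> ceq C' {#f (X, x, e)#} {#g (X, x, e)#}"
  shows "ceq C' (image_mset f P) (image_mset g P)"
  using assms(1)
proof (induction P)
  case empty show ?case by (simp add: ceq_refl)
next
  case (add t P)
  obtain X x e where t: "t = (X, x, e)" by (cases t)
  have "ceq C' ({#f t#} + image_mset f P) ({#g t#} + image_mset g P)"
    using add assms(2) by (intro ceq_add) (auto simp: t)
  then show ?case by simp
qed

text \<open>
  The essential point is half exactness. If the restriction \<open>x \<otimes> f\<^sup>*e\<close> of a pure tensor to \<open>A\<close> is zero, then
  \<open>x\<close> extends to \<open>w\<close> on the middle term \<open>W\<close> of \<open>f\<^sup>*e\<close> by \<open>tensor_zero\<close>. This rewrites the tensor as \<open>w \<otimes> j\<^sub>*e\<close> with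
  \<open>f\<^sup>*j\<^sub>*e = 0\<close>, and \<open>j\<^sub>*e\<close> is pulled back from \<open>C\<close>.
\<close>

lemma coend_exact_presheaf: "exact_presheaf R \<C> (coend_presheaf R \<C> F)"
proof (rule exact_presheaf.intro[OF extriangulated_category_axioms exact_presheaf_axioms.intro], goal_cases)
  have F: "psh_obj (coend_presheaf R \<C> F) X = coend_module R \<C> F X" for X
    by (simp add: coend_presheaf_def)
  note F [simp]
  {
    case (1 X) then show ?case by (simp add: coend_group)
  next
    case (2 X Y f x)
    then obtain P where "typed Y P" "x = cl Y P" by (auto simp: carrier_coend)
    then show ?case using cl_closed[OF typed_pull[OF _ 2(1)]] pull_coend[OF 2(1)] by simp
  next
    case (3 X Y f x y)
    then obtain P Q where "x = cl Y P" "y = cl Y Q" by (auto simp: carrier_coend)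
    then show ?case by (simp add: add_coend pull_coend[OF 3(1)])
  next
    case (4 X x)
    then obtain P where P: "typed X P" "x = cl X P" by (auto simp: carrier_coend)
    have "image_mset (pullT (Ide \<C> X)) P = image_mset id P"
      by (rule image_mset_cong) (use P(1) pull_Ide 4(1) in \<open>auto simp: pure_tensors_def\<close>)
    then show ?case using P pull_coend[OF arr_id[OF 4(1)]] by simp
  next
    case (5 X Y f W g x)
    then obtain P where P: "typed W P" "x = cl W P" by (auto simp: carrier_coend)
    have "image_mset (pullT (g \<cdot> f)) P = image_mset (pullT f) (image_mset (pullT g) P)"
      unfolding image_mset.compositionality
    proof (rule image_mset_cong, goal_cases)
      case (1 t)
      then obtain Z z e where "t = (Z, z, e)" "ext W Z e"
        using P(1) arr_obj[OF 5(2)] by (cases t) (auto simp: pure_tensors_def extension_def)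
      then show ?case using pull_comp[OF _ 5(2,1)] by simp
    qed
    then show ?case using P pull_coend[OF 5(1)] pull_coend[OF 5(2)] pull_coend[OF arr_comp[OF 5(1,2)]] by simp
  next
    case (6 X Y f g x)
    obtain Z z e where x: "Z \<in> Obj \<C>" "z \<in> el Z" "ext Y Z e" "x = cl Y {#(Z, z, e)#}"
      using coend_pure[OF arr_obj(2)[OF 6(1)] 6(3)[unfolded F]] by blast
    have e: "pull \<C> f Z e \<in> exts \<C> X Z" "pull \<C> g Z e \<in> exts \<C> X Z"
      using ext_pull[OF x(3) 6(1)] ext_pull[OF x(3) 6(2)] by (auto simp: extension_def)
    show ?case
      using coend_eq.add_right[OF x(1,2) e] additive_pull[OF x(3) 6(1,2)]
      by (simp add: x(4) pull_coend[OF 6(1)] pull_coend[OF 6(2)] pull_coend[OF arr_add[OF 6(1,2)]]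
          add_coend cl_eq add_mset_commute)
  next
    case (7 r X x)
    then obtain P where P: "typed X P" "x = cl X P" by (auto simp: carrier_coend)
    then show ?case
      using cl_closed[OF typed_scale[OF typed_tensors[OF P(1) 7(2)] 7(1)]] by (simp add: coend_module_def)
  next
    case (8 r X Y f x)
    then obtain P where P: "typed Y P" "x = cl Y P" by (auto simp: carrier_coend)
    define T where "T = tensors x"
    have T: "typed Y T" "ceq Y P T" unfolding T_def P(2)
      using typed_tensors[OF P(1) arr_obj(2)[OF 8(2)]] tensors_cl by auto
    have rx: "r \<odot>\<^bsub>coend_module R \<C> F Y\<^esub> x = cl Y (image_mset (scaleT r) T)"
      by (simp add: coend_module_def T_def)
    have "ceq X (image_mset (pullT (r \<odot>\<^bsub>Hom \<C> X Y\<^esub> f)) T) (image_mset (\<lambda>t. pullT f (scaleT r t)) T)"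
    proof (rule ceq_map_all[OF T(1)])
      fix Z z e assume "(Z, z, e) \<in> pure_tensors \<C> F Y"
      then have z: "Z \<in> Obj \<C>" "z \<in> el Z" "e \<in> exts \<C> Y Z" "ext Y Z e"
        using arr_obj[OF 8(2)] by (auto simp: pure_iff extension_def)
      have "pull \<C> f Z e \<in> exts \<C> X Z" using ext_pull[OF z(4) 8(2)] by (simp add: extension_def)
      from coend_eq.balanced[OF z(1) 8(1) z(2) this]
      show "ceq X {#pullT (r \<odot>\<^bsub>Hom \<C> X Y\<^esub> f) (Z, z, e)#} {#pullT f (scaleT r (Z, z, e))#}"
        using smult_pull[of Y X Z r f e] z 8(1,2) ceq_sym by (fastforce simp: arrow_def)
    qed
    then have "cl X (image_mset (pullT (r \<odot>\<^bsub>Hom \<C> X Y\<^esub> f)) T) = cl X (image_mset (pullT f) (image_mset (scaleT r) T))"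
      by (simp add: cl_eq image_mset.compositionality comp_def)
    moreover have "x = cl Y T" using P(2) T(2) by (simp add: cl_eq)
    ultimately show ?case
      using rx pull_coend[OF 8(2)] pull_coend[OF arr_smult[OF 8(1,2)], of T] by simp
  next
    case (9 A f B g C \<delta> u)
    note D = realizesD[OF 9(1)]
    obtain Z x e where x: "Z \<in> Obj \<C>" "x \<in> el Z" "ext B Z e" "u = cl B {#(Z, x, e)#}"
      using coend_pure[OF D(6) 9(2)[unfolded F]] by blast
    note fe = ext_pull[OF x(3) D(2)]
    have "ceq A {#(Z, x, pull \<C> f Z e)#} {#}"
      using 9(3) by (simp add: x(4) pull_coend[OF D(2)] zero_coend cl_eq)
    moreover obtain j W p where r: "rlz Z j W p A (pull \<C> f Z e)" using realization[OF fe] by blast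
    ultimately obtain w where w: "w \<in> el W" "act j w = x" using tensor_zero[OF _ x(2)] by metis
    note DW = realizesD[OF r]
    have "pull \<C> f W (push \<C> B j e) = push \<C> A j (pull \<C> f Z e)"
      using push_pull_commute[OF x(3) DW(2) D(2)] by simp
    then have "pull \<C> f W (push \<C> B j e) = ze A W" using push_inflation[OF r] by simp
    from pull_exact[OF 9(1) ext_push[OF x(3) DW(2)] this] obtain e' where
      e': "ext C W e'" "pull \<C> g W e' = push \<C> B j e" by blast
    have "ceq B {#(Z, act j w, e)#} {#(W, w, push \<C> B j e)#}"
      by (rule coend_eq.dinatural) (use DW x w in \<open>auto simp: arrow_def extension_def\<close>)
    then have "u = psh_mor (coend_presheaf R \<C> F) g (cl C {#(W, w, e')#})"
      using x(4) w(2) e'(2) by (simp add: pull_coend[OF D(3)] cl_eq)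
    then show ?case using pure_coend[OF w(1) e'(1)] by auto
  }
qed

text \<open>
  The deflation of a realization of \<open>e\<close> kills \<open>x \<otimes> e\<close>.
\<close>

lemma coend_effaceable: "effaceable (coend_presheaf R \<C> F)"
  unfolding effaceable_def
proof (intro ballI)
  have S: "psh_obj (coend_presheaf R \<C> F) X = coend_module R \<C> F X" for X
    by (simp add: coend_presheaf_def)
  fix C u assume C: "C \<in> Obj \<C>" and u: "u \<in> carrier (psh_obj (coend_presheaf R \<C> F) C)"
  obtain Z x e where x: "Z \<in> Obj \<C>" "x \<in> el Z" "ext C Z e" "u = cl C {#(Z, x, e)#}"
    using coend_pure[OF C u[unfolded S]] by blast
  obtain j W p where r: "rlz Z j W p C e" using realization[OF x(3)] by blast
  have "psh_mor (coend_presheaf R \<C> F) p u = \<zero>\<^bsub>psh_obj (coend_presheaf R \<C> F) W\<^esub>"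
    using pull_deflation[OF r] tensor_zero_right[OF realizesD(6)[OF r] x(1,2)]
    by (simp add: x(4) pull_coend[OF realizesD(3)[OF r]] S zero_coend cl_eq)
  with r show "\<exists>Z j W p e. rlz Z j W p C e \<and>
      psh_mor (coend_presheaf R \<C> F) p u = \<zero>\<^bsub>psh_obj (coend_presheaf R \<C> F) W\<^esub>" by blast
qed

end

context extriangulated_category
begin

lemma ext_presheaf_sel [simp]:
  "carrier (psh_obj (ext_presheaf \<C> A) C) = Base ` exts \<C> C A"
  "\<zero>\<^bsub>psh_obj (ext_presheaf \<C> A) C\<^esub> = Base (ze C A)"
  "u \<oplus>\<^bsub>psh_obj (ext_presheaf \<C> A) C\<^esub> v = Base (base u \<oplus>\<^bsub>Ext \<C> C A\<^esub> base v)"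
  "r \<odot>\<^bsub>psh_obj (ext_presheaf \<C> A) C\<^esub> u = Base (r \<odot>\<^bsub>Ext \<C> C A\<^esub> base u)"
  "psh_mor (ext_presheaf \<C> A) c u = Base (pull \<C> c A (base u))"
  by (simp_all add: ext_presheaf_def)

lemma ext_exact_presheaf:
  assumes A: "A \<in> Obj \<C>"
  shows "exact_presheaf R \<C> (ext_presheaf \<C> A)"
proof (rule exact_presheaf.intro[OF extriangulated_category_axioms exact_presheaf_axioms.intro], goal_cases)
  case (1 X)
  interpret E: abelian_group "Ext \<C> X A" using ext_group 1 A by blast
  show ?case
  proof (rule abelian_groupI)
    show "\<exists>y\<in>carrier (psh_obj (ext_presheaf \<C> A) X). y \<oplus>\<^bsub>psh_obj (ext_presheaf \<C> A) X\<^esub> x = \<zero>\<^bsub>psh_obj (ext_presheaf \<C> A) X\<^esub>"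
      if "x \<in> carrier (psh_obj (ext_presheaf \<C> A) X)" for x
      using that by (auto intro!: bexI[of _ "\<ominus>\<^bsub>Ext \<C> X A\<^esub> base x"] simp: E.l_neg)
  qed (auto simp: E.a_ac)
next
  case (2 X Y f x) then show ?case using pull_closed A by (auto simp: arrow_def)
next
  case (3 X Y f x y) then show ?case using pull_add[of Y X A f] A by (auto simp: arrow_def)
next
  case (4 X x) then show ?case using pull_Ide A by auto
next
  case (5 X Y f W g x) then show ?case using pull_Comp A by (auto simp: arrow_def)
next
  case (6 X Y f g x) then show ?case using add_pull A by (auto simp: arrow_def)
next
  case (7 r X x) then show ?case using ext_smult[of r X A "base x"] A by (auto simp: extension_def)
next
  case (8 r X Y f x)
  then show ?case using smult_pull[of Y X A r f] pull_smult[of Y X A f r] A by (auto simp: arrow_def)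
next
  case (9 C f B g D \<delta> x)
  then obtain d where d: "x = Base d" "ext B A d" "pull \<C> f A d = ze C A"
    using A realizesD(6)[OF 9(1)] by (auto simp: extension_def)
  from pull_exact[OF 9(1) d(2,3)] obtain d' where "ext D A d'" "pull \<C> g A d' = d" by blast
  then show ?case using d(1) by (auto simp: extension_def)
qed

lemma higher_exact_presheaf:
  assumes "A \<in> Obj \<C>"
  shows "exact_presheaf R \<C> (higher_ext_presheaf R \<C> A (Suc n))"
  by (induction n) (simp_all add: ext_exact_presheaf[OF assms] exact_presheaf.coend_exact_presheaf)

text \<open>
  Vanishing for single objects; the membership conditions make it false outside the category.
\<close>

definition hvanish where
  "hvanish k X Y \<longleftrightarrow> X \<in> Obj \<C> \<and> Y \<in> Obj \<C> \<and>
     carrier (higher_ext R \<C> k X Y) = {\<zero>\<^bsub>higher_ext R \<C> k X Y\<^esub>}"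

lemma hvanish_1: "hvanish (Suc 0) X Y \<longleftrightarrow> orth \<C> X Y"
  by (auto simp: hvanish_def orth_def higher_ext_def)

lemma hvanishI:
  assumes "X \<in> Obj \<C>" "Y \<in> Obj \<C>"
    "\<And>x. x \<in> carrier (psh_obj (higher_ext_presheaf R \<C> Y (Suc k)) X) \<Longrightarrow>
       x = \<zero>\<^bsub>psh_obj (higher_ext_presheaf R \<C> Y (Suc k)) X\<^esub>"
  shows "hvanish (Suc k) X Y"
  using assms exact_presheaf.zero_el[OF higher_exact_presheaf[OF assms(2)] assms(1)]
  unfolding hvanish_def higher_ext_def by blast

lemma hvanishD:
  assumes "hvanish (Suc k) X Y" "x \<in> carrier (psh_obj (higher_ext_presheaf R \<C> Y (Suc k)) X)"
  shows "x = \<zero>\<^bsub>psh_obj (higher_ext_presheaf R \<C> Y (Suc k)) X\<^esub>"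
  using assms unfolding hvanish_def higher_ext_def by blast

lemma hvanish_zero_tensor:
  assumes "hvanish (Suc (Suc k)) X A" "x \<in> carrier (psh_obj (higher_ext_presheaf R \<C> A (Suc k)) K)" "ext X K \<xi>"
  shows "coend_eq R \<C> (higher_ext_presheaf R \<C> A (Suc k)) X {#(K, x, \<xi>)#} {#}"
proof -
  have A: "A \<in> Obj \<C>" using assms(1) by (simp add: hvanish_def)
  interpret F: exact_presheaf R \<C> "higher_ext_presheaf R \<C> A (Suc k)" by (rule higher_exact_presheaf[OF A])
  from hvanishD[OF assms(1)] F.pure_coend[OF assms(2,3)]
  have "F.cl X {#(K, x, \<xi>)#} = F.cl X {#}" by (simp add: coend_presheaf_def F.zero_coend)
  then show ?thesis by (simp add: F.cl_eq)
qed

text \<open>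
  For \<open>x \<in> \<bbbE>\<^sup>k(K,A)\<close> the tensor \<open>x \<otimes> \<xi>\<close> lies in \<open>\<bbbE>\<^sup>k\<^sup>+\<^sup>1(X,A) = 0\<close>, so \<open>x\<close> extends to \<open>\<bbbE>\<^sup>k(B,A) = 0\<close>.
\<close>

lemma hvanish_kernel:
  assumes "conf \<C> K B X" "hvanish (Suc k) B A" "hvanish (Suc (Suc k)) X A"
  shows "hvanish (Suc k) K A"
proof -
  obtain i p \<xi> where r: "rlz K i B p X \<xi>" using assms(1) by (auto simp: conf_def)
  note D = realizesD[OF r]
  have A: "A \<in> Obj \<C>" using assms(2) by (simp add: hvanish_def)
  interpret F: exact_presheaf R \<C> "higher_ext_presheaf R \<C> A (Suc k)" by (rule higher_exact_presheaf[OF A])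
  show ?thesis
  proof (rule hvanishI[OF D(5) A])
    fix x assume x: "x \<in> F.el K"
    obtain y where y: "y \<in> F.el B" "F.act i y = x"
      using F.tensor_zero[OF r x hvanish_zero_tensor[OF assms(3) x D(1)]] by blast
    then show "x = F.zF K" using hvanishD[OF assms(2) y(1)] F.act_zero[OF D(2)] by simp
  qed
qed

text \<open>
  The tensor of the two extensions is zero, so by \<open>tensor_zero\<close> the extension of \<open>K\<close> by \<open>Y\<close> is
  the restriction of one of \<open>B\<close>, with middle term \<open>V\<close>. By the dual of (ET4), \<open>V\<close> is an extension of \<open>X\<close> by \<open>W\<close>.
\<close>

lemma conf_lift:
  assumes "hvanish 2 X Y" "conf \<C> K B X" "conf \<C> Y W K"
  shows "\<exists>V. conf \<C> Y V B \<and> conf \<C> W V X"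
proof -
  obtain i p \<xi> where r: "rlz K i B p X \<xi>" using assms(2) by (auto simp: conf_def)
  obtain u v \<delta> where s: "rlz Y u W v K \<delta>" using assms(3) by (auto simp: conf_def)
  note D = realizesD[OF r] and D' = realizesD[OF s]
  interpret F: exact_presheaf R \<C> "ext_presheaf \<C> Y" by (rule ext_exact_presheaf[OF D'(5)])
  have x: "Base \<delta> \<in> F.el K" using D'(1) by (simp add: extension_def)
  have "F.ceq X {#(K, Base \<delta>, \<xi>)#} {#}"
    using hvanish_zero_tensor[of 0 X Y "Base \<delta>" K \<xi>] assms(1) x D(1) by (simp add: numeral_2_eq_2)
  from F.tensor_zero[OF r x this] obtain y where "y \<in> F.el B" "F.act i y = Base \<delta>" by blast
  then obtain d where d: "ext B Y d" "pull \<C> i Y d = \<delta>"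
    using D(6) D'(5) by (auto simp: extension_def)
  obtain m V q where t: "rlz Y m V q B d" using realization[OF d(1)] by blast
  \<comment> \<open>The term \<open>E\<close> realizes the restriction of \<open>d\<close> to \<open>K\<close>, so it is isomorphic to \<open>W\<close>.\<close>
  from compose_deflations[OF r t] obtain E h dd e \<delta>'' where
    E: "rlz E h V (p \<cdot> q) X \<delta>''" "rlz Y e E dd K \<delta>" using d(2) by metis
  obtain b where b: "is_iso \<C> E W b" using realizes_unique[OF E(2) s] by metis
  obtain b' where b': "arr E W b" "arr W E b'" "b' \<cdot> b = Ide \<C> E" "b \<cdot> b' = Ide \<C> W"
    using isoE[OF b] by metis
  from realizes_iso_left[OF E(1) b'] t show ?thesis unfolding conf_def by blast
qed

end

section \<open>Exactness of higher extensions in the covariant variable\<close>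

locale presheaf_morphism = dom: exact_presheaf R \<C> F + cod: exact_presheaf R \<C> G
  for R :: "('r, 'y) ring_scheme" (structure)
  and \<C> :: "('o, 'm, 'r, 'e, 'z) extri_cat_scheme"
  and F :: "('o, 'm, 'r, 'e) presheaf" and G :: "('o, 'm, 'r, 'e) presheaf" +
  fixes \<phi> :: "'o \<Rightarrow> ('o, 'e) hext \<Rightarrow> ('o, 'e) hext"
  assumes map_closed: "\<lbrakk>X \<in> Obj \<C>; x \<in> carrier (psh_obj F X)\<rbrakk> \<Longrightarrow> \<phi> X x \<in> carrier (psh_obj G X)"
    and map_add: "\<lbrakk>X \<in> Obj \<C>; x \<in> carrier (psh_obj F X); y \<in> carrier (psh_obj F X)\<rbrakk>
      \<Longrightarrow> \<phi> X (x \<oplus>\<^bsub>psh_obj F X\<^esub> y) = \<phi> X x \<oplus>\<^bsub>psh_obj G X\<^esub> \<phi> X y"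
    and map_natural: "\<lbrakk>arrow \<C> X Y f; x \<in> carrier (psh_obj F Y)\<rbrakk>
      \<Longrightarrow> \<phi> X (psh_mor F f x) = psh_mor G f (\<phi> Y x)"
begin

lemma map_zero: "X \<in> Obj \<C> \<Longrightarrow> \<phi> X (dom.zF X) = cod.zF X"
  by (rule additive_map_zero[OF dom.obj_group cod.obj_group]) (auto simp: map_closed map_add)

lemma map_scalar:
  assumes "r \<in> carrier R" "X \<in> Obj \<C>" "x \<in> dom.el X"
  shows "\<phi> X (r \<odot>\<^bsub>psh_obj F X\<^esub> x) = r \<odot>\<^bsub>psh_obj G X\<^esub> \<phi> X x"
  using dom.scalar_via_mor[OF assms] cod.scalar_via_mor[OF assms(1,2) map_closed[OF assms(2,3)]]
    map_natural[OF dom.arr_smult[OF assms(1) dom.arr_id[OF assms(2)]] assms(3)] by simp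

abbreviation mapT where "mapT \<equiv> (\<lambda>(X, x, e). (X, \<phi> X x, e))"

lemma ceq_map:
  assumes "dom.ceq C P Q"
  shows "cod.ceq C (image_mset mapT P) (image_mset mapT Q)"
  using assms
proof induction
  case (plus P Q S) then show ?case by (simp add: coend_eq.plus)
next
  case (trans P Q S) then show ?case by (blast intro: cod.ceq_trans)
next
  case (add_left X x x' e)
  then show ?case using coend_eq.add_left[of X \<C> "\<phi> X x" G "\<phi> X x'" e C R] by (simp add: map_add map_closed)
next
  case (add_right X x e e')
  then show ?case using coend_eq.add_right[of X \<C> "\<phi> X x" G e C e' R] by (simp add: map_closed)
next
  case (zero X e)
  then show ?case using coend_eq.zero[of X \<C> e C R G] by (simp add: map_zero)
next
  case (balanced X r x e)
  then show ?case using coend_eq.balanced[of X \<C> r R "\<phi> X x" G e C] by (simp add: map_closed map_scalar)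
next
  case (dinatural X X' f x e)
  then show ?case
    using coend_eq.dinatural[of X \<C> X' f "\<phi> X' x" G e C R] map_natural[of X X' f x] by (simp add: map_closed arrow_def)
qed (auto intro: cod.ceq_refl cod.ceq_sym)

definition coend_map where
  "coend_map C u = cod.cl C (image_mset mapT (tensors u))"

lemma coend_map_cl: "coend_map C (dom.cl C P) = cod.cl C (image_mset mapT P)"
  unfolding coend_map_def cod.cl_eq by (rule cod.ceq_sym, rule ceq_map[OF dom.tensors_cl])

lemma coend_map_morphism: "presheaf_morphism R \<C> (coend_presheaf R \<C> F) (coend_presheaf R \<C> G) coend_map"
proof (rule presheaf_morphism.intro[OF dom.coend_exact_presheaf cod.coend_exact_presheaf
     presheaf_morphism_axioms.intro], goal_cases)
  have S: "psh_obj (coend_presheaf R \<C> F) X = coend_module R \<C> F X"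
    "psh_obj (coend_presheaf R \<C> G) X = coend_module R \<C> G X" for X
    by (simp_all add: coend_presheaf_def)
  {
    case (1 X u)
    then obtain P where P: "dom.typed X P" "u = dom.cl X P" by (auto simp: S dom.carrier_coend)
    have "cod.typed X (image_mset mapT P)" using P(1) map_closed by (fastforce simp: pure_tensors_def)
    then show ?case unfolding P(2) coend_map_cl S by (rule cod.cl_closed)
  next
    case (2 X u v)
    then obtain P Q where "u = dom.cl X P" "v = dom.cl X Q" by (auto simp: S dom.carrier_coend)
    then show ?case by (simp add: S dom.add_coend cod.add_coend coend_map_cl)
  next
    case (3 X Y f u)
    then obtain P where P: "u = dom.cl Y P" by (auto simp: S dom.carrier_coend)
    have "image_mset mapT (image_mset (dom.pullT f) P) = image_mset (cod.pullT f) (image_mset mapT P)"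
      unfolding image_mset.compositionality by (rule image_mset_cong) auto
    then show ?case by (simp add: P dom.pull_coend[OF 3(1)] cod.pull_coend[OF 3(1)] coend_map_cl)
  }
qed

end

context extriangulated_category
begin

definition exact_at where
  "exact_at F1 F2 F3 \<phi> \<psi> \<longleftrightarrow> presheaf_morphism R \<C> F1 F2 \<phi> \<and> presheaf_morphism R \<C> F2 F3 \<psi> \<and>
     (\<forall>X\<in>Obj \<C>. \<forall>x\<in>carrier (psh_obj F2 X). \<psi> X x = \<zero>\<^bsub>psh_obj F3 X\<^esub> \<longrightarrow>
       (\<exists>y\<in>carrier (psh_obj F1 X). \<phi> X y = x))"

text \<open>
  Exactness passes to coends. If \<open>\<psi>(x) \<otimes> e\<close> is zero, then \<open>\<psi>(x)\<close> extends to the middle term \<open>W\<close> of a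
  realization of \<open>e\<close>. Some deflation onto \<open>W\<close> kills this extension; the kernel \<open>Z'\<close> of its composite with
  \<open>W \<rightarrow> X\<close> maps to \<open>Z\<close>, \<open>e\<close> is a pushforward from \<open>Z'\<close>, and on \<open>Z'\<close> the restriction of \<open>x\<close> is in the
  kernel of \<open>\<psi>\<close>, so it comes from \<open>F1\<close>.
\<close>

lemma coend_exact_step:
  assumes exact: "exact_at F1 F2 F3 \<phi> \<psi>" and eff: "effaceable F3"
  shows "exact_at (coend_presheaf R \<C> F1) (coend_presheaf R \<C> F2) (coend_presheaf R \<C> F3)
    (presheaf_morphism.coend_map R \<C> F2 \<phi>) (presheaf_morphism.coend_map R \<C> F3 \<psi>)"
proof -
  interpret f: presheaf_morphism R \<C> F1 F2 \<phi> using exact by (simp add: exact_at_def)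
  interpret g: presheaf_morphism R \<C> F2 F3 \<psi> using exact by (simp add: exact_at_def)
  have S: "psh_obj (coend_presheaf R \<C> F) X = coend_module R \<C> F X" for F X
    by (simp add: coend_presheaf_def)
  have "\<exists>v\<in>carrier (coend_module R \<C> F1 X). f.coend_map X v = u"
    if X: "X \<in> Obj \<C>" and u: "u \<in> carrier (coend_module R \<C> F2 X)" "g.coend_map X u = \<zero>\<^bsub>coend_module R \<C> F3 X\<^esub>" for X u
  proof -
    obtain Z x e where x: "Z \<in> Obj \<C>" "x \<in> f.cod.el Z" "ext X Z e" "u = f.cod.cl X {#(Z, x, e)#}"
      using f.cod.coend_pure[OF X u(1)] by blast
    obtain j W p where r: "rlz Z j W p X e" using realization[OF x(3)] by blast
    note D = realizesD[OF r]
    have "g.cod.ceq X {#(Z, \<psi> Z x, e)#} {#}"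
      using u(2) by (simp add: x(4) g.coend_map_cl g.cod.zero_coend g.cod.cl_eq)
    from g.cod.tensor_zero[OF r g.map_closed[OF x(1,2)] this] obtain w where
      w: "w \<in> g.cod.el W" "g.cod.act j w = \<psi> Z x" by blast
    obtain V v W' q \<eta> where s: "rlz V v W' q W \<eta>" "g.cod.act q w = g.cod.zF W'"
      using eff D(6) w(1) unfolding effaceable_def by blast
    \<comment> \<open>The kernel \<open>Z'\<close> of the composite deflation \<open>W' \<rightarrow> W \<rightarrow> X\<close>.\<close>
    from compose_deflations[OF r s(1)] obtain Z' h d \<delta> where
      Z': "rlz Z' h W' (p \<cdot> q) X \<delta>" "arr Z' Z d" "q \<cdot> h = j \<cdot> d" "push \<C> X d \<delta> = e" using realizesD(3) by metis
    note D' = realizesD[OF Z'(1)] and Ds = realizesD[OF s(1)]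
    have "\<psi> Z' (f.cod.act d x) = g.cod.act d (g.cod.act j w)"
      using g.map_natural[OF Z'(2) x(2)] w(2) by simp
    also have "\<dots> = g.cod.act h (g.cod.act q w)"
      using g.cod.mor_comp[OF Z'(2) D(2) w(1)] g.cod.mor_comp[OF D'(2) Ds(3) w(1)] Z'(3) by simp
    also have "\<dots> = g.cod.zF Z'" using s(2) g.cod.act_zero[OF D'(2)] by simp
    finally obtain y where y: "y \<in> f.dom.el Z'" "\<phi> Z' y = f.cod.act d x"
      using exact D'(5) f.cod.mor_closed[OF Z'(2) x(2)] unfolding exact_at_def by blast
    have "f.cod.ceq X {#(Z', f.cod.act d x, \<delta>)#} {#(Z, x, push \<C> X d \<delta>)#}"
      by (rule coend_eq.dinatural) (use D' Z' x in \<open>auto simp: arrow_def extension_def\<close>)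
    then have "f.coend_map X (f.dom.cl X {#(Z', y, \<delta>)#}) = u"
      by (simp add: f.coend_map_cl x(4) f.cod.cl_eq y(2) Z'(4))
    then show ?thesis using f.dom.pure_coend[OF y(1) D'(1)] by blast
  qed
  then show ?thesis
    unfolding exact_at_def S using f.coend_map_morphism g.coend_map_morphism by blast
qed

lemma higher_effaceable:
  assumes "A \<in> Obj \<C>"
  shows "effaceable (higher_ext_presheaf R \<C> A (Suc (Suc n)))"
  using exact_presheaf.coend_effaceable[OF higher_exact_presheaf[OF assms]] by simp

lemma push_morphism:
  assumes g: "arr A' A g"
  shows "presheaf_morphism R \<C> (ext_presheaf \<C> A') (ext_presheaf \<C> A) (\<lambda>X u. Base (push \<C> X g (base u)))"
proof (rule presheaf_morphism.intro[OF ext_exact_presheaf[OF arr_obj(1)[OF g]] ext_exact_presheaf[OF arr_obj(2)[OF g]]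
     presheaf_morphism_axioms.intro], goal_cases)
  case (1 X x) then show ?case using push_closed g by (auto simp: arrow_def)
next
  case (2 X x y) then show ?case using push_add[of X A' A g] g by (auto simp: arrow_def)
next
  case (3 X Y h x) then show ?case using push_pull[of Y X A' A g h] g by (auto simp: arrow_def)
qed

lemma connecting_morphism:
  assumes d: "ext A A'' \<delta>"
  shows "presheaf_morphism R \<C> (ext_presheaf \<C> A) (coend_presheaf R \<C> (ext_presheaf \<C> A''))
      (\<lambda>X u. coend_class R \<C> (ext_presheaf \<C> A'') X {#(A, Base \<delta>, base u)#})"
proof -
  note D = ext_obj[OF d]
  interpret F: exact_presheaf R \<C> "ext_presheaf \<C> A''" by (rule ext_exact_presheaf[OF D(1)])
  have \<delta>: "Base \<delta> \<in> F.el A" using d by (simp add: extension_def)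
  have S: "psh_obj (coend_presheaf R \<C> (ext_presheaf \<C> A'')) X = coend_module R \<C> (ext_presheaf \<C> A'') X" for X
    by (simp add: coend_presheaf_def)
  show ?thesis
  proof (rule presheaf_morphism.intro[OF ext_exact_presheaf[OF D(2)] F.coend_exact_presheaf
       presheaf_morphism_axioms.intro], goal_cases)
    case (1 X x)
    then obtain d where "x = Base d" "ext X A d" using D(2) by (auto simp: extension_def)
    then show ?case using F.pure_coend[OF \<delta>] by (simp add: S)
  next
    case (2 X x y)
    then obtain d d' where d: "x = Base d" "y = Base d'" "d \<in> exts \<C> X A" "d' \<in> exts \<C> X A" by auto
    from coend_eq.add_right[OF D(2) \<delta> d(3,4)]
    have "F.ceq X {#(A, Base \<delta>, d \<oplus>\<^bsub>Ext \<C> X A\<^esub> d')#} {#(A, Base \<delta>, d), (A, Base \<delta>, d')#}" .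
    then show ?case by (simp add: d S F.add_coend F.cl_eq add_mset_commute)
  next
    case (3 X Y h x)
    then show ?case using F.pull_coend[OF 3(1)] by auto
  qed
qed

text \<open>
  The start of the long exact sequence: if \<open>\<delta> \<otimes> d\<close> is zero, the extension \<open>\<delta>\<close> of \<open>A\<close> continues to the middle term
  \<open>B\<close> of \<open>d\<close>, and the dual of (ET4) turns this into an extension of \<open>X\<close> by \<open>A'\<close> that maps to \<open>d\<close>.
\<close>

lemma connecting_kernel:
  assumes r: "rlz A'' f A' g A \<delta>" and X: "X \<in> Obj \<C>"
    and x: "x \<in> carrier (psh_obj (ext_presheaf \<C> A) X)"
    and z: "coend_class R \<C> (ext_presheaf \<C> A'') X {#(A, Base \<delta>, base x)#} = \<zero>\<^bsub>coend_module R \<C> (ext_presheaf \<C> A'') X\<^esub>"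
  shows "\<exists>y\<in>carrier (psh_obj (ext_presheaf \<C> A') X). Base (push \<C> X g (base y)) = x"
proof -
  note D = realizesD[OF r]
  interpret F: exact_presheaf R \<C> "ext_presheaf \<C> A''" by (rule ext_exact_presheaf[OF D(5)])
  have \<delta>: "Base \<delta> \<in> F.el A" using D(1) by (simp add: extension_def)
  obtain d where d: "x = Base d" "ext X A d" using x X D(7) by (auto simp: extension_def)
  obtain i B p where s: "rlz A i B p X d" using realization[OF d(2)] by blast
  have "F.ceq X {#(A, Base \<delta>, d)#} {#}" using z d(1) by (simp add: F.zero_coend F.cl_eq)
  from F.tensor_zero[OF s \<delta> this] obtain y where "y \<in> F.el B" "F.act i y = Base \<delta>" by blast
  then obtain e where e: "ext B A'' e" "pull \<C> i A'' e = \<delta>"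
    using realizesD(6)[OF s] D(5) by (auto simp: extension_def)
  obtain m V q where t: "rlz A'' m V q B e" using realization[OF e(1)] by blast
  from compose_deflations[OF s t] obtain E h c n \<delta>'' where
    E: "rlz E h V (p \<cdot> q) X \<delta>''" "rlz A'' n E c A \<delta>" "push \<C> X c \<delta>'' = d" using e(2) by metis
  obtain b where b: "is_iso \<C> E A' b" "g \<cdot> b = c" using realizes_unique[OF E(2) r] by metis
  have ba: "arr E A' b" using isoE[OF b(1)] by metis
  have "push \<C> X g (push \<C> X b \<delta>'') = d"
    using push_comp[OF realizesD(1)[OF E(1)] ba D(3)] b(2) E(3) by simp
  then show ?thesis
    using ext_push[OF realizesD(1)[OF E(1)] ba] d(1)
    by (intro bexI[of _ "Base (push \<C> X b \<delta>'')"]) (auto simp: extension_def)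
qed

text \<open>
  Exactness of \<open>\<bbbE>\<^sup>k(X,A') \<rightarrow> \<bbbE>\<^sup>k(X,A) \<rightarrow> \<bbbE>\<^sup>k\<^sup>+\<^sup>1(X,A'')\<close>, naturally in \<open>X\<close>. The induction starts from \<open>connecting_kernel\<close>.
  The maps themselves depend on iterated coends and are not named, since only vanishing is derived from them.
\<close>

lemma higher_exact_step:
  assumes r: "rlz A'' f A' g A \<delta>"
  shows "\<exists>\<phi> \<psi>. exact_at (higher_ext_presheaf R \<C> A' (Suc k)) (higher_ext_presheaf R \<C> A (Suc k))
     (higher_ext_presheaf R \<C> A'' (Suc (Suc k))) \<phi> \<psi>"
proof (induction k)
  case 0
  have S: "psh_obj (coend_presheaf R \<C> F) X = coend_module R \<C> F X" for F X
    by (simp add: coend_presheaf_def)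
  show ?case
    unfolding exact_at_def higher_ext_presheaf.simps S
    by (intro exI conjI ballI impI, rule push_morphism[OF realizesD(3)[OF r]],
        rule connecting_morphism[OF realizesD(1)[OF r]], rule connecting_kernel[OF r])
next
  case (Suc k)
  then show ?case
    using coend_exact_step[OF _ higher_effaceable[OF realizesD(5)[OF r], of k]]
    unfolding higher_ext_presheaf.simps(2)[of R \<C> _ "Suc k"] higher_ext_presheaf.simps(2)[of R \<C> A' k]
      higher_ext_presheaf.simps(2)[of R \<C> A k] by blast
qed

lemma hvanish_cokernel:
  assumes "conf \<C> A'' A' A" "hvanish (Suc k) X A'" "hvanish (Suc (Suc k)) X A''"
  shows "hvanish (Suc k) X A"
proof -
  obtain f g \<delta> where r: "rlz A'' f A' g A \<delta>" using assms(1) by (auto simp: conf_def)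
  have X: "X \<in> Obj \<C>" using assms(2) by (simp add: hvanish_def)
  obtain \<phi> \<psi> where e: "exact_at (higher_ext_presheaf R \<C> A' (Suc k)) (higher_ext_presheaf R \<C> A (Suc k))
     (higher_ext_presheaf R \<C> A'' (Suc (Suc k))) \<phi> \<psi>" using higher_exact_step[OF r] by blast
  then have 1: "presheaf_morphism R \<C> (higher_ext_presheaf R \<C> A' (Suc k)) (higher_ext_presheaf R \<C> A (Suc k)) \<phi>"
    and 2: "presheaf_morphism R \<C> (higher_ext_presheaf R \<C> A (Suc k)) (higher_ext_presheaf R \<C> A'' (Suc (Suc k))) \<psi>"
    unfolding exact_at_def by blast+
  show ?thesis
  proof (rule hvanishI[OF X realizesD(7)[OF r]])
    fix x assume x: "x \<in> carrier (psh_obj (higher_ext_presheaf R \<C> A (Suc k)) X)"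
    from hvanishD[OF assms(3) presheaf_morphism.map_closed[OF 2 X x]] e X x obtain y where
      y: "y \<in> carrier (psh_obj (higher_ext_presheaf R \<C> A' (Suc k)) X)" "\<phi> X y = x"
      unfolding exact_at_def by blast
    then show "x = \<zero>\<^bsub>psh_obj (higher_ext_presheaf R \<C> A (Suc k)) X\<^esub>"
      using hvanishD[OF assms(2) y(1)] presheaf_morphism.map_zero[OF 1 X] by simp
  qed
qed

end

section \<open>Coresolutions\<close>

text \<open>
  The objects with a finite coresolution by objects of \<open>\<M>\<close>. With the conflation relation reversed these are the
  objects with a finite resolution.
\<close>

inductive_set coresolved :: "('o \<Rightarrow> 'o \<Rightarrow> 'o \<Rightarrow> bool) \<Rightarrow> 'o set \<Rightarrow> 'o set"
  for cf :: "'o \<Rightarrow> 'o \<Rightarrow> 'o \<Rightarrow> bool" and \<M> :: "'o set" where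
  base: "X \<in> \<M> \<Longrightarrow> X \<in> coresolved cf \<M>"
| step: "\<lbrakk>cf X M X'; M \<in> \<M>; X' \<in> coresolved cf \<M>\<rbrakk> \<Longrightarrow> X \<in> coresolved cf \<M>"

lemma coresolved_mono: "\<M> \<subseteq> \<N> \<Longrightarrow> coresolved cf \<M> \<subseteq> coresolved cf \<N>"
proof
  fix X assume "\<M> \<subseteq> \<N>" "X \<in> coresolved cf \<M>"
  from this(2,1) show "X \<in> coresolved cf \<N>" by induction (blast intro: coresolved.intros)+
qed

definition (in conflation_calculus) additive_class :: "'o set \<Rightarrow> bool" where
  "additive_class \<X> \<longleftrightarrow> \<X> \<subseteq> ob \<and> (\<forall>Z. null Z \<longrightarrow> Z \<in> \<X>) \<and>
     (\<forall>A B S. A \<in> \<X> \<and> B \<in> \<X> \<and> bp A B S \<longrightarrow> S \<in> \<X>) \<and>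
     (\<forall>A B S. S \<in> \<X> \<and> bp A B S \<longrightarrow> A \<in> \<X>)"

context conflation_calculus
begin

lemma additive_classD:
  assumes "additive_class \<X>"
  shows "A \<in> \<X> \<Longrightarrow> A \<in> ob" "null Z \<Longrightarrow> Z \<in> \<X>" "\<lbrakk>A \<in> \<X>; B \<in> \<X>; bp A B S\<rbrakk> \<Longrightarrow> S \<in> \<X>"
    "\<lbrakk>S \<in> \<X>; bp A B S\<rbrakk> \<Longrightarrow> A \<in> \<X>"
  using assms unfolding additive_class_def by blast+

lemma null_bp: "\<lbrakk>null Z; A \<in> ob\<rbrakk> \<Longrightarrow> bp Z A A"
  by (rule bp_swap[OF bp_null])
lemma cf_id_null: "\<lbrakk>null Z; A \<in> ob\<rbrakk> \<Longrightarrow> cf A A Z"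
  by (rule cf_bp[OF bp_null])
lemma cf_null_id: "\<lbrakk>null Z; A \<in> ob\<rbrakk> \<Longrightarrow> cf Z A A"
  by (rule cf_bp[OF null_bp])

end

section \<open>From silting subcategories to cotorsion pairs\<close>

text \<open>
  The orthogonality between coresolved and resolved objects is visibly symmetric under duality, unlike the
  vanishing of the higher extensions of \<open>\<M>\<close> from which it is derived.
\<close>

locale silting_calculus = conflation_calculus ob null bp cf ort
  for ob :: "'o set" and null bp cf ort +
  fixes \<M> :: "'o set"
  assumes additive: "additive_class \<M>"
    and orthogonal: "\<lbrakk>X \<in> coresolved cf \<M>; Y \<in> coresolved (\<lambda>A B C. cf C B A) \<M>\<rbrakk> \<Longrightarrow> ort X Y"
begin

definition "cores = coresolved cf \<M>"
definition "res = coresolved (\<lambda>A B C. cf C B A) \<M>"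

lemma dual_silting: "silting_calculus ob null bp (\<lambda>A B C. cf C B A) (\<lambda>C A. ort A C) \<M>"
proof -
  interpret d: conflation_calculus ob null bp "\<lambda>A B C. cf C B A" "\<lambda>C A. ort A C" by (rule dual)
  show ?thesis
  proof (unfold_locales, goal_cases)
    case 1 show ?case by (rule additive)
  next
    case (2 X Y) then show ?case by (intro orthogonal)
  qed
qed

lemma dual_cores: "silting_calculus.cores (\<lambda>A B C. cf C B A) \<M> = res"
  and dual_res: "silting_calculus.res (\<lambda>A B C. cf C B A) \<M> = cores"
  by (simp_all add: silting_calculus.cores_def[OF dual_silting] silting_calculus.res_def[OF dual_silting] cores_def res_def)

lemma ort_cores_res: "\<lbrakk>X \<in> cores; Y \<in> res\<rbrakk> \<Longrightarrow> ort X Y"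
  unfolding cores_def res_def by (rule orthogonal)

lemma M_cores: "A \<in> \<M> \<Longrightarrow> A \<in> cores" and M_res: "A \<in> \<M> \<Longrightarrow> A \<in> res"
  unfolding cores_def res_def by (auto intro: coresolved.base)

lemma cores_ob: "A \<in> cores \<Longrightarrow> A \<in> ob"
  unfolding cores_def by (erule coresolved.cases) (use additive_classD(1)[OF additive] cf_ob in blast)+

lemma cores_step: "\<lbrakk>cf X M X'; M \<in> \<M>; X' \<in> cores\<rbrakk> \<Longrightarrow> X \<in> cores"
  unfolding cores_def by (rule coresolved.step)

lemma res_step: "\<lbrakk>cf X' M X; M \<in> \<M>; X' \<in> res\<rbrakk> \<Longrightarrow> X \<in> res"
  unfolding res_def by (rule coresolved.step)

lemma cores_conf: 
  assumes "X \<in> cores"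
  obtains M X' where "cf X M X'" "M \<in> \<M>" "X' \<in> cores"
  using assms unfolding cores_def
proof cases
  case base
  obtain Z where Z: "null Z" using ex_null by blast
  show thesis
    using that[OF cf_id_null[OF Z additive_classD(1)[OF additive base]] base M_cores[OF additive_classD(2)[OF additive Z]]] .
next
  case (step M X')
  then show thesis using that unfolding cores_def by blast
qed

lemma res_conf: 
  assumes "X \<in> res"
  obtains M X' where "cf X' M X" "M \<in> \<M>" "X' \<in> res"
  using silting_calculus.cores_conf[OF dual_silting, unfolded dual_cores, OF assms] by blast

lemma res_ob: "A \<in> res \<Longrightarrow> A \<in> ob"
  using silting_calculus.cores_ob[OF dual_silting, unfolded dual_cores] by blast

lemma cores_add:
  assumes "A \<in> cores" "B \<in> \<M>" "bp A B S"
  shows "S \<in> cores"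
proof -
  obtain M X' where c: "cf A M X'" "M \<in> \<M>" "X' \<in> cores" using cores_conf[OF assms(1)] by blast
  obtain Z where Z: "null Z" using ex_null by blast
  obtain T where T: "bp M B T" using ex_bp additive_classD(1)[OF additive] c(2) assms(2) by blast
  have "cf S T X'"
    using cf_sum[OF c(1) cf_id_null[OF Z additive_classD(1)[OF additive assms(2)]] assms(3) T bp_null[OF Z cores_ob[OF c(3)]]] .
  then show ?thesis using cores_step c(3) additive_classD(3)[OF additive c(2) assms(2) T] by blast
qed

text \<open>
  Horseshoe argument by induction on the coresolution of \<open>X1\<close>: the pushout of \<open>E\<close> along the first step \<open>X1 \<rightarrow> M\<close> splits
  by orthogonality.
\<close>

lemma cores_ext:
  assumes "X1 \<in> cores" "X2 \<in> cores" "cf X1 E X2"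
  shows "E \<in> cores"
  using assms unfolding cores_def
proof (induction X1 arbitrary: X2 E rule: coresolved.induct)
  case (base X1)
  have "ort X2 X1" using base ort_cores_res M_res cores_def by blast
  from bp_swap[OF cf_split[OF base(3) this]] show ?case using cores_add base unfolding cores_def by blast
next
  case (step X1 M X1')
  obtain G where G: "cf M G X2" "cf E G X1'" using cf_pushout[OF step.hyps(1) step.prems(2)] by blast
  have X2: "X2 \<in> cores" using step.prems cores_def by blast
  have "bp M X2 G" using cf_split[OF G(1) ort_cores_res[OF X2 M_res[OF step.hyps(2)]]] .
  then have "G \<in> cores" using cores_add[OF X2 step.hyps(2) bp_swap] by blast
  then obtain M' G' where G': "cf G M' G'" "M' \<in> \<M>" "G' \<in> cores" using cores_conf by blast
  obtain H where H: "cf E M' H" "cf X1' H G'" using cf_comp_left[OF G(2) G'(1)] by blast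
  have "H \<in> coresolved cf \<M>" using step.IH[OF _ H(2)] G'(3) cores_def by blast
  then show ?case using coresolved.step[of cf, OF H(1) G'(2)] by blast
qed

lemma cores_bp: "\<lbrakk>A \<in> cores; B \<in> cores; bp A B S\<rbrakk> \<Longrightarrow> S \<in> cores"
  using cores_ext cf_bp by blast

text \<open>
  The cone of the composite \<open>K \<rightarrow> X1 \<rightarrow> M\<close> is an extension of two objects with a coresolution.
\<close>

lemma cores_cocone:
  assumes "cf K X1 X2" "X1 \<in> cores" "X2 \<in> cores"
  shows "K \<in> cores"
proof -
  obtain M X' where c: "cf X1 M X'" "M \<in> \<M>" "X' \<in> cores" using cores_conf[OF assms(2)] by blast
  obtain G where G: "cf K M G" "cf X2 G X'" using cf_comp_left[OF assms(1) c(1)] by blast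
  show ?thesis using cores_step[OF G(1) c(2) cores_ext[OF assms(3) c(3) G(2)]] .
qed

lemma res_ext: "\<lbrakk>X1 \<in> res; X2 \<in> res; cf X2 E X1\<rbrakk> \<Longrightarrow> E \<in> res"
  using silting_calculus.cores_ext[OF dual_silting, unfolded dual_cores] by blast

text \<open>
  Let \<open>T = A \<oplus> B\<close> have first step \<open>T \<rightarrow> N \<rightarrow> X'\<close>. The restrictions of \<open>T \<rightarrow> N\<close> to \<open>A\<close> and \<open>B\<close> are inflations with
  cones \<open>G\<close> and \<open>G'\<close>. Comparing \<open>T \<rightarrow> N\<close> with \<open>T \<rightarrow> N \<oplus> N\<close> by a pushout whose two conflations split shows that
  \<open>G\<close> is a summand of \<open>N \<oplus> N \<oplus> X'\<close>. The additional summand \<open>M\<close> in the statement makes the induction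
  hypothesis apply to this object.
\<close>

lemma cores_summand:
  assumes "D \<in> cores" "bp M D T" "M \<in> \<M>" "bp A B T"
  shows "A \<in> cores"
  using assms unfolding cores_def
proof (induction D arbitrary: M T A B rule: coresolved.induct)
  case (base D)
  then have "A \<in> \<M>" using additive_classD(3,4)[OF additive] by blast
  then show ?case by (rule coresolved.base)
next
  case (step D M0 X')
  have X': "X' \<in> cores" and D: "D \<in> cores" using step.hyps cores_def coresolved.step[of cf] by blast+
  obtain Z where Z: "null Z" using ex_null by blast
  note Mob = additive_classD(1)[OF additive]
  obtain N where N: "bp M M0 N" using ex_bp Mob step by blast
  then have NM: "N \<in> \<M>" using additive_classD(3)[OF additive] step by blast
  have c: "cf T N X'"
    using cf_sum[OF cf_id_null[OF Z Mob[OF step.prems(2)]] step.hyps(1) step.prems(1) N null_bp[OF Z cores_ob[OF X']]] .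
  have T: "T \<in> cores" using cores_add[OF D step.prems(2) bp_swap[OF step.prems(1)]] .
  obtain G where G: "cf A N G" "cf B G X'" using cf_comp_left[OF cf_bp[OF step.prems(3)] c] by blast
  obtain G' where G': "cf B N G'" "cf A G' X'"
    using cf_comp_left[OF cf_bp[OF bp_swap[OF step.prems(3)]] c] by blast
  obtain NN where NN: "bp N N NN" using ex_bp Mob NM by blast
  then have NNM: "NN \<in> \<M>" using additive_classD(3)[OF additive] NM by blast
  obtain GG where GG: "bp G G' GG" using ex_bp cf_ob G G' by blast
  have "cf T NN GG" using cf_sum[OF G(1) G'(1) step.prems(3) NN GG] .
  then obtain E where E: "cf N E GG" "cf NN E X'" using cf_pushout[OF c] by blast
  have oT: "ort T N" and oX: "ort X' N" "ort X' NN" using ort_cores_res M_res T X' NM NNM by blast+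
  have "ort B N" "ort A N" using ort_summand_left[OF _ oT] bp_swap step.prems(3) by blast+
  then have "ort G N" "ort G' N" using ort_middle_left[OF G(2)] ort_middle_left[OF G'(2)] oX by blast+
  then have "ort GG N" using ort_middle_left[OF cf_bp[OF GG]] by blast
  from cf_split[OF E(1) this] have "bp GG N E" by (rule bp_swap)
  then obtain U where "bp G U E" using bp_assoc[OF GG] by blast
  moreover have "bp NN X' E" using cf_split[OF E(2) oX(2)] .
  ultimately have "G \<in> coresolved cf \<M>" using step.IH NNM by blast
  then show ?case using coresolved.step[of cf, OF G(1) NM] by blast
qed

lemma cores_additive: "additive_class cores"
  unfolding additive_class_def
proof (intro conjI allI impI subsetI)
  fix A B S assume a: "S \<in> cores \<and> bp A B S"
  obtain Z where Z: "null Z" using ex_null by blast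
  show "A \<in> cores"
    using cores_summand[OF _ null_bp[OF Z] additive_classD(2)[OF additive Z]] cores_ob a by blast
next
  fix A B S assume "A \<in> cores \<and> B \<in> cores \<and> bp A B S"
  then show "S \<in> cores" using cores_bp by blast
qed (use cores_ob M_cores additive_classD(2)[OF additive] in blast)+

lemma cores_inter_res: "cores \<inter> res = \<M>"
proof
  show "cores \<inter> res \<subseteq> \<M>"
  proof
    fix Z assume Z: "Z \<in> cores \<inter> res"
    then obtain M X' where c: "cf Z M X'" "M \<in> \<M>" "X' \<in> cores" using cores_conf by blast
    then have "bp Z X' M" using cf_split ort_cores_res Z by blast
    then show "Z \<in> \<M>" using additive_classD(4)[OF additive c(2)] by blast
  qed
qed (use M_cores M_res in blast)

text \<open>
  The objects with a right approximation by a coresolved object whose kernel is resolved. By \<open>approximable_left\<close>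
  these are also the objects with a left approximation, so the class is self-dual.
\<close>

definition "approximable = {C. \<exists>Y\<in>res. \<exists>X\<in>cores. cf Y X C}"

lemma approximable_left: 
  assumes "C \<in> approximable"
  obtains Y X where "Y \<in> res" "X \<in> cores" "cf C Y X"
proof -
  obtain Y X where YX: "Y \<in> res" "X \<in> cores" "cf Y X C" using assms unfolding approximable_def by blast
  obtain M X' where c: "cf X M X'" "M \<in> \<M>" "X' \<in> cores" using cores_conf[OF YX(2)] by blast
  obtain Y' where "cf Y M Y'" "cf C Y' X'" using cf_comp_left[OF YX(3) c(1)] by blast
  then show thesis using that res_step c YX by blast
qed

lemma dual_approximable: "silting_calculus.approximable (\<lambda>A B C. cf C B A) \<M> = approximable"
proof
  interpret d: silting_calculus ob null bp "\<lambda>A B C. cf C B A" "\<lambda>C A. ort A C" \<M> by (rule dual_silting)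
  show "d.approximable \<subseteq> approximable"
  proof
    fix C assume "C \<in> d.approximable"
    then obtain Y X where "Y \<in> cores" "X \<in> res" "cf X Y C" by (rule d.approximable_left[unfolded dual_cores dual_res])
    then show "C \<in> approximable" unfolding approximable_def by blast
  qed
  show "approximable \<subseteq> d.approximable"
  proof
    fix C assume "C \<in> approximable"
    then obtain Y X where "Y \<in> res" "X \<in> cores" "cf C Y X" by (rule approximable_left)
    then show "C \<in> d.approximable" unfolding d.approximable_def dual_cores dual_res by blast
  qed
qed

lemma approximableI: "\<lbrakk>Y \<in> res; X \<in> cores; cf Y X C\<rbrakk> \<Longrightarrow> C \<in> approximable"
  unfolding approximable_def by blast

lemma cores_approximable:
  assumes "X \<in> cores"
  shows "X \<in> approximable"
proof -
  obtain Z where Z: "null Z" using ex_null by blast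
  show ?thesis
    using approximableI[OF M_res[OF additive_classD(2)[OF additive Z]] assms cf_null_id[OF Z cores_ob[OF assms]]] .
qed

lemma res_approximable: "X \<in> res \<Longrightarrow> X \<in> approximable"
  using silting_calculus.cores_approximable[OF dual_silting, unfolded dual_cores dual_approximable] by blast

lemma res_sum:
  assumes "Y \<in> res" "X \<in> cores" "bp Y X P"
  obtains Y' X' where "cf Y' X' P" "Y' \<in> res" "X' \<in> cores"
proof -
  obtain Z where Z: "null Z" using ex_null by blast
  obtain M Y' where c: "cf Y' M Y" "M \<in> \<M>" "Y' \<in> res" using res_conf[OF assms(1)] by blast
  obtain S where S: "bp M X S" using ex_bp cf_ob[OF c(1)] cores_ob[OF assms(2)] by blast
  have "cf Y' S P"
    using cf_sum[OF c(1) cf_null_id[OF Z cores_ob[OF assms(2)]] bp_null[OF Z res_ob[OF c(3)]] S assms(3)] .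
  then show thesis using that c cores_bp[OF M_cores[OF c(2)] assms(2) S] by blast
qed

text \<open>
  Push out along \<open>C1 \<rightarrow> Y1\<close> to get \<open>G\<close>, pull \<open>G\<close> back along \<open>X2 \<rightarrow> C2\<close> to get \<open>P\<close>, which splits as
  \<open>Y1 \<oplus> X2\<close> and hence is a quotient of a coresolved object \<open>X'\<close>. This makes \<open>G\<close> a quotient of \<open>X'\<close>, and the kernel
  \<open>Q\<close> of the composite \<open>X' \<rightarrow> G \<rightarrow> X1\<close> approximates \<open>E\<close>.
\<close>

lemma approximable_ext:
  assumes "C1 \<in> approximable" "C2 \<in> approximable" "cf C1 E C2"
  shows "E \<in> approximable"
proof -
  obtain Y1 X1 where 1: "Y1 \<in> res" "X1 \<in> cores" "cf C1 Y1 X1" using approximable_left[OF assms(1)] by blast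
  obtain Y2 X2 where 2: "Y2 \<in> res" "X2 \<in> cores" "cf Y2 X2 C2" using assms(2) unfolding approximable_def by blast
  obtain G where G: "cf Y1 G C2" "cf E G X1" using cf_pushout[OF 1(3) assms(3)] by blast
  obtain P where P: "cf Y1 P X2" "cf Y2 P G" using cf_pullback[OF G(1) 2(3)] by blast
  have "bp Y1 X2 P" using cf_split[OF P(1) ort_cores_res[OF 2(2) 1(1)]] .
  then obtain Y' X' where Y': "cf Y' X' P" "Y' \<in> res" "X' \<in> cores" using res_sum[OF 1(1) 2(2)] by blast
  obtain K where K: "cf K X' G" "cf Y' K Y2" using cf_comp_right[OF P(2) Y'(1)] by blast
  have KW: "K \<in> res" using res_ext[OF 2(1) Y'(2) K(2)] .
  obtain Q where Q: "cf Q X' X1" "cf K Q E" using cf_comp_right[OF G(2) K(1)] by blast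
  have "Q \<in> cores" using cores_cocone[OF Q(1) Y'(3) 1(2)] .
  then show ?thesis using approximableI[OF KW _ Q(2)] by blast
qed

text \<open>
  The kernel \<open>G\<close> of \<open>X2 \<rightarrow> C2 \<rightarrow> C\<close> is an extension of approximable objects; the pushout along its left approximation
  has a middle term that is coresolved.
\<close>

lemma approximable_cone:
  assumes "C1 \<in> approximable" "C2 \<in> approximable" "cf C1 C2 C"
  shows "C \<in> approximable"
proof -
  obtain Y2 X2 where 2: "Y2 \<in> res" "X2 \<in> cores" "cf Y2 X2 C2" using assms(2) unfolding approximable_def by blast
  obtain G where G: "cf G X2 C" "cf Y2 G C1" using cf_comp_right[OF assms(3) 2(3)] by blast
  have "G \<in> approximable" using approximable_ext[OF res_approximable[OF 2(1)] assms(1) G(2)] .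
  then obtain Y X where YX: "Y \<in> res" "X \<in> cores" "cf G Y X" using approximable_left by blast
  obtain H where H: "cf X2 H X" "cf Y H C" using cf_pushout[OF G(1) YX(3)] by blast
  show ?thesis using approximableI[OF YX(1) cores_ext[OF 2(2) YX(2) H(1)] H(2)] .
qed

lemma approximable_cocone: "\<lbrakk>C1 \<in> approximable; C2 \<in> approximable; cf C C2 C1\<rbrakk> \<Longrightarrow> C \<in> approximable"
  using silting_calculus.approximable_cone[OF dual_silting, unfolded dual_approximable] by blast

text \<open>
  For \<open>D = A \<oplus> B\<close>, let \<open>L\<close> and \<open>L'\<close> be the kernels of the composites \<open>X \<rightarrow> D \<rightarrow> A\<close> and \<open>X \<rightarrow> D \<rightarrow> B\<close>. Pulling back
  \<open>X \<oplus> X \<rightarrow> D\<close> along \<open>X \<rightarrow> D\<close> relates \<open>L \<oplus> L'\<close> to \<open>K\<close>.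
\<close>

lemma summand_kernels:
  assumes "K \<in> res" "X \<in> cores" "cf K X D" "bp A B D"
  obtains L L' LL XX P where "cf L X A" "bp L L' LL" "bp K XX P" "XX \<in> cores" "cf LL P X"
proof -
  obtain L where L: "cf L X A" using cf_comp_right[OF cf_bp[OF bp_swap[OF assms(4)]] assms(3)] by blast
  obtain L' where L': "cf L' X B" using cf_comp_right[OF cf_bp[OF assms(4)] assms(3)] by blast
  obtain LL where LL: "bp L L' LL" using ex_bp cf_ob L L' by blast
  obtain XX where XX: "bp X X XX" using ex_bp cores_ob[OF assms(2)] by blast
  then have XXV: "XX \<in> cores" using cores_bp assms(2) by blast
  obtain P where P: "cf K P XX" "cf LL P X"
    using cf_pullback[OF assms(3) cf_sum[OF L L' LL XX assms(4)]] by blast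
  \<comment> \<open>Orthogonality of \<open>XX\<close> to \<open>K\<close> splits the other conflation through \<open>P\<close>.\<close>
  then have "bp K XX P" using cf_split ort_cores_res[OF XXV assms(1)] by blast
  then show thesis using that L LL XXV P by blast
qed

text \<open>
  Induction on the resolution \<open>K1 \<rightarrow> M \<rightarrow> K\<close>. The object \<open>LL = L \<oplus> L'\<close> is again approximated by a coresolved object
  \<open>Q\<close>, but with the shorter kernel \<open>K1\<close>, so \<open>L\<close> is approximable, and \<open>A\<close> is the cone of \<open>L \<rightarrow> X\<close>. If
  \<open>K\<close> lies in \<open>\<M>\<close>, then \<open>LL\<close> itself is coresolved.
\<close>

lemma approximable_summand_aux:
  assumes "K \<in> res" "X \<in> cores" "cf K X D" "bp A B D"
  shows "A \<in> approximable"
  using assms(1)[unfolded res_def] assms(2-)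
proof (induction K arbitrary: X D A B rule: coresolved.induct)
  case (base K)
  obtain L L' LL XX P where L: "cf L X A" "bp L L' LL" "bp K XX P" "XX \<in> cores" "cf LL P X"
    using summand_kernels[OF M_res[OF base(1)] base(2-4)] by metis
  have "LL \<in> cores" using cores_cocone[OF L(5) cores_bp[OF M_cores[OF base(1)] L(4,3)] base(2)] .
  then have "L \<in> cores" using additive_classD(4)[OF cores_additive _ L(2)] by blast
  then show ?case using approximable_cone[OF cores_approximable cores_approximable L(1)] base(2) by blast
next
  case (step K M K1)
  have K: "K \<in> res" "K1 \<in> res" using coresolved.step[of "\<lambda>A B C. cf C B A", OF step.hyps] step.hyps res_def by blast+
  obtain L L' LL XX P where L: "cf L X A" "bp L L' LL" "bp K XX P" "XX \<in> cores" "cf LL P X"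
    using summand_kernels[OF K(1) step.prems] by metis
  obtain Z where Z: "null Z" using ex_null by blast
  obtain S where S: "bp M XX S" using ex_bp cf_ob[OF step.hyps(1)] cores_ob[OF L(4)] by blast
  have SV: "S \<in> cores" using cores_bp[OF M_cores[OF step.hyps(2)] L(4) S] .
  have "cf K1 S P"
    using cf_sum[OF step.hyps(1) cf_null_id[OF Z cores_ob[OF L(4)]] bp_null[OF Z res_ob[OF K(2)]] S L(3)] .
  then obtain Q where Q: "cf Q S X" "cf K1 Q LL" using cf_comp_right[OF L(5)] by blast
  have "Q \<in> cores" using cores_cocone[OF Q(1) SV step.prems(1)] .
  then have "L \<in> approximable" using step.IH[OF _ Q(2) L(2)] by blast
  then show ?case using approximable_cone[OF _ cores_approximable L(1)] step.prems(1) by blast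
qed

lemma approximable_summand: "\<lbrakk>D \<in> approximable; bp A B D\<rbrakk> \<Longrightarrow> A \<in> approximable"
  unfolding approximable_def[of] using approximable_summand_aux approximable_def by blast

lemma approximable_ob: "C \<in> approximable \<Longrightarrow> C \<in> ob"
  unfolding approximable_def using cf_ob by blast

lemma approximable_additive: "additive_class approximable"
  unfolding additive_class_def
  using approximable_ob approximable_summand approximable_ext cf_bp M_cores[THEN cores_approximable] additive_classD(2)[OF additive] by blast

lemma approximable_bounded: "C \<in> approximable \<Longrightarrow> C \<in> coresolved (\<lambda>A B C. cf C B A) cores"
proof -
  assume "C \<in> approximable"
  then obtain Y X where YX: "Y \<in> res" "X \<in> cores" "cf Y X C" unfolding approximable_def by blast
  have "Y \<in> coresolved (\<lambda>A B C. cf C B A) cores"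
    using coresolved_mono[of \<M> cores] YX(1)[unfolded res_def] M_cores by blast
  then show ?thesis using coresolved.step[of "\<lambda>A B C. cf C B A", OF YX(3,2)] by blast
qed

end

section \<open>From cotorsion pairs to silting subcategories\<close>

text \<open>
  The closure properties and the lifting axiom hold for hereditary cotorsion pairs; unlike the vanishing of higher
  extensions they are visibly self-dual.
\<close>

locale cotorsion_calculus = conflation_calculus ob null bp cf ort
  for ob :: "'o set" and null bp cf ort +
  fixes \<X> \<Y> :: "'o set"
  assumes X_additive: "additive_class \<X>" and Y_additive: "additive_class \<Y>"
    and orthogonal: "\<lbrakk>X \<in> \<X>; Y \<in> \<Y>\<rbrakk> \<Longrightarrow> ort X Y"
    and right_approx: "C \<in> ob \<Longrightarrow> \<exists>Y\<in>\<Y>. \<exists>X\<in>\<X>. cf Y X C"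
    and left_approx: "C \<in> ob \<Longrightarrow> \<exists>Y\<in>\<Y>. \<exists>X\<in>\<X>. cf C Y X"
    and X_cocone: "\<lbrakk>X1 \<in> \<X>; X2 \<in> \<X>; cf K X1 X2\<rbrakk> \<Longrightarrow> K \<in> \<X>"
    and Y_cone: "\<lbrakk>Y1 \<in> \<Y>; Y2 \<in> \<Y>; cf Y1 Y2 C\<rbrakk> \<Longrightarrow> C \<in> \<Y>"
    and lift: "\<lbrakk>X \<in> \<X>; Y \<in> \<Y>; cf K B X; cf Y W K\<rbrakk> \<Longrightarrow> \<exists>V. cf Y V B \<and> cf W V X"
begin

lemma dual_cotorsion: "cotorsion_calculus ob null bp (\<lambda>A B C. cf C B A) (\<lambda>C A. ort A C) \<Y> \<X>"
proof -
  interpret d: conflation_calculus ob null bp "\<lambda>A B C. cf C B A" "\<lambda>C A. ort A C" by (rule dual)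
  show ?thesis
  proof (unfold_locales, goal_cases)
    case 1 then show ?case by (rule Y_additive)
  next
    case 2 then show ?case by (rule X_additive)
  next
    case 3 then show ?case by (intro orthogonal)
  next
    case 4 then show ?case using left_approx by blast
  next
    case 5 then show ?case using right_approx by blast
  next
    case 6 then show ?case using Y_cone by blast
  next
    case 7 then show ?case using X_cocone by blast
  next
    case 8 then show ?case using lift by blast
  qed
qed

text \<open>
  The class \<open>\<X>\<close> contains every object that is orthogonal to \<open>\<Y>\<close>, because its right approximation splits.
\<close>

lemma X_ext:
  assumes "X1 \<in> \<X>" "X2 \<in> \<X>" "cf X1 E X2"
  shows "E \<in> \<X>"
proof -
  obtain Y X where YX: "Y \<in> \<Y>" "X \<in> \<X>" "cf Y X E" using right_approx cf_ob[OF assms(3)] by blast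
  have "ort E Y" using ort_middle_left[OF assms(3)] orthogonal assms YX by blast
  then have "bp E Y X" using bp_swap[OF cf_split[OF YX(3)]] by blast
  then show ?thesis using additive_classD(4)[OF X_additive YX(2)] by blast
qed

lemma Y_ext: "\<lbrakk>Y1 \<in> \<Y>; Y2 \<in> \<Y>; cf Y1 E Y2\<rbrakk> \<Longrightarrow> E \<in> \<Y>"
  using cotorsion_calculus.X_ext[OF dual_cotorsion] by blast

definition "cores = coresolved cf (\<X> \<inter> \<Y>)"

lemma cores_X: "A \<in> cores \<Longrightarrow> A \<in> \<X>"
  unfolding cores_def by (induction rule: coresolved.induct) (auto intro: X_cocone)

text \<open>
  Finite coresolutions by objects of \<open>\<Y>\<close> all of whose proper cosyzygies lie in \<open>\<X>\<close>. Compared with the objects of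
  \<open>\<Y>\<^sup>\<or>\<close>, this makes the cosyzygies orthogonal to \<open>\<Y>\<close>, so that the splittings in \<open>tame_summand\<close> and the
  liftings in \<open>tame_ext\<close> are available.
\<close>

inductive tame where
  tame_base: "Y \<in> \<Y> \<Longrightarrow> tame Y"
| tame_step: "\<lbrakk>cf C Y X; Y \<in> \<Y>; X \<in> \<X>; tame X\<rbrakk> \<Longrightarrow> tame C"

lemma tame_ext:
  assumes "tame D" "Y \<in> \<Y>" "cf Y E D"
  shows "tame E"
  using assms(1)
proof cases
  case tame_base
  then show ?thesis using Y_ext[OF assms(2) _ assms(3)] tame.tame_base by blast
next
  case (tame_step Y1 X1)
  obtain U where U: "cf Y U Y1" "cf E U X1" using lift[OF tame_step(3) assms(2) tame_step(1) assms(3)] by blast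
  have "U \<in> \<Y>" using Y_ext[OF assms(2) tame_step(2) U(1)] .
  then show ?thesis using tame.tame_step[OF U(2)] tame_step by blast
qed

text \<open>
  Schanuel's lemma: let \<open>C \<rightarrow> Y0 \<rightarrow> K\<close> be the first step of a tame object. The induced step of \<open>T = Y \<oplus> C\<close> with cone \<open>K\<close>
  and the sum of the left approximations of
  \<open>X\<close> and \<open>U\<close> have a common pushout \<open>E\<close> that splits in both ways. So the cone \<open>X1\<close> of the approximation of \<open>X\<close> is a summand of
  \<open>N \<oplus> K\<close>, where \<open>N \<in> \<Y>\<close>, and the induction hypothesis applies to it. The middle term of the approximation
  lies in \<open>\<X> \<inter> \<Y>\<close>.
\<close>

lemma tame_summand:
  assumes "tame K" "Y \<in> \<Y>" "bp Y K T" "bp X U T" "X \<in> \<X>"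
  shows "X \<in> cores"
  using assms
proof (induction K arbitrary: Y T X U rule: tame.induct)
  case (tame_base K)
  then have "X \<in> \<Y>" using additive_classD(3,4)[OF Y_additive] by blast
  then show ?case using tame_base unfolding cores_def by (blast intro: coresolved.base)
next
  case (tame_step C Y0 K)
  obtain Z where Z: "null Z" using ex_null by blast
  note Yob = additive_classD(1)[OF Y_additive] and Xob = additive_classD(1)[OF X_additive]
  obtain Y0' where Y0': "bp Y Y0 Y0'" using ex_bp Yob tame_step by blast
  then have Y0'Y: "Y0' \<in> \<Y>" using additive_classD(3)[OF Y_additive] tame_step by blast
  have c: "cf T Y0' K"
    using cf_sum[OF cf_id_null[OF Z Yob[OF tame_step.prems(1)]] tame_step.hyps(1) tame_step.prems(2) Y0'
        null_bp[OF Z Xob[OF tame_step.hyps(3)]]] .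
  obtain M1 X1 where X1: "M1 \<in> \<Y>" "X1 \<in> \<X>" "cf X M1 X1" using left_approx Xob tame_step.prems(4) by blast
  have M1: "M1 \<in> \<X>" using X_ext[OF tame_step.prems(4) X1(2,3)] .
  obtain YU XU where XU: "YU \<in> \<Y>" "XU \<in> \<X>" "cf U YU XU" using left_approx bp_ob[OF tame_step.prems(3)] by blast
  obtain N where N: "bp M1 YU N" using ex_bp Yob X1 XU by blast
  then have NY: "N \<in> \<Y>" using additive_classD(3)[OF Y_additive] X1 XU by blast
  obtain G where G: "bp X1 XU G" using ex_bp Xob X1 XU by blast
  then have GX: "G \<in> \<X>" using additive_classD(3)[OF X_additive] X1 XU by blast
  have "cf T N G" using cf_sum[OF X1(3) XU(3) tame_step.prems(3) N G] .
  then obtain E where E: "cf Y0' E G" "cf N E K" using cf_pushout[OF c] by blast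
  have "bp G Y0' E" using bp_swap[OF cf_split[OF E(1) orthogonal[OF GX Y0'Y]]] .
  then obtain S where S: "bp X1 S E" using bp_assoc[OF G] by blast
  have "bp N K E" using cf_split[OF E(2) orthogonal[OF tame_step.hyps(3) NY]] .
  then have "X1 \<in> cores" using tame_step.IH[OF NY _ S X1(2)] by blast
  then show ?case unfolding cores_def using coresolved.step[of cf, OF X1(3)] M1 X1(1) by blast
qed

lemma cores_tame: "X \<in> cores \<Longrightarrow> tame X"
  unfolding cores_def
proof (induction rule: coresolved.induct)
  case (base X) then show ?case by (blast intro: tame.tame_base)
next
  case (step X M X')
  then show ?case using tame.tame_step[OF step(1)] cores_X cores_def by blast
qed

text \<open>
  An arbitrary coresolution step \<open>C \<rightarrow> Y0 \<rightarrow> K\<close> is replaced by the left approximation of \<open>C\<close>: its cone \<open>X\<close> is a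
  summand of a tame extension \<open>E\<close> of \<open>K\<close>, hence coresolved by \<open>tame_summand\<close>, hence tame.
\<close>

lemma tame_coresolved:
  assumes "C \<in> coresolved cf \<Y>"
  shows "tame C"
  using assms
proof (induction rule: coresolved.induct)
  case (base Y) then show ?case by (rule tame.tame_base)
next
  case (step C Y0 K)
  obtain Z where Z: "null Z" using ex_null by blast
  obtain Y X where YX: "Y \<in> \<Y>" "X \<in> \<X>" "cf C Y X" using left_approx cf_ob[OF step(1)] by blast
  obtain E where E: "cf Y0 E X" "cf Y E K" using cf_pushout[OF step(1) YX(3)] by blast
  have "tame E" using tame_ext[OF step.IH YX(1) E(2)] .
  moreover have "bp X Y0 E" using bp_swap[OF cf_split[OF E(1) orthogonal[OF YX(2) step(2)]]] .
  moreover have "bp Z E E" using null_bp[OF Z] cf_ob[OF E(1)] by blast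
  ultimately have "X \<in> cores" using tame_summand additive_classD(2)[OF Y_additive Z] YX(2) by blast
  then show ?case using tame.tame_step[OF YX(3,1,2)] cores_tame by blast
qed

theorem X_coresolved:
  assumes "ob \<subseteq> coresolved cf \<Y>"
  shows "\<X> = coresolved cf (\<X> \<inter> \<Y>)"
proof
  show "coresolved cf (\<X> \<inter> \<Y>) \<subseteq> \<X>" using cores_X cores_def by blast
  show "\<X> \<subseteq> coresolved cf (\<X> \<inter> \<Y>)"
  proof
    fix X assume X: "X \<in> \<X>"
    obtain Z where Z: "null Z" using ex_null by blast
    note o = additive_classD(1)[OF X_additive X]
    have "tame X" using tame_coresolved assms o by blast
    from tame_summand[OF this additive_classD(2)[OF Y_additive Z] null_bp[OF Z o] bp_null[OF Z o] X]
    show "X \<in> coresolved cf (\<X> \<inter> \<Y>)" by (simp add: cores_def)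
  qed
qed

theorem Y_resolved:
  assumes "ob \<subseteq> coresolved (\<lambda>A B C. cf C B A) \<X>"
  shows "\<Y> = coresolved (\<lambda>A B C. cf C B A) (\<X> \<inter> \<Y>)"
  using cotorsion_calculus.X_coresolved[OF dual_cotorsion assms] by (simp add: Int_commute)

end

section \<open>The bijection\<close>

context extriangulated_category
begin

abbreviation (input) cof where "cof \<equiv> (\<lambda>A B C. conf \<C> C B A)"

interpretation calc: conflation_calculus "Obj \<C>" "zero_object \<C>" "biproduct_of \<C>" "conf \<C>" "orth \<C>"
  by (rule conflation_calculus_instance)

lemma conflation_iff: "(\<exists>f g. conflation \<C> A f B g C) \<longleftrightarrow> conf \<C> A B C"
  unfolding conflation_def conf_def realizes_def extension_def by blast

lemma extension_cat_conf: "extension_cat \<C> \<X> \<Y> = {M. \<exists>X\<in>\<X>. \<exists>Y\<in>\<Y>. conf \<C> X M Y}"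
  unfolding extension_cat_def conflation_iff ..
lemma Cone_conf: "Cone \<C> \<X> \<Y> = {M. \<exists>X\<in>\<X>. \<exists>Y\<in>\<Y>. conf \<C> X Y M}"
  unfolding Cone_def conflation_iff ..
lemma Cocone_conf: "Cocone \<C> \<X> \<Y> = {M. \<exists>X\<in>\<X>. \<exists>Y\<in>\<Y>. conf \<C> M X Y}"
  unfolding Cocone_def conflation_iff ..

text \<open>
  Closure under isomorphisms follows because an isomorphism exhibits its target as a biproduct of its source with a zero object.
\<close>

lemma additive_class_iff: "calc.additive_class \<X> \<longleftrightarrow> subcategory \<C> \<X> \<and> summand_closed \<C> \<X>"
proof
  assume a: "calc.additive_class \<X>"
  note A = calc.additive_classD[OF a]
  have "Y \<in> \<X>" if XY: "X \<in> \<X>" "is_iso \<C> X Y f" for X Y f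
  proof -
    obtain Z where Z: "zero_object \<C> Z" using ex_zero_object by blast
    obtain g where g: "arr X Y f" "arr Y X g" "g \<cdot> f = Ide \<C> X" "f \<cdot> g = Ide \<C> Y" using isoE[OF XY(2)] by metis
    have "biproduct_of \<C> X Z Y"
      unfolding biproduct_of_def using biproduct_iso[OF biproduct_zero[OF Z A(1)[OF XY(1)]] g] by blast
    then show ?thesis by (rule A(3)[OF XY(1) A(2)[OF Z]])
  qed
  then show "subcategory \<C> \<X> \<and> summand_closed \<C> \<X>"
    unfolding subcategory_def summand_closed_def using a
    unfolding calc.additive_class_def biproduct_of_def by blast
next
  assume "subcategory \<C> \<X> \<and> summand_closed \<C> \<X>"
  then show "calc.additive_class \<X>"
    unfolding subcategory_def summand_closed_def calc.additive_class_def biproduct_of_def by blast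
qed

text \<open>
  The coresolutions of length zero are those with a zero cone; since such a conflation splits, they contribute only objects of \<open>\<M>\<close>.
\<close>

lemma vee_coresolved:
  assumes a: "calc.additive_class \<M>"
  shows "vee \<C> \<M> = coresolved (conf \<C>) \<M>"
proof
  have "X \<in> coresolved (conf \<C>) \<M>" if "X \<in> vee_n \<C> \<M> n" for X n
    using that
  proof (induction n arbitrary: X)
    case 0
    then obtain M Z where c: "M \<in> \<M>" "zero_object \<C> Z" "conf \<C> X M Z" by (auto simp: Cocone_conf)
    have "orth \<C> Z X" using calc.ort_null_left[OF c(2)] calc.cf_ob[OF c(3)] by blast
    from calc.additive_classD(4)[OF a c(1) calc.cf_split[OF c(3) this]]
    show ?case by (rule coresolved.base)
  next
    case (Suc n)
    then show ?case by (auto simp: Cocone_conf intro: coresolved.step)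
  qed
  then show "vee \<C> \<M> \<subseteq> coresolved (conf \<C>) \<M>" by (auto simp: vee_def)
  have "\<exists>n. X \<in> vee_n \<C> \<M> n" if "X \<in> coresolved (conf \<C>) \<M>" for X
    using that
  proof induction
    case (base X)
    obtain Z where Z: "zero_object \<C> Z" using ex_zero_object by blast
    have "X \<in> vee_n \<C> \<M> 0"
      using calc.cf_id_null[OF Z calc.additive_classD(1)[OF a base]] base Z by (auto simp: Cocone_conf)
    then show ?case ..
  next
    case (step X M X')
    then obtain n where "X' \<in> vee_n \<C> \<M> n" by blast
    then have "X \<in> vee_n \<C> \<M> (Suc n)" using step by (auto simp: Cocone_conf)
    then show ?case ..
  qed
  then show "coresolved (conf \<C>) \<M> \<subseteq> vee \<C> \<M>" by (auto simp: vee_def)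
qed

lemma Cone_op: "Cone \<C> \<X> \<Y> = Cocone (op_cat \<C>) \<Y> \<X>"
proof -
  interpret op: extriangulated_category R "op_cat \<C>" by (rule op_extriangulated)
  show ?thesis unfolding Cone_conf op.Cocone_conf by auto
qed

lemma wedge_op: "wedge \<C> \<M> = vee (op_cat \<C>) \<M>"
proof -
  have "wedge_n \<C> \<M> n = vee_n (op_cat \<C>) \<M> n" for n
    by (induction n) (simp_all add: Cone_op)
  then show ?thesis by (simp add: wedge_def vee_def)
qed

lemma wedge_coresolved:
  assumes a: "calc.additive_class \<M>"
  shows "wedge \<C> \<M> = coresolved cof \<M>"
proof -
  interpret op: extriangulated_category R "op_cat \<C>" by (rule op_extriangulated)
  have "zero_object (op_cat \<C>) = zero_object \<C>" "biproduct_of (op_cat \<C>) = biproduct_of \<C>"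
    "conf (op_cat \<C>) = cof" by (simp_all add: fun_eq_iff)
  then show ?thesis using op.vee_coresolved[of \<M>] a by (simp add: wedge_op)
qed

lemma hvanish_iff:
  assumes "\<X> \<subseteq> Obj \<C>" "\<Y> \<subseteq> Obj \<C>"
  shows "higher_ext_vanishes R \<C> k \<X> \<Y> \<longleftrightarrow> (\<forall>X\<in>\<X>. \<forall>Y\<in>\<Y>. hvanish k X Y)"
  using assms unfolding higher_ext_vanishes_def hvanish_def by blast

lemma is_thick_iff:
  "is_thick \<C> \<T> \<longleftrightarrow> calc.additive_class \<T> \<and>
     (\<forall>A B C. conf \<C> A B C \<longrightarrow> (A \<in> \<T> \<and> C \<in> \<T> \<longrightarrow> B \<in> \<T>) \<and> (A \<in> \<T> \<and> B \<in> \<T> \<longrightarrow> C \<in> \<T>) \<and>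
       (B \<in> \<T> \<and> C \<in> \<T> \<longrightarrow> A \<in> \<T>))"
  unfolding is_thick_def additive_class_iff extension_cat_conf Cone_conf Cocone_conf by blast

lemma thick_Obj: "is_thick \<C> (Obj \<C>)"
  unfolding is_thick_iff calc.additive_class_def
  using calc.cf_ob calc.bp_ob zero_obj by blast

lemma coresolved_thick:
  assumes t: "is_thick \<C> \<T>" and "\<M> \<subseteq> \<T>"
  shows "coresolved (conf \<C>) \<M> \<subseteq> \<T>" "coresolved cof \<M> \<subseteq> \<T>"
proof -
  have A: "A \<in> \<T>" if "conf \<C> A B C" "B \<in> \<T>" "C \<in> \<T>" for A B C
    using t that unfolding is_thick_iff by blast
  have C: "C \<in> \<T>" if "conf \<C> A B C" "A \<in> \<T>" "B \<in> \<T>" for A B C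
    using t that unfolding is_thick_iff by blast
  have "X \<in> \<T>" if "X \<in> coresolved (conf \<C>) \<M>" for X
    using that by induction (use assms(2) A in blast)+
  then show "coresolved (conf \<C>) \<M> \<subseteq> \<T>" by blast
  have "X \<in> \<T>" if "X \<in> coresolved cof \<M>" for X
    using that by induction (use assms(2) C in blast)+
  then show "coresolved cof \<M> \<subseteq> \<T>" by blast
qed

lemma additive_Int: "\<lbrakk>calc.additive_class \<X>; calc.additive_class \<Y>\<rbrakk> \<Longrightarrow> calc.additive_class (\<X> \<inter> \<Y>)"
  unfolding calc.additive_class_def by blast

text \<open>
  An object without extensions by \<open>\<Y>\<close> lies in \<open>\<X>\<close>, and dually, so the transfers of vanishing give the closure and lifting
  axioms of \<open>cotorsion_calculus\<close>. A thick subcategory that contains \<open>\<X> \<inter> \<Y>\<close> then contains \<open>\<X>\<close>,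
  and so everything by boundedness.
\<close>

lemma cotorsion_pair_silting:
  assumes "(\<X>, \<Y>) \<in> bounded_hereditary_cotorsion_pairs R \<C>"
  shows "\<X> \<inter> \<Y> \<in> silt R \<C>" "\<Psi> \<C> (\<X> \<inter> \<Y>) = (\<X>, \<Y>)"
proof -
  have X: "calc.additive_class \<X>" and Y: "calc.additive_class \<Y>"
    and orth: "\<And>A B. \<lbrakk>A \<in> \<X>; B \<in> \<Y>\<rbrakk> \<Longrightarrow> exts \<C> A B = {ze A B}"
    and cone: "Obj \<C> = Cone \<C> \<Y> \<X>" and cocone: "Obj \<C> = Cocone \<C> \<Y> \<X>"
    and her: "hereditary R \<C> \<X> \<Y>" and wedge: "Obj \<C> = wedge \<C> \<X>" and vee: "Obj \<C> = vee \<C> \<Y>"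
    using assms unfolding bounded_hereditary_cotorsion_pairs_def cotorsion_pair_def bounded_def additive_class_iff
    by auto
  note Xob = calc.additive_classD(1)[OF X] and Yob = calc.additive_classD(1)[OF Y]
  have o: "orth \<C> A B" if "A \<in> \<X>" "B \<in> \<Y>" for A B
    using orth[OF that] Xob Yob that by (simp add: orth_def)
  have h: "hvanish k A B" if "k \<ge> 1" "A \<in> \<X>" "B \<in> \<Y>" for k A B
  proof (cases "k = 1")
    case True then show ?thesis using hvanish_1 o that by simp
  next
    case False
    then have "k \<ge> 2" using that by simp
    then show ?thesis
      using her that hvanish_iff[of \<X> \<Y> k] Xob Yob unfolding hereditary_def by blast
  qed
  interpret cot: cotorsion_calculus "Obj \<C>" "zero_object \<C>" "biproduct_of \<C>" "conf \<C>" "orth \<C>" \<X> \<Y>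
  proof (unfold_locales, goal_cases)
    case 1 show ?case by (rule X)
  next
    case 2 show ?case by (rule Y)
  next
    case 3 then show ?case by (rule o)
  next
    case 4 then show ?case using cone unfolding Cone_conf by blast
  next
    case 5 then show ?case using cocone unfolding Cocone_conf by blast
  next
    case (6 X1 X2 K)
    obtain B A where BA: "B \<in> \<Y>" "A \<in> \<X>" "conf \<C> B A K"
      using cone calc.cf_ob[OF 6(3)] unfolding Cone_conf by blast
    have "hvanish (Suc 0) K B"
      using hvanish_kernel[OF 6(3), of 0 B] h[of 1 X1 B] h[of "Suc (Suc 0)" X2 B] 6 BA by simp
    then have "biproduct_of \<C> B K A" using calc.cf_split[OF BA(3)] hvanish_1 by blast
    then show ?case using calc.additive_classD(4)[OF X BA(2)] calc.bp_swap by blast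
  next
    case (7 Y1 Y2 C)
    obtain B A where BA: "B \<in> \<Y>" "A \<in> \<X>" "conf \<C> C B A"
      using cocone calc.cf_ob[OF 7(3)] unfolding Cocone_conf by blast
    have "hvanish (Suc 0) A C"
      using hvanish_cokernel[OF 7(3), of 0 A] h[of 1 A Y2] h[of "Suc (Suc 0)" A Y1] 7 BA by simp
    then have "biproduct_of \<C> C A B" using calc.cf_split[OF BA(3)] hvanish_1 by blast
    then show ?case using calc.additive_classD(4)[OF Y BA(1)] by blast
  next
    case (8 A B K D W)
    then show ?case using conf_lift[OF h[of 2 A B]] by simp
  qed
  have XV: "\<X> = coresolved (conf \<C>) (\<X> \<inter> \<Y>)"
    using cot.X_coresolved vee vee_coresolved[OF Y] by simp
  have YW: "\<Y> = coresolved cof (\<X> \<inter> \<Y>)"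
    using cot.Y_resolved wedge wedge_coresolved[OF X] by simp
  note M = additive_Int[OF X Y]
  show "\<Psi> \<C> (\<X> \<inter> \<Y>) = (\<X>, \<Y>)"
    unfolding \<Psi>_def vee_coresolved[OF M] wedge_coresolved[OF M] XV[symmetric] YW[symmetric] ..
  have "Obj \<C> \<subseteq> \<T>" if t: "is_thick \<C> \<T>" "\<X> \<inter> \<Y> \<subseteq> \<T>" for \<T>
  proof -
    have "\<X> \<subseteq> \<T>" using coresolved_thick(1)[OF t] XV by simp
    then show ?thesis using coresolved_thick(2)[OF t(1), of \<X>] wedge wedge_coresolved[OF X] by simp
  qed
  then have "Obj \<C> = thick \<C> (\<X> \<inter> \<Y>)"
    unfolding thick_def using thick_Obj calc.additive_classD(1)[OF M] by blast
  moreover have "higher_ext_vanishes R \<C> k (\<X> \<inter> \<Y>) (\<X> \<inter> \<Y>)" if "k \<ge> 1" for k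
    using hvanish_iff[of "\<X> \<inter> \<Y>" "\<X> \<inter> \<Y>" k] h[OF that] Xob by blast
  ultimately show "\<X> \<inter> \<Y> \<in> silt R \<C>"
    using M unfolding silt_def additive_class_iff by blast
qed

text \<open>
  Vanishing is first extended from \<open>\<M>\<close> to \<open>\<M>\<^sup>\<or>\<close> in the contravariant variable and then to \<open>\<M>\<^sup>\<and>\<close> in the covariant
  one. The second step raises the degree, so it has to be carried out for all degrees at once.
\<close>

lemma silting_cotorsion_pair:
  assumes "\<M> \<in> silt R \<C>"
  shows "\<Psi> \<C> \<M> \<in> bounded_hereditary_cotorsion_pairs R \<C>" "\<Phi> (\<Psi> \<C> \<M>) = \<M>"
proof -
  have M: "calc.additive_class \<M>" and van: "\<And>k. k \<ge> 1 \<Longrightarrow> higher_ext_vanishes R \<C> k \<M> \<M>"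
    and thick: "Obj \<C> = thick \<C> \<M>"
    using assms unfolding silt_def additive_class_iff by auto
  have hM: "hvanish (Suc k) A B" if "A \<in> \<M>" "B \<in> \<M>" for k A B
    using van[of "Suc k"] hvanish_iff[of \<M> \<M> "Suc k"] calc.additive_classD(1)[OF M] that by auto
  have hV: "hvanish (Suc k) X B" if "X \<in> coresolved (conf \<C>) \<M>" "B \<in> \<M>" for k X B
    using that
  proof (induction arbitrary: k)
    case (base X) then show ?case by (simp add: hM)
  next
    case (step X M X') then show ?case using hvanish_kernel[OF step(1)] hM by blast
  qed
  have h: "hvanish (Suc k) X Y" if "Y \<in> coresolved cof \<M>" "X \<in> coresolved (conf \<C>) \<M>" for k X Y
    using that
  proof (induction arbitrary: k)
    case (base X) then show ?case by (simp add: hV)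
  next
    case (step X M X') then show ?case using hvanish_cokernel[OF step(1)] hV by blast
  qed
  interpret sil: silting_calculus "Obj \<C>" "zero_object \<C>" "biproduct_of \<C>" "conf \<C>" "orth \<C>" \<M>
  proof (unfold_locales, goal_cases)
    case 1 show ?case by (rule M)
  next
    case (2 X Y) then show ?case using h[of Y X 0] hvanish_1 by simp
  qed
  interpret dual: silting_calculus "Obj \<C>" "zero_object \<C>" "biproduct_of \<C>" cof "\<lambda>C A. orth \<C> A C" \<M>
    by (rule sil.dual_silting)
  note dual = sil.dual_cores sil.dual_res sil.dual_approximable
  have "is_thick \<C> sil.approximable"
    unfolding is_thick_iff using sil.approximable_additive sil.approximable_ext sil.approximable_cone sil.approximable_cocone by blast
  then have "Obj \<C> \<subseteq> sil.approximable"
    using thick sil.M_cores sil.cores_approximable unfolding thick_def by blast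
  then have T: "sil.approximable = Obj \<C>" using sil.approximable_ob by blast
  have W: "calc.additive_class sil.res"
    using dual.cores_additive unfolding dual .
  note V = sil.cores_additive
  have \<Psi>: "\<Psi> \<C> \<M> = (sil.cores, sil.res)"
    unfolding \<Psi>_def vee_coresolved[OF M] wedge_coresolved[OF M] sil.cores_def sil.res_def ..
  show "\<Phi> (\<Psi> \<C> \<M>) = \<M>"
    unfolding \<Psi> \<Phi>_def using sil.cores_inter_res by simp
  have "Obj \<C> = Cone \<C> sil.res sil.cores"
    unfolding Cone_conf T[symmetric] sil.approximable_def ..
  moreover have "Obj \<C> = Cocone \<C> sil.res sil.cores"
    unfolding Cocone_conf T[symmetric] unfolding dual(3)[symmetric] dual.approximable_def unfolding dual by blast
  moreover have "exts \<C> X Y = {ze X Y}" if "X \<in> sil.cores" "Y \<in> sil.res" for X Y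
    using sil.ort_cores_res[OF that] by (simp add: orth_def)
  ultimately have "cotorsion_pair \<C> sil.cores sil.res"
    unfolding cotorsion_pair_def using V[unfolded additive_class_iff] W[unfolded additive_class_iff] by blast
  moreover have "hereditary R \<C> sil.cores sil.res"
    unfolding hereditary_def
  proof (intro allI impI)
    fix k :: nat assume "k \<ge> 2"
    then obtain j where "k = Suc j" by (cases k) auto
    then show "higher_ext_vanishes R \<C> k sil.cores sil.res"
      using hvanish_iff[of sil.cores sil.res k] sil.cores_ob sil.res_ob h unfolding sil.cores_def sil.res_def by blast
  qed
  moreover have "bounded \<C> sil.cores sil.res"
  proof -
    have "Obj \<C> = coresolved cof sil.cores"
      using sil.approximable_bounded T coresolved_thick(2)[OF thick_Obj, of sil.cores] sil.cores_ob by blast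
    moreover have "Obj \<C> = coresolved (conf \<C>) sil.res"
      using dual.approximable_bounded[unfolded dual] T coresolved_thick(1)[OF thick_Obj, of sil.res] sil.res_ob by blast
    ultimately show ?thesis
      unfolding bounded_def vee_coresolved[OF W] wedge_coresolved[OF V] by blast
  qed
  ultimately show "\<Psi> \<C> \<M> \<in> bounded_hereditary_cotorsion_pairs R \<C>"
    unfolding \<Psi> bounded_hereditary_cotorsion_pairs_def by simp
qed

end

theorem theorem5p7:
  fixes R :: "('r, 'y) ring_scheme" and \<C> :: "('o, 'm, 'r, 'e, 'z) extri_cat_scheme"
  assumes "extriangulated_category R \<C>"
  shows "bij_betw \<Phi> (bounded_hereditary_cotorsion_pairs R \<C>) (silt R \<C>) \<and>
         bij_betw (\<Psi> \<C>) (silt R \<C>) (bounded_hereditary_cotorsion_pairs R \<C>) \<and>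
         (\<forall>p\<in>bounded_hereditary_cotorsion_pairs R \<C>. \<Psi> \<C> (\<Phi> p) = p) \<and>
         (\<forall>\<M>\<in>silt R \<C>. \<Phi> (\<Psi> \<C> \<M>) = \<M>)"
proof -
  interpret extriangulated_category R \<C> by fact
  have \<Phi>: "\<Phi> p \<in> silt R \<C>" "\<Psi> \<C> (\<Phi> p) = p" if "p \<in> bounded_hereditary_cotorsion_pairs R \<C>" for p
    using cotorsion_pair_silting[of "fst p" "snd p"] that by (simp_all add: \<Phi>_def split_beta)
  note \<Psi> = silting_cotorsion_pair
  have "bij_betw \<Phi> (bounded_hereditary_cotorsion_pairs R \<C>) (silt R \<C>)"
    by (rule bij_betw_byWitness[where f' = "\<Psi> \<C>"]) (use \<Phi> \<Psi> in auto)
  moreover have "bij_betw (\<Psi> \<C>) (silt R \<C>) (bounded_hereditary_cotorsion_pairs R \<C>)"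
    by (rule bij_betw_byWitness[where f' = \<Phi>]) (use \<Phi> \<Psi> in auto)
  ultimately show ?thesis using \<Phi> \<Psi> by simp
qed

end
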